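(* Assume $\theta>2$. Let $v$ be a step function with $N$ jumps as described in the context, let $\alpha:=\frac12+\frac1\theta$ and $k_j:=\sum_{m=1}^{j}\alpha^m$ for $j\in\mathbb{N}$, $j\ge 1$, and fix such a $j$. For each sufficiently small $\varepsilon>0$ let $u^\varepsilon$ be the solution of $$u_t=Q(\varepsilon^2u_x)_x-F'(u)\ \text{ in }(a,b)\times(0,\infty),\qquad u_x(a,t)=u_x(b,t)=0\ (t>0),\qquad u(x,0)=u_0^\varepsilon(x),$$ with $|u^\varepsilon_x(x,t)|\le\kappa\varepsilon^{-2}$ for all $x\in[a,b]$, $t\ge0$, and $u^\varepsilon\in C([0,T],H^2(a,b))\cap C^1([0,T],H^1(a,b))$ for every $T>0$. Assume that $$\lim_{\varepsilon\to0^+}\|u_0^\varepsilon-v\|_{L^1(a,b)}=0$$ and that there exist $C,\varepsilon_0>0$ such that $E_\varepsilon[u_0^\varepsilon]\le Nc_\varepsilon+C\varepsilon^{k_j}$ for any $\varepsilon\in(0,\varepsilon_0)$. Then, for any $l>0$, $$\sup_{0\le t\le l\varepsilon^{-k_j}}\|u^\varepsilon(\cdot,t)-v\|_{L^1(a,b)}\longrightarrow0\qquad\text{as }\varepsilon\to0^+.$$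
   Context: Here $a<b$ are real. Assumptions on $Q$: $Q\in C^1(\mathbb{R})$, $Q(-s)=-Q(s)$ for all $s$, $\lim_{s\to\pm\infty}Q(s)=Q(0)=0$, and there is $\kappa>0$ with $Q'(s)>0$ for $s\in(-\kappa,\kappa)$ and $Q'(s)<0$ for $|s|>\kappa$. Assumptions on $F$ (with parameter $\theta$): $F\in C^1(\mathbb{R})$, $F(\pm1)=F'(\pm1)=0$, $F(u)>0$ for all $u\ne\pm1$, and there are constants $0<\lambda_1\le\lambda_2$, $\eta>0$ such that, for each choice of sign, $\lambda_1|1\pm u|^{\theta-2}\le\frac{F'(u)}{u\pm1}\le\lambda_2|1\pm u|^{\theta-2}$ for $|u\pm1|<\eta$ (understood for $u\ne\mp1$, where the quotient is defined). Step function $v$: $N\in\mathbb{N}$, $N\ge1$, and $v:[a,b]\to\{-1,+1\}$ is piecewise constant with exactly $N$ jumps located at $a<h_1<\dots<h_N<b$; $r>0$ is such that the intervals $(h_i-r,h_i+r)$ are pairwise disjoint, $a\le h_1-r$ and $h_N+r\le b$. Notation: $\tilde Q(s):=\int_0^sQ(t)\,dt$, $\ell:=\kappa Q(\kappa)-\tilde Q(\kappa)>0$, $P_\varepsilon(s):=\int_0^s\varepsilon^2z\,Q'(\varepsilon^2z)\,dz$; $J_\varepsilon:[0,\ell\varepsilon^{-2}]\to[0,\kappa\varepsilon^{-2}]$ is the inverse of the increasing bijection $P_\varepsilon:[0,\kappa\varepsilon^{-2}]\to[0,\ell\varepsilon^{-2}]$. Energy: $E_\varepsilon[u]:=\int_a^b\Big[\frac{\tilde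 Q(\varepsilon^2u_x)}{\varepsilon^3}+\frac{F(u)}{\varepsilon}\Big]dx$. Minimal transition energy: $c_\varepsilon:=\varepsilon^{-1}\int_{-1}^{1}Q\big(\varepsilon^2J_\varepsilon(F(s))\big)\,ds$, defined for $0<\varepsilon<\sqrt{\ell/\max_{[-1,1]}F}$. *)

theory Defs
  imports "HOL-Analysis.Analysis"
begin

section \<open>Sobolev spaces on a bounded interval\<close>

text \<open>Functions are representatives of their classes modulo null sets; all notions below
  are invariant under changing a function on a null subset of \<open>(a, b)\<close>.\<close>

definition test_function :: "real \<Rightarrow> real \<Rightarrow> (real \<Rightarrow> real) \<Rightarrow> bool" where
  "test_function a b \<phi> \<longleftrightarrow>
     (\<forall>n x. ((deriv ^^ n) \<phi>) field_differentiable (at x)) \<and>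
     closure {x. \<phi> x \<noteq> 0} \<subseteq> {a<..<b}"

definition locally_integrable :: "real \<Rightarrow> real \<Rightarrow> (real \<Rightarrow> real) \<Rightarrow> bool" where
  "locally_integrable a b f \<longleftrightarrow>
     (\<forall>c d. a < c \<and> d < b \<longrightarrow> integrable (lebesgue_on {c..d}) f)"

definition has_weak_deriv :: "real \<Rightarrow> real \<Rightarrow> (real \<Rightarrow> real) \<Rightarrow> (real \<Rightarrow> real) \<Rightarrow> bool" where
  "has_weak_deriv a b f g \<longleftrightarrow>
     locally_integrable a b f \<and> locally_integrable a b g \<and>
     (\<forall>\<phi>. test_function a b \<phi> \<longrightarrow>
        (\<integral>x. f x * deriv \<phi> x \<partial>lebesgue_on {a<..<b}) =
        - (\<integral>x. g x * \<phi> x \<partial>lebesgue_on {a<..<b}))"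

text \<open>Weak derivatives are unique up to a null set, so the choice does not affect integrals.\<close>

definition weak_deriv :: "real \<Rightarrow> real \<Rightarrow> (real \<Rightarrow> real) \<Rightarrow> real \<Rightarrow> real" where
  "weak_deriv a b f = (SOME g. has_weak_deriv a b f g)"

definition square_integrable :: "real \<Rightarrow> real \<Rightarrow> (real \<Rightarrow> real) \<Rightarrow> bool" where
  "square_integrable a b f \<longleftrightarrow>
     f \<in> borel_measurable (lebesgue_on {a<..<b}) \<and>
     integrable (lebesgue_on {a<..<b}) (\<lambda>x. (f x)\<^sup>2)"

primrec sobolev_H :: "nat \<Rightarrow> real \<Rightarrow> real \<Rightarrow> (real \<Rightarrow> real) \<Rightarrow> bool" where
  "sobolev_H 0 a b f \<longleftrightarrow> square_integrable a b f"
| "sobolev_H (Suc k) a b f \<longleftrightarrow>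
     square_integrable a b f \<and> (\<exists>g. has_weak_deriv a b f g \<and> sobolev_H k a b g)"

primrec sobolev_norm :: "nat \<Rightarrow> real \<Rightarrow> real \<Rightarrow> (real \<Rightarrow> real) \<Rightarrow> real" where
  "sobolev_norm 0 a b f = sqrt (\<integral>x. (f x)\<^sup>2 \<partial>lebesgue_on {a<..<b})"
| "sobolev_norm (Suc k) a b f =
     sqrt ((\<integral>x. (f x)\<^sup>2 \<partial>lebesgue_on {a<..<b}) + (sobolev_norm k a b (weak_deriv a b f))\<^sup>2)"

text \<open>Curves \<open>u :: time \<Rightarrow> space \<Rightarrow> value\<close> in \<open>C([0,T], H\<^sup>k(a,b))\<close>, and curves in
  \<open>C\<^sup>1([0,T], H\<^sup>k(a,b))\<close> with (strong) time derivative \<open>w\<close>.\<close>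

definition C0_sobolev :: "nat \<Rightarrow> real \<Rightarrow> real \<Rightarrow> real \<Rightarrow> (real \<Rightarrow> real \<Rightarrow> real) \<Rightarrow> bool" where
  "C0_sobolev k a b T u \<longleftrightarrow>
     (\<forall>t\<in>{0..T}. sobolev_H k a b (u t) \<and>
        ((\<lambda>s. sobolev_norm k a b (\<lambda>x. u s x - u t x)) \<longlongrightarrow> 0) (at t within {0..T}))"

definition C1_sobolev ::
  "nat \<Rightarrow> real \<Rightarrow> real \<Rightarrow> real \<Rightarrow> (real \<Rightarrow> real \<Rightarrow> real) \<Rightarrow> (real \<Rightarrow> real \<Rightarrow> real) \<Rightarrow> bool" where
  "C1_sobolev k a b T u w \<longleftrightarrow>
     C0_sobolev k a b T u \<and> C0_sobolev k a b T w \<and>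
     (\<forall>t\<in>{0..T}.
        ((\<lambda>s. sobolev_norm k a b (\<lambda>x. (u s x - u t x) / (s - t) - w t x)) \<longlongrightarrow> 0)
          (at t within {0..T}))"

definition L1_norm :: "real \<Rightarrow> real \<Rightarrow> (real \<Rightarrow> real) \<Rightarrow> real" where
  "L1_norm a b f = (\<integral>x. \<bar>f x\<bar> \<partial>lebesgue_on {a<..<b})"


section \<open>Nonlinearities, step functions, energy\<close>

definition admissible_Q :: "(real \<Rightarrow> real) \<Rightarrow> real \<Rightarrow> bool" where
  "admissible_Q Q \<kappa> \<longleftrightarrow>
     Q C1_differentiable_on UNIV \<and>
     (\<forall>s. Q (- s) = - Q s) \<and>
     (Q \<longlongrightarrow> 0) at_top \<and> (Q \<longlongrightarrow> 0) at_bot \<and> Q 0 = 0 \<and>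
     \<kappa> > 0 \<and>
     (\<forall>s. - \<kappa> < s \<and> s < \<kappa> \<longrightarrow> deriv Q s > 0) \<and>
     (\<forall>s. \<bar>s\<bar> > \<kappa> \<longrightarrow> deriv Q s < 0)"

text \<open>The sign \<open>\<sigma>\<close> stands for the choice of \<open>\<plusminus>\<close>.\<close>

definition admissible_F :: "(real \<Rightarrow> real) \<Rightarrow> real \<Rightarrow> bool" where
  "admissible_F F \<theta> \<longleftrightarrow>
     F C1_differentiable_on UNIV \<and>
     F 1 = 0 \<and> F (- 1) = 0 \<and> deriv F 1 = 0 \<and> deriv F (- 1) = 0 \<and>
     (\<forall>u. u \<noteq> 1 \<and> u \<noteq> - 1 \<longrightarrow> F u > 0) \<and>
     (\<exists>c\<^sub>1 c\<^sub>2 \<eta>. 0 < c\<^sub>1 \<and> c\<^sub>1 \<le> c\<^sub>2 \<and> 0 < \<eta> \<and>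
        (\<forall>\<sigma>\<in>{1, - 1}. \<forall>u. \<bar>u + \<sigma>\<bar> < \<eta> \<and> u \<noteq> - \<sigma> \<longrightarrow>
           c\<^sub>1 * \<bar>1 + \<sigma> * u\<bar> powr (\<theta> - 2) \<le> deriv F u / (u + \<sigma>) \<and>
           deriv F u / (u + \<sigma>) \<le> c\<^sub>2 * \<bar>1 + \<sigma> * u\<bar> powr (\<theta> - 2)))"

text \<open>The jump points are \<open>h 1 < \<dots> < h N\<close>; the values of \<open>v\<close> at the jump points are
  unconstrained elements of \<open>{-1, 1}\<close>.\<close>

definition step_function ::
  "real \<Rightarrow> real \<Rightarrow> nat \<Rightarrow> (nat \<Rightarrow> real) \<Rightarrow> real \<Rightarrow> (real \<Rightarrow> real) \<Rightarrow> bool" where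
  "step_function a b N h r v \<longleftrightarrow>
     N \<ge> 1 \<and>
     strict_mono_on {1..N} h \<and> (\<forall>i\<in>{1..N}. a < h i \<and> h i < b) \<and>
     (\<forall>x\<in>{a..b}. v x \<in> {- 1, 1}) \<and>
     (\<forall>x y. a \<le> x \<and> x \<le> y \<and> y \<le> b \<and> {x..y} \<inter> h ` {1..N} = {} \<longrightarrow> v x = v y) \<and>
     (\<forall>i\<in>{1..N}. \<exists>p q. p \<noteq> q \<and> (v \<longlongrightarrow> p) (at_left (h i)) \<and> (v \<longlongrightarrow> q) (at_right (h i))) \<and>
     r > 0 \<and> disjoint_family_on (\<lambda>i. {h i - r<..<h i + r}) {1..N} \<and>
     a \<le> h 1 - r \<and> h N + r \<le> b"

definition Q_tilde :: "(real \<Rightarrow> real) \<Rightarrow> real \<Rightarrow> real" where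
  "Q_tilde Q s = (LBINT t=0..ereal s. Q t)"

definition P_eps :: "(real \<Rightarrow> real) \<Rightarrow> real \<Rightarrow> real \<Rightarrow> real" where
  "P_eps Q \<epsilon> s = (LBINT z=0..ereal s. \<epsilon>\<^sup>2 * z * deriv Q (\<epsilon>\<^sup>2 * z))"

definition J_eps :: "(real \<Rightarrow> real) \<Rightarrow> real \<Rightarrow> real \<Rightarrow> real \<Rightarrow> real" where
  "J_eps Q \<kappa> \<epsilon> = inv_into {0..\<kappa> / \<epsilon>\<^sup>2} (P_eps Q \<epsilon>)"

text \<open>Meaningful for \<open>0 < \<epsilon> < sqrt (\<ell> / max F)\<close>, the maximum being over \<open>[-1,1]\<close> and
  \<open>\<ell> = \<kappa> * Q \<kappa> - Q_tilde Q \<kappa>\<close>: then \<open>F\<close> maps \<open>[-1,1]\<close> into \<open>[0, \<ell> / \<epsilon>\<^sup>2]\<close>, which is the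
  image of \<open>[0, \<kappa> / \<epsilon>\<^sup>2]\<close> under \<open>P_eps Q \<epsilon>\<close>.\<close>

definition c_eps :: "(real \<Rightarrow> real) \<Rightarrow> real \<Rightarrow> (real \<Rightarrow> real) \<Rightarrow> real \<Rightarrow> real" where
  "c_eps Q \<kappa> F \<epsilon> = (LBINT s=-1..1. Q (\<epsilon>\<^sup>2 * J_eps Q \<kappa> \<epsilon> (F s))) / \<epsilon>"

text \<open>Classical space derivative on \<open>[a, b]\<close>, one-sided at the end points.\<close>

definition space_deriv :: "real \<Rightarrow> real \<Rightarrow> (real \<Rightarrow> real) \<Rightarrow> real \<Rightarrow> real" where
  "space_deriv a b f x = vector_derivative f (at x within {a..b})"

definition energy ::
  "(real \<Rightarrow> real) \<Rightarrow> (real \<Rightarrow> real) \<Rightarrow> real \<Rightarrow> real \<Rightarrow> real \<Rightarrow> (real \<Rightarrow> real) \<Rightarrow> real" where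
  "energy Q F a b \<epsilon> u =
     (LBINT x=ereal a..ereal b. Q_tilde Q (\<epsilon>\<^sup>2 * space_deriv a b u x) / \<epsilon> ^ 3 + F (u x) / \<epsilon>)"


section \<open>The initial-boundary value problem\<close>

text \<open>An element of \<open>H\<^sup>2(a,b)\<close> has a unique representative in \<open>C\<^sup>1([a,b])\<close>; the differentiability
  requirement selects it, so that \<open>u\<^sub>x\<close> makes sense at every point of \<open>[a, b]\<close>. The
  evolution equation is an equality in \<open>L\<^sup>2(a,b)\<close> for each \<open>t > 0\<close>, where \<open>w\<close> is \<open>u\<^sub>t\<close>
  and \<open>g\<close> is \<open>Q(\<epsilon>\<^sup>2 u\<^sub>x)\<^sub>x\<close>.\<close>

definition is_solution ::
  "(real \<Rightarrow> real) \<Rightarrow> real \<Rightarrow> (real \<Rightarrow> real) \<Rightarrow> real \<Rightarrow> real \<Rightarrow> real \<Rightarrow> (real \<Rightarrow> real) \<Rightarrow>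
   (real \<Rightarrow> real \<Rightarrow> real) \<Rightarrow> bool" where
  "is_solution Q \<kappa> F a b \<epsilon> u\<^sub>0 u \<longleftrightarrow>
     (\<forall>t\<ge>0. \<forall>x\<in>{a..b}. u t differentiable (at x within {a..b})) \<and>
     (\<forall>T>0. C0_sobolev 2 a b T u) \<and>
     (\<exists>w. (\<forall>T>0. C1_sobolev 1 a b T u w) \<and>
        (\<forall>t>0. \<exists>g. has_weak_deriv a b (\<lambda>x. Q (\<epsilon>\<^sup>2 * space_deriv a b (u t) x)) g \<and>
           (AE x in lebesgue_on {a<..<b}. w t x = g x - deriv F (u t x)))) \<and>
     (\<forall>t>0. space_deriv a b (u t) a = 0 \<and> space_deriv a b (u t) b = 0) \<and>
     (\<forall>x\<in>{a..b}. u 0 x = u\<^sub>0 x) \<and>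
     (\<forall>t\<ge>0. \<forall>x\<in>{a..b}. \<bar>space_deriv a b (u t) x\<bar> \<le> \<kappa> / \<epsilon>\<^sup>2)"

definition k_exp :: "real \<Rightarrow> nat \<Rightarrow> real" where
  "k_exp \<theta> j = (\<Sum>m=1..j. (1 / 2 + 1 / \<theta>) ^ m)"

end

theory Submission
  imports Defs
begin

text \<open>
  Why the solution stays near the step function. The equation is the gradient flow of the energy,
  so the time it needs to move is controlled by the energy that it can still lose. If the energy
  drops by \<open>d\<close> during a time \<open>T\<close>, the displacement in \<open>L\<^sup>1\<close> is at most of order \<open>sqrt (\<epsilon> d T)\<close>
  (\<open>L1_displacement_le_dissipation\<close>). Initially the energy exceeds \<open>N c\<^sub>\<epsilon>\<close> by at most
  \<open>C \<epsilon>\<^sup>k\<close> with \<open>k = k\<^sub>j\<close>; while the solution remains \<open>L\<^sup>1\<close>-close to \<open>v\<close>, its energy is at least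
  \<open>N c\<^sub>\<epsilon> - K \<epsilon>\<^sup>k\<close> (\<open>energy_lower_bound\<close>). Hence \<open>d\<close> is of order \<open>\<epsilon>\<^sup>k\<close>, the displacement up to
  time \<open>l \<epsilon>\<^sup>-\<^sup>k\<close> is of order \<open>sqrt \<epsilon>\<close>, and continuity in time prevents the solution from ever reaching
  the boundary of the neighbourhood in which the lower bound is available.

  The lower bound. Convexity of \<open>Q_tilde\<close> on \<open>[-\<kappa>, \<kappa>]\<close> yields a weight with
  \<open>weight \<epsilon> u * \<bar>u\<^sub>x\<bar>\<close> below the energy density, and \<open>c\<^sub>\<epsilon>\<close> is the integral of the weight from
  \<open>-1\<close> to \<open>1\<close>. A passage between points where \<open>F u \<le> A\<close>, one near each well, therefore costs at
  least \<open>c\<^sub>\<epsilon> - 2 L A\<^sup>\<alpha>\<close> with \<open>\<alpha> = 1/2 + 1/\<theta>\<close>, because \<open>F\<close> behaves like the power \<open>\<theta>\<close> of the distance to the well and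
  the weight is at most a multiple of \<open>sqrt F\<close>. If the part of the energy near the jumps is known to be at
  least \<open>N c\<^sub>\<epsilon> - K \<epsilon>\<^sup>k\<close>, then only \<open>O(\<epsilon>\<^sup>k)\<close> is left elsewhere, so next to the jumps there are points with
  \<open>F u = O(\<epsilon>\<^sup>k\<^sup>+\<^sup>1)\<close>, and the bound improves to the exponent \<open>\<alpha> (1 + k)\<close>
  (\<open>energy_lower_bound_step\<close>). Starting from \<open>k = 0\<close>, \<open>j\<close> such steps give exactly \<open>k\<^sub>j\<close>.

  The dissipation inequality. At a positive time \<open>t\<close> the equation identifies the derivative of the flux
  \<open>Q (\<epsilon>\<^sup>2 u\<^sub>x)\<close>, and convexity of \<open>Q_tilde\<close> bounds the energy at earlier times from below by its
  linearisation at time \<open>t\<close>. This gives a one-sided estimate of the energy increments from the left, and a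
  continuous function whose left increments are almost nonpositive is nonincreasing
  (\<open>nonincreasing_if_left_increments\<close>), so neither the energy nor the \<open>L\<^sup>1\<close> distance has to be
  differentiated or integrated in time.

  Weak derivatives are made classical by one formula: if \<open>f\<close> is everywhere the derivative of some
  function and has the weak derivative \<open>g\<close>, then \<open>f d - f c\<close> is the integral of \<open>g\<close>
  (\<open>weak_deriv_increment\<close>). It is obtained by testing with smoothed trapezoids whose ramps
  become steep.
\<close>

section \<open>Smooth cutoff functions\<close>

definition smooth :: "(real \<Rightarrow> real) \<Rightarrow> bool" where
  "smooth f \<longleftrightarrow> (\<forall>n x. ((deriv ^^ n) f) field_differentiable (at x))"

lemma smooth_coinduct:
  assumes "f \<in> S" "\<And>g x. g \<in> S \<Longrightarrow> g field_differentiable (at x)" "\<And>g. g \<in> S \<Longrightarrow> deriv g \<in> S"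
  shows "smooth f"
proof -
  have "(deriv ^^ n) f \<in> S" for n
    by (induction n) (use assms in auto)
  then show ?thesis
    unfolding smooth_def using assms by blast
qed

lemma smooth_field_differentiable: "smooth f \<Longrightarrow> f field_differentiable (at x)"
  unfolding smooth_def by (metis funpow_0)

lemma smooth_DERIV: "smooth f \<Longrightarrow> (f has_real_derivative deriv f x) (at x)"
  using smooth_field_differentiable field_differentiable_derivI by blast

lemma smooth_continuous_on: "smooth f \<Longrightarrow> continuous_on S f"
  by (meson DERIV_isCont continuous_at_imp_continuous_on smooth_DERIV)

lemma smooth_deriv: "smooth f \<Longrightarrow> smooth (deriv f)"
  unfolding smooth_def by (metis comp_apply funpow_Suc_right)

lemma smooth_antiderivative:
  assumes "\<And>x. (f has_real_derivative f' x) (at x)" "smooth f'"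
  shows "smooth f"
proof -
  have "deriv f = f'"
    using assms(1) DERIV_imp_deriv by blast
  moreover have "f field_differentiable (at x)" for x
    using assms(1) field_differentiable_def by blast
  ultimately show ?thesis
    using assms(2) by (intro smooth_coinduct[of _ "insert f {g. smooth g}"])
      (auto simp: smooth_field_differentiable smooth_deriv)
qed

inductive_set sums_of_smooth_products :: "(real \<Rightarrow> real) set" where
  product: "smooth f \<Longrightarrow> smooth g \<Longrightarrow> (\<lambda>x. f x * g x) \<in> sums_of_smooth_products"
| sum: "p \<in> sums_of_smooth_products \<Longrightarrow> q \<in> sums_of_smooth_products \<Longrightarrow>
    (\<lambda>x. p x + q x) \<in> sums_of_smooth_products"

text \<open>The Leibniz rule leaves the set of products of two smooth functions but not the set of finite sums of
such products, so coinduction is applied to the latter.\<close>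

lemma smooth_mult:
  assumes "smooth f" "smooth g"
  shows "smooth (\<lambda>x. f x * g x)"
proof (rule smooth_coinduct[OF sums_of_smooth_products.product[OF assms]])
  have *: "(\<forall>x. p field_differentiable (at x)) \<and> deriv p \<in> sums_of_smooth_products"
    if "p \<in> sums_of_smooth_products" for p
    using that
  proof induction
    case (product f g)
    have D: "((\<lambda>x. f x * g x) has_real_derivative deriv f x * g x + deriv g x * f x) (at x)" for x
      by (intro DERIV_mult smooth_DERIV product)
    then have "deriv (\<lambda>x. f x * g x) = (\<lambda>x. deriv f x * g x + deriv g x * f x)"
      using DERIV_imp_deriv by blast
    with D product show ?case
      by (auto simp: field_differentiable_def
          intro!: sums_of_smooth_products.intros smooth_deriv)
  next
    case (sum p q)
    have D: "((\<lambda>x. p x + q x) has_real_derivative deriv p x + deriv q x) (at x)" for x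
      by (intro DERIV_add) (use sum field_differentiable_derivI in blast)+
    then have "deriv (\<lambda>x. p x + q x) = (\<lambda>x. deriv p x + deriv q x)"
      using DERIV_imp_deriv by blast
    with D sum show ?case
      by (auto simp: field_differentiable_def intro!: sums_of_smooth_products.intros)
  qed
  show "\<And>g x. g \<in> sums_of_smooth_products \<Longrightarrow> g field_differentiable (at x)"
    "\<And>g. g \<in> sums_of_smooth_products \<Longrightarrow> deriv g \<in> sums_of_smooth_products"
    using * by blast+
qed

lemma smooth_diff:
  assumes "smooth f" "smooth g"
  shows "smooth (\<lambda>x. f x - g x)"
proof (rule smooth_coinduct[of _ "{\<lambda>x. p x - q x |p q. smooth p \<and> smooth q}"])
  have D: "((\<lambda>x. p x - q x) has_real_derivative deriv p x - deriv q x) (at x)"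
    if "smooth p" "smooth q" for p q x
    by (intro DERIV_diff smooth_DERIV that)
  then have "deriv (\<lambda>x. p x - q x) = (\<lambda>x. deriv p x - deriv q x)" if "smooth p" "smooth q" for p q
    using that DERIV_imp_deriv by blast
  then show "\<And>g. g \<in> {\<lambda>x. p x - q x |p q. smooth p \<and> smooth q} \<Longrightarrow>
      deriv g \<in> {\<lambda>x. p x - q x |p q. smooth p \<and> smooth q}"
    using smooth_deriv by fastforce
  show "\<And>g x. g \<in> {\<lambda>x. p x - q x |p q. smooth p \<and> smooth q} \<Longrightarrow> g field_differentiable at x"
    using D by (auto simp: field_differentiable_def)
qed (use assms in blast)

lemma smooth_affine:
  assumes "smooth f"
  shows "smooth (\<lambda>x. k * f (m * x + e))"
proof (rule smooth_coinduct[of _ "{\<lambda>x. k * f (m * x + e) |k f. smooth f}"])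
  have D: "((\<lambda>x. k * f (m * x + e)) has_real_derivative (k * m) * deriv f (m * x + e)) (at x)"
    if "smooth f" for f k x
  proof -
    have "((\<lambda>x. f (m * x + e)) has_real_derivative deriv f (m * x + e) * m) (at x)"
      by (rule DERIV_chain2[OF smooth_DERIV[OF that]]) (auto intro!: derivative_eq_intros)
    from DERIV_cmult[OF this, of k] show ?thesis
      by (simp add: algebra_simps)
  qed
  then have eq: "deriv (\<lambda>x. k * f (m * x + e)) = (\<lambda>x. (k * m) * deriv f (m * x + e))"
    if "smooth f" for f k
    using that DERIV_imp_deriv by blast
  show "deriv g \<in> {\<lambda>x. k * f (m * x + e) |k f. smooth f}"
    if g: "g \<in> {\<lambda>x. k * f (m * x + e) |k f. smooth f}" for g
  proof -
    obtain k f where f: "g = (\<lambda>x. k * f (m * x + e))" "smooth f"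
      using g by blast
    with eq have "deriv g = (\<lambda>x. (k * m) * deriv f (m * x + e))"
      by blast
    with smooth_deriv[OF f(2)] show ?thesis
      by blast
  qed
  show "\<And>g x. g \<in> {\<lambda>x. k * f (m * x + e) |k f. smooth f} \<Longrightarrow> g field_differentiable at x"
    using D by (auto simp: field_differentiable_def)
qed (use assms in blast)

text \<open>The functions \<open>p(1/x) exp(-1/x)\<close> for \<open>x > 0\<close>, extended by \<open>0\<close>. This family is closed under
differentiation, which makes its members smooth; \<open>flat_exp 1\<close> is the usual building block of cutoffs.\<close>

definition flat_exp :: "real poly \<Rightarrow> real \<Rightarrow> real" where
  "flat_exp p x = (if x > 0 then poly p (1 / x) * exp (- (1 / x)) else 0)"

lemma poly_times_exp_minus_tendsto_0:
  "((\<lambda>y::real. poly p y * exp (- y)) \<longlongrightarrow> 0) at_top"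
proof -
  have "((\<lambda>y::real. \<Sum>i\<le>degree p. coeff p i * (y ^ i / exp y)) \<longlongrightarrow> (\<Sum>i\<le>degree p. coeff p i * 0)) at_top"
    by (intro tendsto_intros tendsto_power_div_exp_0)
  then show ?thesis
    by (simp add: poly_altdef sum_distrib_right exp_minus divide_inverse mult.assoc)
qed

lemma flat_exp_DERIV:
  "(flat_exp p has_real_derivative flat_exp ([:0, 0, 1:] * (p - pderiv p)) x) (at x)"
proof -
  consider "x > 0" | "x < 0" | "x = 0"
    by linarith
  then show ?thesis
  proof cases
    case 1
    have D: "((\<lambda>x. poly p (1 / x) * exp (- (1 / x))) has_real_derivative
        poly (pderiv p) (1 / x) * (- (1 / x\<^sup>2)) * exp (- (1 / x)) +
        exp (- (1 / x)) * (1 / x\<^sup>2) * poly p (1 / x)) (at x)"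
      using 1 by (auto intro!: derivative_eq_intros DERIV_chain2[OF poly_DERIV] simp: power2_eq_square)
    have eq: "poly (pderiv p) (1 / x) * (- (1 / x\<^sup>2)) * exp (- (1 / x)) +
        exp (- (1 / x)) * (1 / x\<^sup>2) * poly p (1 / x) = flat_exp ([:0, 0, 1:] * (p - pderiv p)) x"
      using 1 by (simp add: flat_exp_def algebra_simps power2_eq_square)
    have "\<forall>\<^sub>F y in nhds x. y \<in> {0<..}"
      using 1 by (intro eventually_nhds_in_open) auto
    then have "\<forall>\<^sub>F y in nhds x. poly p (1 / y) * exp (- (1 / y)) = flat_exp p y"
      by eventually_elim (simp add: flat_exp_def)
    from DERIV_cong_ev[OF refl this eq] D show ?thesis
      by (rule iffD1)
  next
    case 2
    have "\<forall>\<^sub>F y in nhds x. y \<in> {..<0}"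
      using 2 by (intro eventually_nhds_in_open) auto
    then have "\<forall>\<^sub>F y in nhds x. flat_exp p y = 0"
      by eventually_elim (simp add: flat_exp_def)
    then have "(flat_exp p has_real_derivative 0) (at x) \<longleftrightarrow> ((\<lambda>x. 0) has_real_derivative 0) (at x)"
      by (intro DERIV_cong_ev) auto
    with 2 show ?thesis
      by (simp add: flat_exp_def)
  next
    case 3
    have "((\<lambda>h. flat_exp p h / h) \<longlongrightarrow> 0) (at_right 0)"
    proof -
      have "((\<lambda>h::real. poly (pCons 0 p) (1 / h) * exp (- (1 / h))) \<longlongrightarrow> 0) (at_right 0)"
        by (rule filterlim_compose[OF poly_times_exp_minus_tendsto_0])
          (use filterlim_inverse_at_top_right in \<open>simp add: inverse_eq_divide\<close>)
      then show ?thesis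
        by (rule Lim_transform_eventually)
          (auto simp: flat_exp_def eventually_at_filter intro!: always_eventually)
    qed
    moreover have "((\<lambda>h. flat_exp p h / h) \<longlongrightarrow> 0) (at_left 0)"
      by (rule tendsto_eventually) (auto simp: flat_exp_def eventually_at_filter intro!: always_eventually)
    ultimately have "((\<lambda>h. flat_exp p h / h) \<longlongrightarrow> 0) (at 0)"
      by (simp add: filterlim_at_split)
    with 3 show ?thesis
      by (simp add: flat_exp_def DERIV_def)
  qed
qed

lemma smooth_flat_exp: "smooth (flat_exp p)"
proof (rule smooth_coinduct[of _ "range flat_exp"])
  show "\<And>g. g \<in> range flat_exp \<Longrightarrow> deriv g \<in> range flat_exp"
    using flat_exp_DERIV DERIV_imp_deriv by (metis (no_types, lifting) ext rangeE rangeI)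
  show "\<And>g x. g \<in> range flat_exp \<Longrightarrow> g field_differentiable at x"
    using flat_exp_DERIV by (auto simp: field_differentiable_def)
qed auto

text \<open>For \<open>g = flat_exp 1\<close> the values \<open>g (n y)\<close> tend to \<open>1\<close> for \<open>y > 0\<close> and vanish for \<open>y \<le> 0\<close>, so
the products \<open>g (n (x - c)) * g (n (d - x))\<close> approximate the indicator of \<open>(c, d)\<close> without any
normalising constant.\<close>

lemma smooth_interval_approx:
  obtains \<psi> :: "nat \<Rightarrow> real \<Rightarrow> real" where
    "\<And>n. smooth (\<psi> n)" "\<And>n x. 0 \<le> \<psi> n x" "\<And>n x. \<psi> n x \<le> 1"
    "\<And>n x. x \<notin> {c<..<d} \<Longrightarrow> \<psi> n x = 0"
    "\<And>x. (\<lambda>n. \<psi> n x) \<longlonglongrightarrow> indicator {c<..<d} x"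
proof
  define g where "g = flat_exp 1"
  define \<psi> where "\<psi> = (\<lambda>n x. g (real (Suc n) * (x - c)) * g (real (Suc n) * (d - x)))"
  have g: "0 \<le> g x" "g x \<le> 1" "x \<le> 0 \<Longrightarrow> g x = 0" for x
    by (auto simp: g_def flat_exp_def)
  have "smooth g"
    by (simp add: g_def smooth_flat_exp)
  have "smooth (\<lambda>x. g (real (Suc n) * (x - c)))" for n
    using smooth_affine[OF \<open>smooth g\<close>, of 1 "real (Suc n)" "- real (Suc n) * c"]
    by (simp add: algebra_simps)
  moreover have "smooth (\<lambda>x. g (real (Suc n) * (d - x)))" for n
    using smooth_affine[OF \<open>smooth g\<close>, of 1 "- real (Suc n)" "real (Suc n) * d"]
    by (simp add: algebra_simps)
  ultimately show "smooth (\<psi> n)" for n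
    unfolding \<psi>_def by (rule smooth_mult)
  show "0 \<le> \<psi> n x" "\<psi> n x \<le> 1" for n x
    using g by (auto simp: \<psi>_def mult_le_one)
  show zero: "\<psi> n x = 0" if "x \<notin> {c<..<d}" for n x
  proof -
    have "real (Suc n) * (x - c) \<le> 0 \<or> real (Suc n) * (d - x) \<le> 0"
      using that by (auto simp: mult_le_0_iff)
    with g(3) show ?thesis
      by (auto simp: \<psi>_def)
  qed
  have lim: "(\<lambda>n. g (real (Suc n) * y)) \<longlonglongrightarrow> 1" if "y > 0" for y
  proof -
    have "(\<lambda>n. exp (- (inverse (real (Suc n)) * (1 / y)))) \<longlonglongrightarrow> exp (- (0 * (1 / y)))"
      by (intro tendsto_intros LIMSEQ_inverse_real_of_nat)
    moreover have "exp (- (inverse (real (Suc n)) * (1 / y))) = g (real (Suc n) * y)" for n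
      using that by (simp add: g_def flat_exp_def divide_inverse del: of_nat_Suc)
    ultimately show ?thesis
      by simp
  qed
  show "(\<lambda>n. \<psi> n x) \<longlonglongrightarrow> indicator {c<..<d} x" for x
  proof (cases "x \<in> {c<..<d}")
    case True
    have "(\<lambda>n. \<psi> n x) \<longlonglongrightarrow> 1 * 1"
      unfolding \<psi>_def by (intro tendsto_mult lim) (use True in auto)
    with True show ?thesis by simp
  qed (simp add: zero)
qed

lemma test_function_smooth:
  assumes "smooth f" "\<And>x. x \<notin> {c..d} \<Longrightarrow> f x = 0" "a < c" "d < b"
  shows "test_function a b f"
proof -
  have "{x. f x \<noteq> 0} \<subseteq> {c..d}"
    using assms(2) by blast
  then have "closure {x. f x \<noteq> 0} \<subseteq> {c..d}"
    by (rule closure_minimal) simp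
  also have "\<dots> \<subseteq> {a<..<b}"
    using assms by auto
  finally show ?thesis
    using assms(1) by (auto simp: test_function_def smooth_def)
qed

lemma absolutely_integrable_mult_continuous:
  fixes f \<phi> :: "real \<Rightarrow> real"
  assumes "f absolutely_integrable_on {c..d}" "continuous_on {c..d} \<phi>"
  shows "(\<lambda>x. f x * \<phi> x) absolutely_integrable_on {c..d}"
proof -
  have "(\<lambda>x. \<phi> x * f x) absolutely_integrable_on {c..d}"
    using assms compact_imp_bounded[OF compact_continuous_image[OF assms(2)]]
    by (intro absolutely_integrable_bounded_measurable_product_real
        continuous_imp_measurable_on_sets_lebesgue) auto
  then show ?thesis
    by (simp add: mult.commute)
qed

lemma locally_integrable_absolutely:
  assumes "locally_integrable a b f" "a < c" "d < b"
  shows "f absolutely_integrable_on {c..d}"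
  using assms unfolding locally_integrable_def
  by (simp add: integrable_restrict_space set_integrable_def)

lemma integral_supported:
  fixes k :: "real \<Rightarrow> real"
  assumes "k absolutely_integrable_on {c..d}" "\<And>x. x \<notin> {c..d} \<Longrightarrow> k x = 0" "a < c" "d < b"
  shows "(\<integral>x. k x \<partial>lebesgue_on {a<..<b}) = integral {c..d} k"
proof -
  have "(\<integral>x. k x \<partial>lebesgue_on {a<..<b}) = (\<integral>x. indicator {a<..<b} x *\<^sub>R k x \<partial>lebesgue)"
    by (subst integral_restrict_space) auto
  also have "\<dots> = (\<integral>x. indicator {c..d} x *\<^sub>R k x \<partial>lebesgue)"
    using assms by (intro Bochner_Integration.integral_cong) (auto simp: indicator_def)
  also have "\<dots> = integral {c..d} k"
    using set_lebesgue_integral_eq_integral(2)[OF assms(1)]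
    by (simp add: set_lebesgue_integral_def)
  finally show ?thesis .
qed

definition ramp :: "real \<Rightarrow> real" where
  "ramp x = max 0 (min 1 x)"

text \<open>Antiderivatives of smooth bumps on \<open>(0, \<tau>)\<close>. Each \<open>\<Psi> n\<close> is constant beyond \<open>\<tau>\<close>, hence the
difference of two translates of it has compact support.\<close>

lemma smooth_ramp_approx:
  assumes "0 < \<tau>"
  obtains \<psi> \<Psi> :: "nat \<Rightarrow> real \<Rightarrow> real" where
    "\<And>n. smooth (\<Psi> n)" "\<And>n x. (\<Psi> n has_real_derivative \<psi> n x) (at x)"
    "\<And>n. continuous_on UNIV (\<psi> n)"
    "\<And>n x. 0 \<le> \<psi> n x" "\<And>n x. \<psi> n x \<le> 1 / \<tau>"
    "\<And>n x. x \<le> 0 \<Longrightarrow> \<Psi> n x = 0" "\<And>n x. \<tau> \<le> x \<Longrightarrow> \<Psi> n x = \<Psi> n \<tau>"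
    "\<And>n x. 0 \<le> \<Psi> n x" "\<And>n x. \<Psi> n x \<le> 1"
    "\<And>x. (\<lambda>n. \<psi> n x) \<longlonglongrightarrow> indicator {0<..<\<tau>} x / \<tau>"
    "\<And>x. (\<lambda>n. \<Psi> n x) \<longlonglongrightarrow> ramp (x / \<tau>)"
proof -
  obtain \<phi> :: "nat \<Rightarrow> real \<Rightarrow> real" where \<phi>:
    "\<And>n. smooth (\<phi> n)" "\<And>n x. 0 \<le> \<phi> n x" "\<And>n x. \<phi> n x \<le> 1"
    "\<And>n x. x \<notin> {0<..<\<tau>} \<Longrightarrow> \<phi> n x = 0"
    "\<And>x. (\<lambda>n. \<phi> n x) \<longlonglongrightarrow> indicator {0<..<\<tau>} x"
    using smooth_interval_approx[of 0 \<tau>] by blast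
  define \<psi> where "\<psi> = (\<lambda>n x. \<phi> n x / \<tau>)"
  have smooth: "smooth (\<psi> n)" for n
    using smooth_affine[OF \<phi>(1)[of n], of "1 / \<tau>" 1 0] by (simp add: \<psi>_def)
  have cont: "continuous_on S (\<psi> n)" for S n
    using smooth_continuous_on smooth by blast
  have "\<exists>A. \<forall>x. (A has_real_derivative \<psi> n x) (at x)" for n
    using einterval_antiderivative[of "-\<infinity>" "\<infinity>" "\<psi> n"] cont[of UNIV n]
    by (auto simp: continuous_on_eq_continuous_at has_real_derivative_iff_has_vector_derivative)
  then obtain A where A: "\<And>n x. (A n has_real_derivative \<psi> n x) (at x)"
    by metis
  define \<Psi> where "\<Psi> = (\<lambda>n x. A n x - A n 0)"
  have D: "(\<Psi> n has_real_derivative \<psi> n x) (at x)" for n x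
    unfolding \<Psi>_def using A by (auto intro!: derivative_eq_intros)
  have incr: "(\<psi> n has_integral (\<Psi> n y - \<Psi> n x)) {x..y}" if "x \<le> y" for n x y
    by (rule fundamental_theorem_of_calculus[OF that])
      (use D in \<open>auto simp: has_real_derivative_iff_has_vector_derivative[symmetric] intro: has_field_derivative_at_within\<close>)
  have zero: "\<Psi> n 0 = 0" for n
    by (simp add: \<Psi>_def)
  have vanish: "\<psi> n x = 0" if "x \<notin> {0<..<\<tau>}" for n x
    using \<phi>(4) that by (simp add: \<psi>_def)
  have const: "\<Psi> n y = \<Psi> n x" if "x \<le> y" "{x..y} \<inter> {0<..<\<tau>} = {}" for n x y
  proof -
    have "(\<psi> n has_integral 0) {x..y}"
      by (rule has_integral_is_0) (use that vanish in blast)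
    from has_integral_unique[OF this incr[OF that(1)]] show ?thesis
      by simp
  qed
  have left: "\<Psi> n x = 0" if "x \<le> 0" for n x
  proof -
    have "{x..0} \<inter> {0<..<\<tau>} = {}"
      by auto
    with const[of x 0 n] that zero show ?thesis
      by simp
  qed
  have right: "\<Psi> n x = \<Psi> n \<tau>" if "\<tau> \<le> x" for n x
  proof -
    have "{\<tau>..x} \<inter> {0<..<\<tau>} = {}"
      by auto
    with const[of \<tau> x n] that show ?thesis
      by simp
  qed
  have nonneg: "0 \<le> \<psi> n x" and le: "\<psi> n x \<le> 1 / \<tau>" for n x
    using \<phi>(2,3) assms by (auto simp: \<psi>_def divide_right_mono)
  have mono: "\<Psi> n x \<le> \<Psi> n y" if "x \<le> y" for n x y
    using has_integral_nonneg[OF incr[OF that]] nonneg by force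
  have lim: "(\<lambda>n. \<psi> n x) \<longlonglongrightarrow> indicator {0<..<\<tau>} x / \<tau>" for x
    unfolding \<psi>_def by (intro tendsto_divide \<phi>(5) tendsto_const) (use assms in auto)
  have lim2: "(\<lambda>n. \<Psi> n x) \<longlonglongrightarrow> ramp (x / \<tau>)" for x
  proof (cases "x \<le> 0")
    case True
    with assms show ?thesis
      by (simp add: left ramp_def divide_nonpos_pos)
  next
    case False
    have "(\<lambda>n. integral {0..x} (\<psi> n)) \<longlonglongrightarrow> integral {0..x} (\<lambda>x. indicator {0<..<\<tau>} x / \<tau>)"
      by (rule dominated_convergence[of _ _ "\<lambda>x. 1 / \<tau>"])
        (use incr[of 0 x] False lim nonneg le in auto)
    moreover have "integral {0..x} (\<psi> n) = \<Psi> n x" for n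
      using incr[of 0 x n] False zero by (simp add: integral_unique)
    moreover have "integral {0..x} (\<lambda>x. indicator {0<..<\<tau>} x / \<tau>) = min x \<tau> * (1 / \<tau>)"
    proof (rule integral_unique)
      have "((\<lambda>x. 1 / \<tau>) has_integral min x \<tau> * (1 / \<tau>)) {0..min x \<tau>}"
        using has_integral_const_real[of "1 / \<tau>" 0 "min x \<tau>"] False assms by simp
      then have "((\<lambda>z. if z \<in> {0..min x \<tau>} then 1 / \<tau> else 0) has_integral min x \<tau> * (1 / \<tau>)) {0..x}"
        by (intro iffD2[OF has_integral_restrict]) auto
      then show "((\<lambda>x. indicator {0<..<\<tau>} x / \<tau>) has_integral min x \<tau> * (1 / \<tau>)) {0..x}"
        by (rule has_integral_spike_finite[of "{0, \<tau>}", rotated 2]) (auto simp: indicator_def)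
    qed
    ultimately have "(\<lambda>n. \<Psi> n x) \<longlonglongrightarrow> min x \<tau> * (1 / \<tau>)"
      by (simp only:)
    moreover have "min x \<tau> * (1 / \<tau>) = ramp (x / \<tau>)"
      using False assms by (auto simp: ramp_def min_def field_simps)
    ultimately show ?thesis
      by simp
  qed
  have ge0: "0 \<le> \<Psi> n x" for n x
    using mono[of 0 x n] zero left by (cases "x \<le> 0") auto
  have le1: "\<Psi> n x \<le> 1" for n x
  proof (cases "0 \<le> x")
    case True
    have "\<Psi> n x \<le> \<Psi> n \<tau>"
      using mono[of x \<tau> n] right[of x n] by (cases "x \<le> \<tau>") auto
    also have "\<Psi> n \<tau> \<le> 1 / \<tau> * (\<tau> - 0)"
    proof -
      have "((\<lambda>x. 1 / \<tau>) has_integral (\<tau> - 0) *\<^sub>R (1 / \<tau>)) {0..\<tau>}"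
        using has_integral_const_real[of "1 / \<tau>" 0 \<tau>] assms by simp
      from has_integral_le[OF incr[of 0 \<tau> n] this] le assms zero show ?thesis
        by simp
    qed
    finally show ?thesis
      using assms by simp
  qed (simp add: left)
  have smooth_\<Psi>: "smooth (\<Psi> n)" for n
    by (rule smooth_antiderivative[OF D smooth])
  show ?thesis
    by (rule that[of \<Psi> \<psi>])
      (assumption | rule smooth_\<Psi> D cont nonneg le left right ge0 le1 lim lim2)+
qed

section \<open>Increments and uniqueness of weak derivatives\<close>

text \<open>The trapezoid rising from \<open>p\<close> to \<open>p + \<tau>\<close> and falling from \<open>q\<close> to \<open>q + \<tau>\<close> is not smooth, but it
is a limit of test functions whose derivatives converge boundedly. Its derivative is piecewise constant,
so testing \<open>f = U'\<close> against it produces difference quotients of \<open>U\<close>.\<close>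

lemma weak_deriv_trapezoid:
  assumes weak: "has_weak_deriv a b f g"
    and U: "\<And>x. x \<in> {a<..<b} \<Longrightarrow> (U has_real_derivative f x) (at x)"
    and "a < p" "p < q" "0 < \<tau>" "q + \<tau> \<le> e" "e < b"
  shows "(U (q + \<tau>) - U q) / \<tau> - (U (p + \<tau>) - U p) / \<tau> =
    integral {p..e} (\<lambda>x. g x * (ramp ((x - p) / \<tau>) - ramp ((x - q) / \<tau>)))"
proof (rule smooth_ramp_approx[OF \<open>0 < \<tau>\<close>])
  fix \<psi> \<Psi> :: "nat \<Rightarrow> real \<Rightarrow> real"
  assume smooth: "\<And>n. smooth (\<Psi> n)" and D: "\<And>n x. (\<Psi> n has_real_derivative \<psi> n x) (at x)"
    and cont: "\<And>n. continuous_on UNIV (\<psi> n)"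
    and nonneg: "\<And>n x. 0 \<le> \<psi> n x" and le: "\<And>n x. \<psi> n x \<le> 1 / \<tau>"
    and left: "\<And>n x. x \<le> 0 \<Longrightarrow> \<Psi> n x = 0" and right: "\<And>n x. \<tau> \<le> x \<Longrightarrow> \<Psi> n x = \<Psi> n \<tau>"
    and ge0: "\<And>n x. 0 \<le> \<Psi> n x" and le1: "\<And>n x. \<Psi> n x \<le> 1"
    and lim: "\<And>x. (\<lambda>n. \<psi> n x) \<longlonglongrightarrow> indicator {0<..<\<tau>} x / \<tau>"
    and lim2: "\<And>x. (\<lambda>n. \<Psi> n x) \<longlonglongrightarrow> ramp (x / \<tau>)"
  define \<phi> where "\<phi> = (\<lambda>n x. \<Psi> n (x - p) - \<Psi> n (x - q))"
  define \<phi>' where "\<phi>' = (\<lambda>n x. \<psi> n (x - p) - \<psi> n (x - q))"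
  let ?I = "{p..e}"
  have D\<phi>: "(\<phi> n has_real_derivative \<phi>' n x) (at x)" for n x
    using DERIV_shift[of "\<Psi> n" "\<psi> n (x - p)" x "-p"] D[of n "x - p"]
      DERIV_shift[of "\<Psi> n" "\<psi> n (x - q)" x "-q"] D[of n "x - q"]
    unfolding \<phi>_def \<phi>'_def by (intro DERIV_diff) auto
  have supp: "\<phi> n x = 0" if "x \<notin> ?I" for n x
    using that left[of "x - p" n] left[of "x - q" n] right[of "x - p" n] right[of "x - q" n] assms
    by (cases "x < p") (auto simp: \<phi>_def)
  have "\<phi>' n x = 0" if "x \<notin> ?I" for n x
  proof -
    have "\<forall>\<^sub>F y in nhds x. y \<in> - ?I"
      using that by (intro eventually_nhds_in_open) auto
    then have "\<forall>\<^sub>F y in nhds x. \<phi> n y = 0"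
      by eventually_elim (use supp in auto)
    then have "(\<phi> n has_real_derivative 0) (at x)"
      using DERIV_cong_ev[OF refl, of "\<phi> n" "\<lambda>_. 0" x 0 0] by simp
    with D\<phi> show ?thesis
      using DERIV_unique by blast
  qed
  note supp' = this
  have "smooth (\<phi> n)" for n
    unfolding \<phi>_def using smooth_affine[OF smooth, of 1 n 1 "-p"] smooth_affine[OF smooth, of 1 n 1 "-q"]
    by (intro smooth_diff) simp_all
  then have "test_function a b (\<phi> n)" for n
    using supp assms by (intro test_function_smooth[of _ p e]) auto
  then have eq: "(\<integral>x. f x * deriv (\<phi> n) x \<partial>lebesgue_on {a<..<b}) =
      - (\<integral>x. g x * \<phi> n x \<partial>lebesgue_on {a<..<b})" for n
    using weak unfolding has_weak_deriv_def by blast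
  have deriv: "deriv (\<phi> n) x = \<phi>' n x" for n x
    using D\<phi> by (rule DERIV_imp_deriv)
  have f: "f absolutely_integrable_on ?I" and g: "g absolutely_integrable_on ?I"
    using weak assms unfolding has_weak_deriv_def
    by (auto intro!: locally_integrable_absolutely)
  have cont\<phi>: "continuous_on ?I (\<phi> n)" for n
    by (meson D\<phi> DERIV_isCont continuous_at_imp_continuous_on)
  have cont\<phi>': "continuous_on ?I (\<phi>' n)" for n
    unfolding \<phi>'_def by (intro continuous_intros continuous_on_compose2[OF cont]) auto
  have f\<phi>: "(\<lambda>x. f x * \<phi>' n x) absolutely_integrable_on ?I"
    and g\<phi>: "(\<lambda>x. g x * \<phi> n x) absolutely_integrable_on ?I" for n
    using f g cont\<phi> cont\<phi>' by (auto intro!: absolutely_integrable_mult_continuous)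
  have eq2: "integral ?I (\<lambda>x. f x * \<phi>' n x) = - integral ?I (\<lambda>x. g x * \<phi> n x)" for n
    using eq[of n] integral_supported[OF f\<phi>[of n], of a b] integral_supported[OF g\<phi>[of n], of a b]
      supp supp' assms by (simp add: deriv)
  define h where "h = (\<lambda>x. f x * (indicator {0<..<\<tau>} (x - p) / \<tau> - indicator {0<..<\<tau>} (x - q) / \<tau>))"
  have abs_f: "(\<lambda>x. \<bar>f x\<bar>) integrable_on ?I" and abs_g: "(\<lambda>x. \<bar>g x\<bar>) integrable_on ?I"
    using f g by (auto simp: absolutely_integrable_on_def)
  have "(\<lambda>n. integral ?I (\<lambda>x. f x * \<phi>' n x)) \<longlonglongrightarrow> integral ?I h"
  proof (rule dominated_convergence[of _ _ "\<lambda>x. \<bar>f x\<bar> * (1 / \<tau>)"])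
    show "norm (f x * \<phi>' n x) \<le> \<bar>f x\<bar> * (1 / \<tau>)" for n x
    proof -
      have "\<bar>\<phi>' n x\<bar> \<le> 1 / \<tau>"
        using nonneg[of n "x - p"] nonneg[of n "x - q"] le[of n "x - p"] le[of n "x - q"]
        unfolding \<phi>'_def by linarith
      then show ?thesis
        unfolding real_norm_def abs_mult by (intro mult_left_mono) auto
    qed
    show "(\<lambda>n. f x * \<phi>' n x) \<longlonglongrightarrow> h x" for x
      unfolding h_def \<phi>'_def by (intro tendsto_intros lim)
    show "(\<lambda>x. \<bar>f x\<bar> * (1 / \<tau>)) integrable_on ?I"
      by (rule integrable_on_mult_left[OF abs_f])
  qed (use f\<phi> in \<open>auto simp: absolutely_integrable_on_def\<close>)
  moreover have "(\<lambda>n. integral ?I (\<lambda>x. g x * \<phi> n x)) \<longlonglongrightarrow>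
      integral ?I (\<lambda>x. g x * (ramp ((x - p) / \<tau>) - ramp ((x - q) / \<tau>)))"
  proof (rule dominated_convergence[of _ _ "\<lambda>x. \<bar>g x\<bar>"])
    show "norm (g x * \<phi> n x) \<le> \<bar>g x\<bar>" for n x
    proof -
      have "\<bar>\<phi> n x\<bar> \<le> 1"
        using ge0[of n "x - p"] ge0[of n "x - q"] le1[of n "x - p"] le1[of n "x - q"]
        unfolding \<phi>_def by linarith
      then show ?thesis
        unfolding real_norm_def abs_mult by (intro mult_left_le) auto
    qed
    show "(\<lambda>n. g x * \<phi> n x) \<longlonglongrightarrow> g x * (ramp ((x - p) / \<tau>) - ramp ((x - q) / \<tau>))" for x
      unfolding \<phi>_def by (intro tendsto_intros lim2)
  qed (use g\<phi> abs_g in \<open>auto simp: absolutely_integrable_on_def\<close>)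
  ultimately have "integral ?I h = - integral ?I (\<lambda>x. g x * (ramp ((x - p) / \<tau>) - ramp ((x - q) / \<tau>)))"
    unfolding eq2 using LIMSEQ_unique tendsto_minus by blast
  moreover have "(h has_integral (U (p + \<tau>) - U p) / \<tau> - (U (q + \<tau>) - U q) / \<tau>) ?I"
  proof -
    have piece: "((\<lambda>x. f x * (indicator {0<..<\<tau>} (x - z) / \<tau>)) has_integral (U (z + \<tau>) - U z) / \<tau>) ?I"
      if "p \<le> z" "z \<le> q" for z
    proof -
      have "(f has_integral (U (z + \<tau>) - U z)) {z..z + \<tau>}"
      proof (rule fundamental_theorem_of_calculus)
        fix x assume "x \<in> {z..z + \<tau>}"
        with that assms have "(U has_real_derivative f x) (at x)"
          by (intro U) auto
        then show "(U has_vector_derivative f x) (at x within {z..z + \<tau>})"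
          by (metis has_field_derivative_at_within has_real_derivative_iff_has_vector_derivative)
      qed (use assms in simp)
      then have "((\<lambda>x. f x / \<tau>) has_integral (U (z + \<tau>) - U z) / \<tau>) {z..z + \<tau>}"
        by (rule has_integral_divide)
      then have "((\<lambda>x. if x \<in> {z..z + \<tau>} then f x / \<tau> else 0) has_integral (U (z + \<tau>) - U z) / \<tau>) ?I"
        by (intro iffD2[OF has_integral_restrict]) (use that assms in auto)
      then show ?thesis
        by (rule has_integral_spike_finite[of "{z, z + \<tau>}", rotated 2]) (auto simp: indicator_def)
    qed
    show ?thesis
      unfolding h_def right_diff_distrib by (intro has_integral_diff piece) (use assms in auto)
  qed
  ultimately show ?thesis
    by (simp add: integral_unique)
qed


text \<open>Letting the width \<open>\<tau>\<close> of the ramps tend to zero turns the difference quotients of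
\<open>weak_deriv_trapezoid\<close> into values of \<open>f\<close>. The condition on \<open>f\<close> is that it be a derivative
everywhere, so that the formula applies to \<open>u\<^sub>x\<close> before its continuity is known.\<close>

theorem weak_deriv_increment:
  assumes weak: "has_weak_deriv a b f g"
    and U: "\<And>x. x \<in> {a<..<b} \<Longrightarrow> (U has_real_derivative f x) (at x)"
    and "a < c" "c \<le> d" "d < b"
  shows "f d - f c = integral {c..d} g"
proof (cases "c = d")
  case False
  with assms have "c < d" by simp
  define t where "t = (b - d) / 2"
  define \<tau> where "\<tau> = (\<lambda>n. t / real (Suc n))"
  have t: "0 < t" "d + t < b"
    using assms by (auto simp: t_def field_simps)
  have \<tau>: "0 < \<tau> n" "\<tau> n \<le> t" for n
    using t by (auto simp: \<tau>_def field_simps)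
  have "\<tau> \<longlonglongrightarrow> 0"
    unfolding \<tau>_def using LIMSEQ_Suc[OF lim_const_over_n[of t]] by simp
  with \<tau> have lim0: "filterlim \<tau> (at 0) sequentially"
    by (auto simp: filterlim_at intro!: always_eventually less_imp_neq[symmetric])
  have quot: "(\<lambda>n. (U (z + \<tau> n) - U z) / \<tau> n) \<longlonglongrightarrow> f z" if "z \<in> {a<..<b}" for z
    using filterlim_compose[OF U[OF that, unfolded DERIV_def] lim0] .
  let ?k = "\<lambda>n x. ramp ((x - c) / \<tau> n) - ramp ((x - d) / \<tau> n)"
  let ?I = "{c..d + t}"
  have g: "g absolutely_integrable_on ?I"
    using weak assms t unfolding has_weak_deriv_def by (auto intro!: locally_integrable_absolutely)
  have "(\<lambda>n. integral ?I (\<lambda>x. g x * ?k n x)) \<longlonglongrightarrow> integral ?I (\<lambda>x. g x * indicator {c<..d} x)"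
  proof (rule dominated_convergence[of _ _ "\<lambda>x. \<bar>g x\<bar>"])
    show "(\<lambda>x. g x * ?k n x) integrable_on ?I" for n
    proof -
      have "continuous_on ?I (?k n)"
        unfolding ramp_def using \<tau>(1)[of n] by (intro continuous_intros) auto
      from absolutely_integrable_mult_continuous[OF g this] show ?thesis
        by (simp add: absolutely_integrable_on_def)
    qed
    show "(\<lambda>x. \<bar>g x\<bar>) integrable_on ?I"
      using g by (simp add: absolutely_integrable_on_def)
    show "norm (g x * ?k n x) \<le> \<bar>g x\<bar>" for n x
      unfolding real_norm_def abs_mult by (intro mult_left_le) (auto simp: ramp_def)
    show "(\<lambda>n. g x * ?k n x) \<longlonglongrightarrow> g x * indicator {c<..d} x" if "x \<in> ?I" for x
    proof -
      have ramp_lim: "(\<lambda>n. ramp ((x - z) / \<tau> n)) \<longlonglongrightarrow> indicator {z<..} x" for z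
      proof (cases "z < x")
        case True
        have "\<forall>\<^sub>F n in sequentially. \<tau> n < x - z"
          using order_tendstoD(2)[OF \<open>\<tau> \<longlonglongrightarrow> 0\<close>, of "x - z"] True by simp
        then have "\<forall>\<^sub>F n in sequentially. ramp ((x - z) / \<tau> n) = 1"
          by eventually_elim (use \<tau>(1) in \<open>auto simp: ramp_def min_def max_def field_simps\<close>)
        with True show ?thesis
          by (simp add: tendsto_eventually)
      next
        case False
        then have "ramp ((x - z) / \<tau> n) = 0" for n
          using \<tau>(1)[of n] by (simp add: ramp_def divide_nonpos_pos)
        with False show ?thesis
          by simp
      qed
      have "(\<lambda>n. g x * ?k n x) \<longlonglongrightarrow> g x * (indicator {c<..} x - indicator {d<..} x)"
        by (intro tendsto_intros ramp_lim)
      also have "indicator {c<..} x - indicator {d<..} x = (indicator {c<..d} x :: real)"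
        using \<open>c < d\<close> by (auto simp: indicator_def)
      finally show ?thesis .
    qed
  qed
  moreover have "integral ?I (\<lambda>x. g x * ?k n x) = (U (d + \<tau> n) - U d) / \<tau> n - (U (c + \<tau> n) - U c) / \<tau> n" for n
    by (rule weak_deriv_trapezoid[OF weak U, symmetric]) (use assms t \<tau> \<open>c < d\<close> in \<open>auto simp: algebra_simps\<close>)
  moreover have "(\<lambda>n. (U (d + \<tau> n) - U d) / \<tau> n - (U (c + \<tau> n) - U c) / \<tau> n) \<longlonglongrightarrow> f d - f c"
    by (intro tendsto_diff quot) (use assms in auto)
  ultimately have "f d - f c = integral ?I (\<lambda>x. g x * indicator {c<..d} x)"
    using LIMSEQ_unique by fastforce
  also have "\<dots> = integral ?I (\<lambda>x. if x \<in> {c..d} then g x else 0)"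
    by (rule integral_spike[of "{c}"]) (use t in \<open>auto simp: indicator_def\<close>)
  also have "\<dots> = integral {c..d} g"
  proof -
    have "{c..d} \<inter> ?I = {c..d}"
      using t by auto
    then show ?thesis
      using Henstock_Kurzweil_Integration.integral_restrict_Int[of ?I "{c..d}" g] by (simp only:)
  qed
  finally show ?thesis .
qed simp

text \<open>The densities given by the positive and the negative part of \<open>h\<close> assign the same finite mass to every
half-line, so they define the same Borel measure and the two parts agree almost everywhere.\<close>

lemma AE_eq_0_if_interval_integrals_eq_0:
  fixes h :: "real \<Rightarrow> real"
  assumes h: "h absolutely_integrable_on {c..d}"
    and zero: "\<And>x y. c \<le> x \<Longrightarrow> x \<le> y \<Longrightarrow> y \<le> d \<Longrightarrow> integral {x..y} h = 0"
  shows "AE x in lebesgue. x \<in> {c..d} \<longrightarrow> h x = 0"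
proof -
  define k where "k = (\<lambda>x. indicator {c..d} x * h x)"
  have k: "integrable lebesgue k"
    using h by (simp add: set_integrable_def k_def)
  then obtain k' where k': "k' \<in> borel_measurable lborel" "AE x in lborel. k x = k' x"
    using completion_ex_borel_measurable_real[of k lborel] by auto
  then have AE: "AE x in lebesgue. k x = k' x"
    by (simp add: AE_completion)
  have "k' \<in> borel_measurable lebesgue"
    using k'(1) by (rule measurable_completion)
  then have "integrable lebesgue k'"
    using k integrable_cong_AE[of k lebesgue k'] AE by auto
  then have int: "integrable lborel k'"
    using k'(1) integrable_completion by blast
  have tail: "(\<integral>y. indicator {x<..} y * k' y \<partial>lborel) = 0" for x
  proof -
    have "(\<integral>y. indicator {x<..} y * k' y \<partial>lborel) = (\<integral>y. indicator {x<..} y * k' y \<partial>lebesgue)"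
      by (intro integral_completion[symmetric] borel_measurable_times) (use k'(1) in auto)
    also have "\<dots> = (\<integral>y. indicator {x<..} y * k y \<partial>lebesgue)"
    proof (rule integral_cong_AE)
      show "AE y in lebesgue. indicator {x<..} y * k' y = indicator {x<..} y * k y"
        using AE by eventually_elim simp
      have "indicat_real {x<..} \<in> borel_measurable lebesgue"
        by (rule borel_measurable_indicator) simp
      then show "(\<lambda>y. indicator {x<..} y * k' y) \<in> borel_measurable lebesgue"
        "(\<lambda>y. indicator {x<..} y * k y) \<in> borel_measurable lebesgue"
        using borel_measurable_integrable[OF k] measurable_completion[OF k'(1)]
        by (auto intro!: borel_measurable_times)
    qed
    also have "(\<lambda>y. indicator {x<..} y * k y) = (\<lambda>y. indicator ({x<..} \<inter> {c..d}) y *\<^sub>R h y)"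
      by (simp add: k_def indicator_inter_arith mult.assoc)
    also have "(\<integral>y. indicator ({x<..} \<inter> {c..d}) y *\<^sub>R h y \<partial>lebesgue) = integral ({x<..} \<inter> {c..d}) h"
    proof -
      have "set_integrable lebesgue ({x<..} \<inter> {c..d}) h"
        by (rule set_integrable_subset[OF h]) auto
      from set_lebesgue_integral_eq_integral(2)[OF this] show ?thesis
        by (simp add: set_lebesgue_integral_def)
    qed
    also have "\<dots> = integral {max c x..d} h"
    proof (rule integral_spike_set)
      show "negligible {y \<in> {x<..} \<inter> {c..d} - {max c x..d}. h y \<noteq> 0}"
        by (rule negligible_subset[of "{x}"]) auto
      show "negligible {y \<in> {max c x..d} - {x<..} \<inter> {c..d}. h y \<noteq> 0}"
        by (rule negligible_subset[of "{x}"]) auto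
    qed
    also have "\<dots> = 0"
      using zero[of "max c x" d] by (cases "max c x \<le> d") auto
    finally show ?thesis .
  qed
  let ?p = "\<lambda>y. ennreal (k' y)" and ?m = "\<lambda>y. ennreal (- k' y)"
  have meas: "?p \<in> borel_measurable lborel" "?m \<in> borel_measurable lborel"
    using k'(1) by auto
  have em: "emeasure (density lborel (\<lambda>y. ennreal (s * k' y))) {x<..} =
      (\<integral>\<^sup>+y. ennreal (s * (indicator {x<..} y * k' y)) \<partial>lborel)" for x s
    using k'(1) by (subst emeasure_density) (auto intro!: nn_integral_cong simp: indicator_def)
  have fin: "(\<integral>\<^sup>+y. ennreal (s * (indicator {x<..} y * k' y)) \<partial>lborel) < \<infinity>" for x s
  proof -
    have "integrable lborel (\<lambda>y. s * (indicator {x<..} y * k' y))"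
      using integrable_mult_indicator[OF _ int, of "{x<..}"] by auto
    then show ?thesis
      using integrableD(2)[of lborel "\<lambda>y. s * (indicator {x<..} y * k' y)"] by (auto simp: top.not_eq_extremum)
  qed
  have eq: "emeasure (density lborel ?p) {x<..} = emeasure (density lborel ?m) {x<..}" for x
  proof -
    have "integrable lborel (\<lambda>y. indicator {x<..} y * k' y)"
      using integrable_mult_indicator[OF _ int, of "{x<..}"] by auto
    from real_lebesgue_integral_def[OF this] tail[of x]
    have "enn2real (\<integral>\<^sup>+y. ennreal (1 * (indicator {x<..} y * k' y)) \<partial>lborel) =
        enn2real (\<integral>\<^sup>+y. ennreal ((- 1) * (indicator {x<..} y * k' y)) \<partial>lborel)"
      by simp
    then have "(\<integral>\<^sup>+y. ennreal (1 * (indicator {x<..} y * k' y)) \<partial>lborel) =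
        (\<integral>\<^sup>+y. ennreal ((- 1) * (indicator {x<..} y * k' y)) \<partial>lborel)"
      using fin[of 1 x] fin[of "- 1" x] by (auto dest!: arg_cong[of _ _ ennreal])
    with em[of 1 x] em[of "-1" x] show ?thesis
      by simp
  qed
  have "density lborel ?p = density lborel ?m"
    by (rule measure_eqI_lessThan) (use eq em[of 1] fin[of 1] in auto)
  then have "AE y in lborel. ?p y = ?m y"
    by (rule sigma_finite_measure.density_unique[OF sigma_finite_lborel meas])
  then have "AE y in lborel. k' y = 0"
  proof eventually_elim
    case (elim y)
    then have "ennreal \<bar>k' y\<bar> = 0"
      by (cases "0 \<le> k' y") (simp_all add: ennreal_neg)
    then show ?case
      by simp
  qed
  then have "AE y in lebesgue. k' y = 0"
    by (simp add: AE_completion)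
  with AE show ?thesis
    by eventually_elim (auto simp: k_def)
qed

lemma AE_eq_if_interval_integrals_eq:
  fixes f g :: "real \<Rightarrow> real"
  assumes f: "locally_integrable a b f" and g: "locally_integrable a b g"
    and eq: "\<And>x y. a < x \<Longrightarrow> x \<le> y \<Longrightarrow> y < b \<Longrightarrow> integral {x..y} f = integral {x..y} g"
  shows "AE x in lebesgue_on {a<..<b}. f x = g x"
proof -
  have *: "AE x in lebesgue. x \<in> {c..d} \<longrightarrow> f x - g x = 0" if "a < c" "d < b" for c d
  proof (rule AE_eq_0_if_interval_integrals_eq_0)
    show "(\<lambda>x. f x - g x) absolutely_integrable_on {c..d}"
      using f g that by (intro set_integral_diff locally_integrable_absolutely)
    fix x y assume xy: "c \<le> x" "x \<le> y" "y \<le> d"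
    have "f absolutely_integrable_on {x..y}" "g absolutely_integrable_on {x..y}"
      using f g that xy by (auto intro!: locally_integrable_absolutely)
    then show "integral {x..y} (\<lambda>x. f x - g x) = 0"
      using eq[of x y] that xy by (subst Henstock_Kurzweil_Integration.integral_diff)
        (auto simp: absolutely_integrable_on_def)
  qed
  have "AE x in lebesgue. \<forall>n. x \<in> {a + 1 / real (Suc n)..b - 1 / real (Suc n)} \<longrightarrow> f x - g x = 0"
    by (subst AE_all_countable) (intro allI *; simp)
  then have "AE x in lebesgue. x \<in> {a<..<b} \<longrightarrow> f x = g x"
  proof eventually_elim
    case (elim x)
    show ?case
    proof
      assume x: "x \<in> {a<..<b}"
      then obtain n where n: "inverse (real (Suc n)) < min (x - a) (b - x)"
        using reals_Archimedean[of "min (x - a) (b - x)"] by auto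
      then have "x \<in> {a + 1 / real (Suc n)..b - 1 / real (Suc n)}"
        by (simp add: inverse_eq_divide)
      with elim show "f x = g x"
        by (metis eq_iff_diff_eq_0)
    qed
  qed
  then show ?thesis
    by (simp add: AE_restrict_space_iff)
qed

section \<open>Square integrable functions on an interval\<close>

lemma borel_measurable_lebesgue_on_AE:
  fixes f g :: "real \<Rightarrow> real"
  assumes f: "f \<in> borel_measurable (lebesgue_on S)" and S: "S \<in> sets lebesgue"
    and eq: "AE x in lebesgue_on S. f x = g x"
  shows "g \<in> borel_measurable (lebesgue_on S)"
proof -
  have "(\<lambda>x. if x \<in> S then f x else 0) \<in> borel_measurable lebesgue"
    using f S borel_measurable_if by blast
  moreover have "AE x in lebesgue. (if x \<in> S then f x else 0) = (if x \<in> S then g x else 0)"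
    using eq S by (simp add: AE_restrict_space_iff)
  ultimately have "(\<lambda>x. if x \<in> S then g x else 0) \<in> borel_measurable lebesgue"
    by (rule borel_measurable_AE)
  then show ?thesis
    using S borel_measurable_if by blast
qed

lemma integral_lebesgue_on_AE:
  fixes f g :: "real \<Rightarrow> real"
  assumes f: "f \<in> borel_measurable (lebesgue_on S)" and S: "S \<in> sets lebesgue"
    and eq: "AE x in lebesgue_on S. f x = g x"
  shows "(\<integral>x. f x \<partial>lebesgue_on S) = (\<integral>x. g x \<partial>lebesgue_on S)"
    "integrable (lebesgue_on S) f \<longleftrightarrow> integrable (lebesgue_on S) g"
  using integral_cong_AE[OF f borel_measurable_lebesgue_on_AE[OF assms] eq]
    integrable_cong_AE[OF f borel_measurable_lebesgue_on_AE[OF assms] eq] by auto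

lemma continuous_integrable_Ioo:
  fixes f :: "real \<Rightarrow> real"
  assumes "continuous_on {a..b} f"
  shows "integrable (lebesgue_on {a<..<b}) f"
    and "(\<integral>x. f x \<partial>lebesgue_on {a<..<b}) = integral {a..b} f"
proof -
  have "f absolutely_integrable_on {a..b}"
    by (rule absolutely_integrable_continuous_real[OF assms])
  then have "f absolutely_integrable_on {a<..<b}"
    by (simp add: absolutely_integrable_on_Icc_iff_Ioo)
  then show int: "integrable (lebesgue_on {a<..<b}) f"
    by (simp add: integrable_restrict_space set_integrable_def)
  show "(\<integral>x. f x \<partial>lebesgue_on {a<..<b}) = integral {a..b} f"
    using lebesgue_integral_eq_integral[OF int] by (simp add: integral_open_interval_real)
qed

lemma finite_measure_Ioo: "finite_measure (lebesgue_on {a<..<b::real})"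
  by (rule finite_measure_lebesgue_on) simp

lemma integral_const_Ioo:
  fixes a b c :: real
  assumes "a \<le> b"
  shows "(\<integral>x. c \<partial>lebesgue_on {a<..<b}) = c * (b - a)"
  using continuous_integrable_Ioo(2)[of a b "\<lambda>_. c"] assms by simp

lemma square_integrable_integrable:
  assumes "square_integrable a b f"
  shows "integrable (lebesgue_on {a<..<b}) f"
proof (rule Bochner_Integration.integrable_bound[of _ "\<lambda>x. (f x)\<^sup>2 + 1"])
  interpret finite_measure "lebesgue_on {a<..<b}"
    by (rule finite_measure_Ioo)
  show "integrable (lebesgue_on {a<..<b}) (\<lambda>x. (f x)\<^sup>2 + 1)"
    using assms by (simp add: square_integrable_def)
  have "\<bar>f x\<bar> \<le> (f x)\<^sup>2 + 1" for x
  proof -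
    have "0 \<le> (\<bar>f x\<bar> - 1)\<^sup>2" "0 \<le> \<bar>f x\<bar>"
      by auto
    then show ?thesis
      by (simp add: power2_diff)
  qed
  then show "AE x in lebesgue_on {a<..<b}. norm (f x) \<le> norm ((f x)\<^sup>2 + 1)"
    by (auto intro: order_trans[OF _ abs_ge_self])
qed (use assms in \<open>simp add: square_integrable_def\<close>)

lemma square_integrable_mult:
  assumes "square_integrable a b f" "square_integrable a b g"
  shows "integrable (lebesgue_on {a<..<b}) (\<lambda>x. f x * g x)"
proof (rule Bochner_Integration.integrable_bound[of _ "\<lambda>x. (f x)\<^sup>2 + (g x)\<^sup>2"])
  show "integrable (lebesgue_on {a<..<b}) (\<lambda>x. (f x)\<^sup>2 + (g x)\<^sup>2)"
    using assms by (simp add: square_integrable_def)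
  have "\<bar>f x * g x\<bar> \<le> (f x)\<^sup>2 + (g x)\<^sup>2" for x
  proof -
    have "0 \<le> (\<bar>f x\<bar> - \<bar>g x\<bar>)\<^sup>2" "0 \<le> \<bar>f x\<bar> * \<bar>g x\<bar>"
      by auto
    then have "\<bar>f x\<bar> * \<bar>g x\<bar> \<le> \<bar>f x\<bar>\<^sup>2 + \<bar>g x\<bar>\<^sup>2"
      unfolding power2_diff by linarith
    then show ?thesis
      by (simp add: abs_mult)
  qed
  then show "AE x in lebesgue_on {a<..<b}. norm (f x * g x) \<le> norm ((f x)\<^sup>2 + (g x)\<^sup>2)"
    by (auto intro: order_trans[OF _ abs_ge_self])
qed (use assms in \<open>auto simp: square_integrable_def\<close>)

lemma square_integrable_diff:
  assumes "square_integrable a b f" "square_integrable a b g"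
  shows "square_integrable a b (\<lambda>x. f x - g x)"
proof -
  have "integrable (lebesgue_on {a<..<b}) (\<lambda>x. (f x)\<^sup>2 - 2 * (f x * g x) + (g x)\<^sup>2)"
    using assms square_integrable_mult[OF assms] by (auto simp: square_integrable_def)
  then show ?thesis
    using assms by (auto simp: square_integrable_def power2_diff algebra_simps)
qed

lemma continuous_square_integrable:
  assumes "continuous_on {a..b} f"
  shows "square_integrable a b f"
  using continuous_integrable_Ioo(1)[OF assms] continuous_integrable_Ioo(1)[of a b "\<lambda>x. (f x)\<^sup>2"] assms
  by (auto simp: square_integrable_def intro!: continuous_intros)

text \<open>The inequality of Cauchy and Schwarz in additive form. The parameter \<open>\<mu>\<close> is chosen only at the end of the
argument, so that no square roots of integrals over time occur.\<close>

lemma integral_abs_le_square: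
  assumes "square_integrable a b f" "0 < \<mu>" "a \<le> b"
  shows "(\<integral>x. \<bar>f x\<bar> \<partial>lebesgue_on {a<..<b}) \<le> (b - a) * \<mu> / 2 + (\<integral>x. (f x)\<^sup>2 \<partial>lebesgue_on {a<..<b}) / (2 * \<mu>)"
proof -
  interpret finite_measure "lebesgue_on {a<..<b}"
    by (rule finite_measure_Ioo)
  have sq: "integrable (lebesgue_on {a<..<b}) (\<lambda>x. (f x)\<^sup>2)"
    using assms by (simp add: square_integrable_def)
  have "(\<integral>x. \<bar>f x\<bar> \<partial>lebesgue_on {a<..<b}) \<le> (\<integral>x. \<mu> / 2 + (f x)\<^sup>2 / (2 * \<mu>) \<partial>lebesgue_on {a<..<b})"
  proof (rule integral_mono)
    show "\<bar>f x\<bar> \<le> \<mu> / 2 + (f x)\<^sup>2 / (2 * \<mu>)" for x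
    proof -
      have "0 \<le> (\<bar>f x\<bar> - \<mu>)\<^sup>2"
        by simp
      then have "2 * \<mu> * \<bar>f x\<bar> \<le> \<mu>\<^sup>2 + (f x)\<^sup>2"
        by (simp add: power2_diff algebra_simps)
      with \<open>0 < \<mu>\<close> show ?thesis
        by (simp add: field_simps power2_eq_square)
    qed
  qed (use sq square_integrable_integrable[OF assms(1)] in auto)
  also have "\<dots> = (\<integral>x. \<mu> / 2 \<partial>lebesgue_on {a<..<b}) + (\<integral>x. (f x)\<^sup>2 / (2 * \<mu>) \<partial>lebesgue_on {a<..<b})"
    by (rule Bochner_Integration.integral_add) (use sq in auto)
  also have "(\<integral>x. \<mu> / 2 \<partial>lebesgue_on {a<..<b}) = (b - a) * \<mu> / 2"
    using integral_const_Ioo[OF \<open>a \<le> b\<close>, of "\<mu> / 2"] by simp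
  finally show ?thesis
    by simp
qed

section \<open>Classical representatives of Sobolev functions\<close>

lemma within_imp_at:
  assumes "(f has_real_derivative D) (at x within {a..b})" "x \<in> {a<..<b}"
  shows "(f has_real_derivative D) (at x)"
proof -
  have "at x within {a..b} = at x"
    by (rule at_within_interior) (use assms(2) in simp)
  with assms(1) show ?thesis
    by simp
qed

lemma FTC_within:
  fixes f f' :: "real \<Rightarrow> real"
  assumes "\<And>x. x \<in> {a..b} \<Longrightarrow> (f has_real_derivative f' x) (at x within {a..b})" "a \<le> c" "c \<le> d" "d \<le> b"
  shows "(f' has_integral (f d - f c)) {c..d}"
proof (rule fundamental_theorem_of_calculus[OF assms(3)])
  fix x assume x: "x \<in> {c..d}"
  have "(f has_real_derivative f' x) (at x within {c..d})"
    by (rule has_field_derivative_subset[OF assms(1)]) (use x assms in auto)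
  then show "(f has_vector_derivative f' x) (at x within {c..d})"
    by (simp add: has_real_derivative_iff_has_vector_derivative)
qed

lemma continuous_locally_integrable:
  assumes "continuous_on {a..b} f"
  shows "locally_integrable a b f"
  unfolding locally_integrable_def
proof (intro allI impI)
  fix c d assume "a < c \<and> d < b"
  then have "continuous_on {c..d} f"
    using assms by (auto intro: continuous_on_subset)
  then show "integrable (lebesgue_on {c..d}) f"
    by (rule continuous_imp_integrable_real)
qed

lemma bounded_deriv_locally_integrable:
  fixes f f' :: "real \<Rightarrow> real"
  assumes D: "\<And>x. x \<in> {a..b} \<Longrightarrow> (f has_real_derivative f' x) (at x within {a..b})"
    and bound: "\<And>x. x \<in> {a..b} \<Longrightarrow> \<bar>f' x\<bar> \<le> B"
  shows "locally_integrable a b f'"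
  unfolding locally_integrable_def
proof (intro allI impI)
  fix c d assume cd: "a < c \<and> d < b"
  have "f' integrable_on {c..d}"
    using FTC_within[OF D, of c d] cd by (cases "c \<le> d") auto
  then have "f' absolutely_integrable_on {c..d}"
    by (rule absolutely_integrable_integrable_bound[of _ _ "\<lambda>_. B", rotated]) (use bound cd in auto)
  then show "integrable (lebesgue_on {c..d}) f'"
    by (simp add: integrable_restrict_space set_integrable_def)
qed

text \<open>The classical and the weak derivative have the same integral over every compact subinterval.\<close>

lemma weak_deriv_unique:
  fixes f f' :: "real \<Rightarrow> real"
  assumes D: "\<And>x. x \<in> {a..b} \<Longrightarrow> (f has_real_derivative f' x) (at x within {a..b})"
    and f': "locally_integrable a b f'" and g: "has_weak_deriv a b f g"
  shows "AE x in lebesgue_on {a<..<b}. f' x = g x"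
proof (rule AE_eq_if_interval_integrals_eq[OF f'])
  show "locally_integrable a b g"
    using g by (simp add: has_weak_deriv_def)
  fix x y assume xy: "a < x" "x \<le> y" "y < b"
  have cont: "continuous_on {a..b} f"
    using D by (meson DERIV_continuous continuous_on_eq_continuous_within)
  have "f y - f x = integral {x..y} g"
  proof (rule weak_deriv_increment[OF g _ xy])
    fix z assume z: "z \<in> {a<..<b}"
    show "((\<lambda>y. integral {a..y} f) has_real_derivative f z) (at z)"
      by (rule within_imp_at[OF integral_has_real_derivative[OF cont]]) (use z in auto)
  qed
  with FTC_within[OF D, of x y] xy show "integral {x..y} f' = integral {x..y} g"
    by (simp add: integral_unique)
qed

lemma test_function_smooth_imp: "test_function a b \<phi> \<Longrightarrow> smooth \<phi>"
  by (simp add: test_function_def smooth_def)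

lemma continuous_measurable_lebesgue_on:
  "continuous_on UNIV f \<Longrightarrow> f \<in> borel_measurable (lebesgue_on {a<..<b::real})" for f :: "real \<Rightarrow> real"
  by (rule continuous_imp_measurable_on_sets_lebesgue) (auto intro: continuous_on_subset)

text \<open>The classical derivative \<open>f'\<close> coincides almost everywhere with the first weak derivative, so it inherits the weak
derivative \<open>g2\<close>; since \<open>f'\<close> is a derivative everywhere, its increments are integrals of \<open>g2\<close>, and these are
continuous up to the end points because \<open>g2\<close> is integrable on the whole interval.\<close>

lemma H2_continuous_deriv:
  assumes "a < b"
    and D: "\<And>x. x \<in> {a..b} \<Longrightarrow> (f has_real_derivative f' x) (at x within {a..b})"
    and bound: "\<And>x. x \<in> {a..b} \<Longrightarrow> \<bar>f' x\<bar> \<le> B"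
    and H2: "sobolev_H 2 a b f"
  shows "continuous_on {a..b} f'"
proof -
  obtain g1 g2 where g1: "has_weak_deriv a b f g1" "square_integrable a b g1"
    and g2: "has_weak_deriv a b g1 g2" "square_integrable a b g2"
    using H2 by (auto simp: numeral_2_eq_2)
  have loc: "locally_integrable a b f'"
    using bounded_deriv_locally_integrable[OF D bound] .
  have AE: "AE x in lebesgue_on {a<..<b}. g1 x = f' x"
    using weak_deriv_unique[OF D loc g1(1)] by (auto elim: eventually_mono)
  have "has_weak_deriv a b f' g2"
    unfolding has_weak_deriv_def
  proof (intro conjI allI impI)
    fix \<phi> assume \<phi>: "test_function a b \<phi>"
    have "deriv \<phi> \<in> borel_measurable (lebesgue_on {a<..<b})"
      by (intro continuous_measurable_lebesgue_on smooth_continuous_on smooth_deriv test_function_smooth_imp[OF \<phi>])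
    with g1(2) have "(\<lambda>x. g1 x * deriv \<phi> x) \<in> borel_measurable (lebesgue_on {a<..<b})"
      by (auto simp: square_integrable_def)
    moreover have "AE x in lebesgue_on {a<..<b}. g1 x * deriv \<phi> x = f' x * deriv \<phi> x"
      using AE by eventually_elim simp
    ultimately have "(\<integral>x. g1 x * deriv \<phi> x \<partial>lebesgue_on {a<..<b}) = (\<integral>x. f' x * deriv \<phi> x \<partial>lebesgue_on {a<..<b})"
      by (intro integral_lebesgue_on_AE) auto
    with g2(1) \<phi> show "(\<integral>x. f' x * deriv \<phi> x \<partial>lebesgue_on {a<..<b}) = - (\<integral>x. g2 x * \<phi> x \<partial>lebesgue_on {a<..<b})"
      unfolding has_weak_deriv_def by metis
  qed (use loc g2 in \<open>auto simp: has_weak_deriv_def\<close>)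
  note weak = this
  have "integrable (lebesgue_on {a<..<b}) g2"
    by (rule square_integrable_integrable[OF g2(2)])
  then have "g2 absolutely_integrable_on {a<..<b}"
    by (simp add: integrable_restrict_space set_integrable_def)
  then have int: "g2 integrable_on {a..b}"
    by (simp only: absolutely_integrable_on_Icc_iff_Ioo[symmetric] set_lebesgue_integral_eq_integral(1))
  define m where "m = (a + b) / 2"
  have m: "m \<in> {a<..<b}"
    using \<open>a < b\<close> by (auto simp: m_def field_simps)
  define H where "H = (\<lambda>x. f' m + integral {a..x} g2 - integral {a..m} g2)"
  have contH: "continuous_on {a..b} H"
    unfolding H_def by (intro continuous_intros indefinite_integral_continuous_1 int)
  have incr: "f' d - f' c = integral {a..d} g2 - integral {a..c} g2" if "a < c" "c \<le> d" "d < b" for c d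
  proof -
    have "f' d - f' c = integral {c..d} g2"
      by (rule weak_deriv_increment[OF weak _ that]) (use within_imp_at[OF D] in auto)
    moreover have "integral {a..c} g2 + integral {c..d} g2 = integral {a..d} g2"
      by (rule Henstock_Kurzweil_Integration.integral_combine)
        (use that integrable_subinterval_real[OF int, of a d] in auto)
    ultimately show ?thesis
      by simp
  qed
  have eqH: "f' x = H x" if "x \<in> {a<..<b}" for x
    using incr[of m x] incr[of x m] m that by (cases "x \<le> m") (auto simp: H_def)
  define V where "V = (\<lambda>x. integral {a..x} H)"
  have DV: "(V has_real_derivative H x) (at x within {a..b})" if "x \<in> {a..b}" for x
    unfolding V_def by (rule integral_has_real_derivative[OF contH that])
  have const: "f x - V x = f a - V a" if "x \<in> {a..b}" for x
  proof (cases "x = a")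
    case False
    show ?thesis
    proof (rule DERIV_isconst_end[of a x "\<lambda>x. f x - V x"])
      show "a < x"
        using False that by simp
      have "continuous_on {a..b} (\<lambda>x. f x - V x)"
        using D DV by (intro continuous_on_diff DERIV_continuous_on) auto
      then show "continuous_on {a..x} (\<lambda>x. f x - V x)"
        by (rule continuous_on_subset) (use that in auto)
      fix z assume "a < z" "z < x"
      then have z: "z \<in> {a<..<b}"
        using that by auto
      have "((\<lambda>x. f x - V x) has_real_derivative f' z - H z) (at z)"
        by (intro DERIV_diff within_imp_at[OF D] within_imp_at[OF DV]) (use z in auto)
      with eqH[OF z] show "((\<lambda>x. f x - V x) has_real_derivative 0) (at z)"
        by simp
    qed
  qed simp
  have "f' x = H x" if x: "x \<in> {a..b}" for x
  proof -
    have "((\<lambda>x. V x + (f a - V a)) has_real_derivative H x) (at x within {a..b})"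
      using DV[OF x] by (auto intro!: derivative_eq_intros)
    then have "(f has_real_derivative H x) (at x within {a..b})"
      by (rule has_field_derivative_transform_within[of _ _ _ _ 1])
        (use x const in \<open>auto simp: algebra_simps\<close>)
    with D[OF x] show ?thesis
      using vector_derivative_within_closed_interval[OF \<open>a < b\<close> x]
      by (metis has_real_derivative_iff_has_vector_derivative)
  qed
  then show ?thesis
    using contH continuous_on_cong[OF refl, of "{a..b}" f' H] by blast
qed


lemma classical_has_weak_deriv:
  fixes f f' :: "real \<Rightarrow> real"
  assumes "a \<le> b" and D: "\<And>x. x \<in> {a..b} \<Longrightarrow> (f has_real_derivative f' x) (at x within {a..b})"
    and f': "continuous_on {a..b} f'"
  shows "has_weak_deriv a b f f'"
  unfolding has_weak_deriv_def
proof (intro conjI allI impI)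
  have f: "continuous_on {a..b} f"
    using D by (meson DERIV_continuous_on)
  show "locally_integrable a b f" "locally_integrable a b f'"
    using f f' by (auto intro: continuous_locally_integrable)
  fix \<phi> assume \<phi>: "test_function a b \<phi>"
  then have smooth: "smooth \<phi>"
    by (rule test_function_smooth_imp)
  have "{x. \<phi> x \<noteq> 0} \<subseteq> {a<..<b}"
    using \<phi> closure_subset[of "{x. \<phi> x \<noteq> 0}"] unfolding test_function_def by blast
  then have zero: "\<phi> a = 0" "\<phi> b = 0"
    by auto
  have "((\<lambda>x. f x * \<phi> x) has_real_derivative f' x * \<phi> x + deriv \<phi> x * f x) (at x within {a..b})"
    if "x \<in> {a..b}" for x
    by (intro DERIV_mult D that has_field_derivative_at_within[OF smooth_DERIV[OF smooth]])
  then have "((\<lambda>x. f' x * \<phi> x + deriv \<phi> x * f x) has_integral (f b * \<phi> b - f a * \<phi> a)) {a..b}"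
    by (rule FTC_within) (use \<open>a \<le> b\<close> in auto)
  moreover have c: "continuous_on {a..b} (\<lambda>x. f' x * \<phi> x)" "continuous_on {a..b} (\<lambda>x. f x * deriv \<phi> x)"
    using f f' smooth_continuous_on[OF smooth] smooth_continuous_on[OF smooth_deriv[OF smooth]]
    by (auto intro!: continuous_on_mult)
  ultimately have "integral {a..b} (\<lambda>x. f' x * \<phi> x) + integral {a..b} (\<lambda>x. f x * deriv \<phi> x) = 0"
    by (subst Henstock_Kurzweil_Integration.integral_add[symmetric])
      (auto simp: zero integral_unique mult.commute integrable_continuous_real)
  then show "(\<integral>x. f x * deriv \<phi> x \<partial>lebesgue_on {a<..<b}) = - (\<integral>x. f' x * \<phi> x \<partial>lebesgue_on {a<..<b})"
    using continuous_integrable_Ioo(2)[OF c(1)] continuous_integrable_Ioo(2)[OF c(2)] by simp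
qed

text \<open>The norm is defined through an arbitrary choice of weak derivative; uniqueness makes that choice irrelevant.\<close>

lemma sobolev_norm_1_classical:
  fixes f f' :: "real \<Rightarrow> real"
  assumes "a \<le> b" and D: "\<And>x. x \<in> {a..b} \<Longrightarrow> (f has_real_derivative f' x) (at x within {a..b})"
    and f': "continuous_on {a..b} f'"
  shows "sobolev_norm 1 a b f =
    sqrt ((\<integral>x. (f x)\<^sup>2 \<partial>lebesgue_on {a<..<b}) + (\<integral>x. (f' x)\<^sup>2 \<partial>lebesgue_on {a<..<b}))"
proof -
  have "has_weak_deriv a b f f'"
    by (rule classical_has_weak_deriv) (use assms in auto)
  then have "has_weak_deriv a b f (weak_deriv a b f)"
    unfolding weak_deriv_def by (rule someI[of "has_weak_deriv a b f"])
  from weak_deriv_unique[OF D continuous_locally_integrable[OF f'] this]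
  have "AE x in lebesgue_on {a<..<b}. (f' x)\<^sup>2 = (weak_deriv a b f x)\<^sup>2"
    by (auto elim: eventually_mono)
  moreover have "(\<lambda>x. (f' x)\<^sup>2) \<in> borel_measurable (lebesgue_on {a<..<b})"
    using continuous_square_integrable[OF f'] unfolding square_integrable_def by auto
  ultimately have "(\<integral>x. (weak_deriv a b f x)\<^sup>2 \<partial>lebesgue_on {a<..<b}) = (\<integral>x. (f' x)\<^sup>2 \<partial>lebesgue_on {a<..<b})"
    by (intro integral_lebesgue_on_AE(1)[symmetric]) auto
  then show ?thesis
    by simp
qed

section \<open>Integration by parts and two inequalities\<close>

text \<open>Both sides are continuous up to the end points, where test functions give no direct information.\<close>

lemma weak_deriv_increment_closed:
  fixes X :: "real \<Rightarrow> real"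
  assumes "a < b" and X: "continuous_on {a..b} X" and weak: "has_weak_deriv a b X g"
    and g: "integrable (lebesgue_on {a<..<b}) g" and y: "y \<in> {a..b}"
  shows "X y - X a = integral {a..y} g"
proof -
  have "g absolutely_integrable_on {a<..<b}"
    using g by (simp add: integrable_restrict_space set_integrable_def)
  then have int: "g integrable_on {a..b}"
    by (simp only: absolutely_integrable_on_Icc_iff_Ioo[symmetric] set_lebesgue_integral_eq_integral(1))
  define Z where "Z = (\<lambda>y. X y - integral {a..y} g)"
  have incr: "Z d = Z c" if cd: "a < c" "c \<le> d" "d < b" for c d
  proof -
    have "X d - X c = integral {c..d} g"
    proof (rule weak_deriv_increment[OF weak _ cd])
      fix z assume z: "z \<in> {a<..<b}"
      show "((\<lambda>y. integral {a..y} X) has_real_derivative X z) (at z)"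
        by (rule within_imp_at[OF integral_has_real_derivative[OF X]]) (use z in auto)
    qed
    moreover have "integral {a..c} g + integral {c..d} g = integral {a..d} g"
      by (rule Henstock_Kurzweil_Integration.integral_combine)
        (use cd integrable_subinterval_real[OF int, of a d] in auto)
    ultimately show ?thesis
      by (simp add: Z_def)
  qed
  define m where "m = (a + b) / 2"
  have m: "a < m" "m < b"
    using \<open>a < b\<close> by (auto simp: m_def field_simps)
  have closure: "closure {a<..<b} = {a..b}"
    using \<open>a < b\<close> by simp
  have "continuous_on {a..b} Z"
    unfolding Z_def by (intro continuous_intros X indefinite_integral_continuous_1 int)
  moreover have "Z x = Z m" if "x \<in> {a<..<b}" for x
    using incr[of x m] incr[of m x] that m by (cases "x \<le> m") auto
  ultimately have const: "Z x = Z m" if "x \<in> {a..b}" for x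
    using continuous_constant_on_closure[of "{a<..<b}" Z "Z m" x] that unfolding closure by blast
  from const[OF y] const[of a] \<open>a < b\<close> show ?thesis
    by (simp add: Z_def)
qed

lemma integral_indicator_lebesgue_on:
  fixes k :: "real \<Rightarrow> real"
  assumes "S \<in> sets lebesgue" "S \<subseteq> {a<..<b}"
  shows "(\<integral>x. indicator S x * k x \<partial>lebesgue_on {a<..<b}) = (\<integral>x. k x \<partial>lebesgue_on S)"
proof -
  have "(\<lambda>x. indicator {a<..<b} x *\<^sub>R (indicator S x * k x)) = (\<lambda>x. indicator S x *\<^sub>R k x)"
    using assms(2) by (intro ext) (auto simp: indicator_def)
  then show ?thesis
    using assms(1) by (simp add: integral_restrict_space)
qed

text \<open>\<open>X\<close> is only absolutely continuous, so the product rule is replaced by exchanging the order of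
integration in the double integral of \<open>g s * f' x\<close> over \<open>s < x\<close>.\<close>

lemma integral_by_parts_indefinite:
  fixes f f' g X :: "real \<Rightarrow> real"
  assumes "a < b" and g: "integrable (lebesgue_on {a<..<b}) g"
    and X: "\<And>y. y \<in> {a..b} \<Longrightarrow> X y = integral {a..y} g" and Xb: "X b = 0"
    and D: "\<And>x. x \<in> {a..b} \<Longrightarrow> (f has_real_derivative f' x) (at x within {a..b})"
    and f': "continuous_on {a..b} f'"
  shows "(\<integral>x. X x * f' x \<partial>lebesgue_on {a<..<b}) = - (\<integral>x. g x * f x \<partial>lebesgue_on {a<..<b})"
proof -
  let ?M = "lebesgue_on {a<..<b}"
  interpret M: finite_measure ?M
    by (rule finite_measure_Ioo)
  interpret P: pair_sigma_finite ?M ?M ..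
  have f: "continuous_on {a..b} f"
    using D by (meson DERIV_continuous_on)
  have intf': "integrable ?M f'"
    by (rule continuous_integrable_Ioo(1)[OF f'])
  note [measurable] = borel_measurable_integrable[OF g] borel_measurable_integrable[OF intf']
  have gab: "g absolutely_integrable_on {a<..<b}"
    using g by (simp add: integrable_restrict_space set_integrable_def)
  have id: "(\<lambda>x. x) \<in> borel_measurable ?M"
    using continuous_measurable_lebesgue_on[of "\<lambda>x. x"] by auto
  have set: "{p \<in> space (?M \<Otimes>\<^sub>M ?M). fst p < snd p} \<in> sets (?M \<Otimes>\<^sub>M ?M)"
    using measurable_compose[OF measurable_fst id] measurable_compose[OF measurable_snd id]
    by (intro borel_measurable_less) auto
  have prod: "integrable (?M \<Otimes>\<^sub>M ?M) (\<lambda>p. g (fst p) * f' (snd p))"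
  proof (rule P.Fubini_integrable)
    show "integrable ?M (\<lambda>x. \<integral>y. norm (g (fst (x, y)) * f' (snd (x, y))) \<partial>?M)"
      using g intf' by (auto simp: abs_mult)
  qed (use intf' in auto)
  have "integrable (?M \<Otimes>\<^sub>M ?M)
      (\<lambda>p. indicator {p \<in> space (?M \<Otimes>\<^sub>M ?M). fst p < snd p} p *\<^sub>R (g (fst p) * f' (snd p)))"
    by (rule integrable_mult_indicator[OF set prod])
  then have int: "integrable (?M \<Otimes>\<^sub>M ?M) (\<lambda>(s, x). if s < x then g s * f' x else 0)"
    by (rule Bochner_Integration.integrable_cong[THEN iffD1, OF refl, rotated])
      (auto simp: indicator_def split: prod.splits)
  have "(\<integral>x. X x * f' x \<partial>?M) = (\<integral>x. (\<integral>s. (if s < x then g s * f' x else 0) \<partial>?M) \<partial>?M)"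
  proof (rule Bochner_Integration.integral_cong[OF refl])
    fix x assume x: "x \<in> space ?M"
    have gx: "g absolutely_integrable_on {a<..<x}"
      by (rule set_integrable_subset[OF gab]) (use x in auto)
    have "(\<integral>s. (if s < x then g s * f' x else 0) \<partial>?M) = (\<integral>s. indicator {a<..<x} s * g s * f' x \<partial>?M)"
      by (rule Bochner_Integration.integral_cong) (auto simp: indicator_def)
    also have "\<dots> = (\<integral>s. indicator {a<..<x} s * g s \<partial>?M) * f' x"
      by simp
    also have "(\<integral>s. indicator {a<..<x} s * g s \<partial>?M) = (\<integral>s. g s \<partial>lebesgue_on {a<..<x})"
      by (rule integral_indicator_lebesgue_on) (use x in auto)
    also have "\<dots> = integral {a<..<x} g"
      by (rule lebesgue_integral_eq_integral)
        (use gx in \<open>auto simp: integrable_restrict_space set_integrable_def\<close>)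
    also have "\<dots> = X x"
      using X[of x] x by (simp add: integral_open_interval_real)
    finally show "X x * f' x = (\<integral>s. (if s < x then g s * f' x else 0) \<partial>?M)"
      by simp
  qed
  also have "\<dots> = (\<integral>s. (\<integral>x. (if s < x then g s * f' x else 0) \<partial>?M) \<partial>?M)"
    by (rule P.Fubini_integral[OF int])
  also have "\<dots> = (\<integral>s. g s * f b - g s * f s \<partial>?M)"
  proof (rule Bochner_Integration.integral_cong[OF refl])
    fix s assume s: "s \<in> space ?M"
    have c: "continuous_on {s..b} f'"
      using f' by (rule continuous_on_subset) (use s in auto)
    have "(\<integral>x. (if s < x then g s * f' x else 0) \<partial>?M) = (\<integral>x. g s * (indicator {s<..<b} x * f' x) \<partial>?M)"
      by (rule Bochner_Integration.integral_cong) (auto simp: indicator_def)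
    also have "\<dots> = g s * (\<integral>x. indicator {s<..<b} x * f' x \<partial>?M)"
      by simp
    also have "(\<integral>x. indicator {s<..<b} x * f' x \<partial>?M) = (\<integral>x. f' x \<partial>lebesgue_on {s<..<b})"
      by (rule integral_indicator_lebesgue_on) (use s in auto)
    also have "\<dots> = f b - f s"
      using continuous_integrable_Ioo(2)[OF c] FTC_within[OF D, of s b] s by (simp add: integral_unique)
    finally show "(\<integral>x. (if s < x then g s * f' x else 0) \<partial>?M) = g s * f b - g s * f s"
      by (simp add: algebra_simps)
  qed
  also have "\<dots> = (\<integral>s. g s * f b \<partial>?M) - (\<integral>s. g s * f s \<partial>?M)"
  proof (rule Bochner_Integration.integral_diff)
    have "g absolutely_integrable_on {a..b}"
      using gab by (simp only: absolutely_integrable_on_Icc_iff_Ioo)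
    then have "(\<lambda>s. g s * f s) absolutely_integrable_on {a..b}"
      by (rule absolutely_integrable_mult_continuous[OF _ f])
    then have "(\<lambda>s. g s * f s) absolutely_integrable_on {a<..<b}"
      by (simp only: absolutely_integrable_on_Icc_iff_Ioo)
    then show "integrable ?M (\<lambda>s. g s * f s)"
      by (simp add: integrable_restrict_space set_integrable_def)
  qed (use g in auto)
  also have "(\<integral>s. g s * f b \<partial>?M) = X b * f b"
    using lebesgue_integral_eq_integral[OF g] X[of b] \<open>a < b\<close> by (simp add: integral_open_interval_real)
  finally show ?thesis
    by (simp add: Xb)
qed

text \<open>For \<open>\<eta> > 0\<close> take the least \<open>t\<close> such that \<open>m T - m t \<le> \<eta> (T - t)\<close>. Were it positive, the hypothesis would
provide a smaller one.\<close>

lemma nonincreasing_if_left_increments: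
  fixes m :: "real \<Rightarrow> real"
  assumes "0 \<le> T" and m: "continuous_on {0..T} m"
    and left: "\<And>t \<eta>. 0 < t \<Longrightarrow> t \<le> T \<Longrightarrow> 0 < \<eta> \<Longrightarrow> \<exists>s. 0 \<le> s \<and> s < t \<and> m t - m s \<le> \<eta> * (t - s)"
  shows "m T \<le> m 0"
proof -
  have le: "m T - m 0 \<le> \<eta> * T" if "0 < \<eta>" for \<eta>
  proof -
    define S where "S = {t \<in> {0..T}. m T + \<eta> * t - \<eta> * T \<le> m t}"
    have "closed S"
      unfolding S_def
      by (intro continuous_on_closed_Collect_le continuous_intros m)
    then have "compact ({0..T} \<inter> S)"
      by (intro compact_Int_closed compact_Icc)
    also have "{0..T} \<inter> S = S"
      by (auto simp: S_def)
    finally have "compact S" .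
    moreover have "T \<in> S"
      using \<open>0 \<le> T\<close> by (simp add: S_def)
    ultimately obtain t where t: "t \<in> S" "\<And>s. s \<in> S \<Longrightarrow> t \<le> s"
      using compact_attains_inf[of S] by auto
    have "t = 0"
    proof (rule ccontr)
      assume "t \<noteq> 0"
      with t(1) have t0: "0 < t" "t \<le> T"
        by (auto simp: S_def)
      then obtain s where s: "0 \<le> s" "s < t" "m t - m s \<le> \<eta> * (t - s)"
        using left \<open>0 < \<eta>\<close> by blast
      with t(1) t0 have "s \<in> S"
        by (auto simp: S_def algebra_simps)
      with t(2) s(2) show False
        by force
    qed
    with t(1) show ?thesis
      by (simp add: S_def)
  qed
  show ?thesis
  proof (rule field_le_epsilon)
    fix e :: real assume "0 < e"
    then have "m T - m 0 \<le> e / (T + 1) * T"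
      by (intro le) (use \<open>0 \<le> T\<close> in auto)
    also have "\<dots> \<le> e"
      using \<open>0 < e\<close> \<open>0 \<le> T\<close> by (simp add: field_simps)
    finally show "m T \<le> m 0 + e"
      by simp
  qed
qed

text \<open>A crude form of the inequality of Cauchy and Schwarz, enough to see that the left-hand side tends to zero with
the norm of \<open>g\<close> while \<open>f\<close> is fixed.\<close>

lemma abs_integral_mult_le_sqrt:
  assumes f: "square_integrable a b f" and g: "square_integrable a b g"
  shows "(\<integral>x. \<bar>f x * g x\<bar> \<partial>lebesgue_on {a<..<b}) \<le>
    ((\<integral>x. (f x)\<^sup>2 \<partial>lebesgue_on {a<..<b}) + 1) / 2 * sqrt (\<integral>x. (g x)\<^sup>2 \<partial>lebesgue_on {a<..<b})"
proof -
  let ?M = "lebesgue_on {a<..<b}"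
  have sq: "integrable ?M (\<lambda>x. (f x)\<^sup>2)" "integrable ?M (\<lambda>x. (g x)\<^sup>2)"
    using f g by (auto simp: square_integrable_def)
  define r where "r = sqrt (\<integral>x. (g x)\<^sup>2 \<partial>?M)"
  have r2: "r\<^sup>2 = (\<integral>x. (g x)\<^sup>2 \<partial>?M)" and "0 \<le> r"
    by (auto simp: r_def)
  show ?thesis
  proof (cases "r = 0")
    case True
    with r2 have "AE x in ?M. (g x)\<^sup>2 = 0"
      using integral_nonneg_eq_0_iff_AE[OF sq(2)] by simp
    then have "AE x in ?M. \<bar>f x * g x\<bar> = 0"
      by eventually_elim simp
    then show ?thesis
      using True by (simp add: integral_eq_zero_AE r_def)
  next
    case False
    with \<open>0 \<le> r\<close> have "0 < r"
      by simp
    have "(\<integral>x. \<bar>f x * g x\<bar> \<partial>?M) \<le> (\<integral>x. r / 2 * (f x)\<^sup>2 + (g x)\<^sup>2 / (2 * r) \<partial>?M)"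
    proof (rule integral_mono)
      show "\<bar>f x * g x\<bar> \<le> r / 2 * (f x)\<^sup>2 + (g x)\<^sup>2 / (2 * r)" for x
      proof -
        have "0 \<le> (r * \<bar>f x\<bar> - \<bar>g x\<bar>)\<^sup>2"
          by simp
        then have "2 * r * \<bar>f x * g x\<bar> \<le> r\<^sup>2 * (f x)\<^sup>2 + (g x)\<^sup>2"
          by (simp add: power2_diff power_mult_distrib abs_mult algebra_simps)
        with \<open>0 < r\<close> show ?thesis
          by (simp add: field_simps power2_eq_square)
      qed
    qed (use sq square_integrable_mult[OF f g] in auto)
    also have "\<dots> = (\<integral>x. r / 2 * (f x)\<^sup>2 \<partial>?M) + (\<integral>x. (g x)\<^sup>2 / (2 * r) \<partial>?M)"
      by (rule Bochner_Integration.integral_add) (use sq in auto)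
    also have "\<dots> = r / 2 * (\<integral>x. (f x)\<^sup>2 \<partial>?M) + r\<^sup>2 / (2 * r)"
      by (simp add: r2)
    also have "\<dots> = ((\<integral>x. (f x)\<^sup>2 \<partial>?M) + 1) / 2 * r"
      using \<open>0 < r\<close> by (simp add: field_simps power2_eq_square)
    finally show ?thesis
      by (simp add: r_def)
  qed
qed

text \<open>The one-dimensional Sobolev embedding: \<open>\<bar>f x\<bar>\<close> exceeds \<open>\<bar>f y\<bar>\<close> by at most the integral of \<open>\<bar>f'\<bar>\<close>; average
over \<open>y\<close>.\<close>

lemma sup_le_integral_abs:
  fixes f f' :: "real \<Rightarrow> real"
  assumes "a < b" and D: "\<And>x. x \<in> {a..b} \<Longrightarrow> (f has_real_derivative f' x) (at x within {a..b})"
    and f': "continuous_on {a..b} f'" and x: "x \<in> {a..b}"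
  shows "\<bar>f x\<bar> \<le> (\<integral>y. \<bar>f y\<bar> \<partial>lebesgue_on {a<..<b}) / (b - a) + (\<integral>y. \<bar>f' y\<bar> \<partial>lebesgue_on {a<..<b})"
proof -
  let ?M = "lebesgue_on {a<..<b}"
  have f: "continuous_on {a..b} f"
    using D by (meson DERIV_continuous_on)
  define A where "A = (\<integral>y. \<bar>f' y\<bar> \<partial>?M)"
  have A: "A = integral {a..b} (\<lambda>y. \<bar>f' y\<bar>)"
    unfolding A_def by (rule continuous_integrable_Ioo(2)) (intro continuous_intros f')
  have osc: "\<bar>f d - f c\<bar> \<le> A" if "a \<le> c" "c \<le> d" "d \<le> b" for c d
  proof -
    have cont: "continuous_on {c..d} f'"
      using f' by (rule continuous_on_subset) (use that in auto)
    have "\<bar>f d - f c\<bar> = norm (integral {c..d} f')"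
      using FTC_within[OF D that] by (simp add: integral_unique)
    also have "\<dots> \<le> integral {c..d} (\<lambda>y. \<bar>f' y\<bar>)"
      by (rule integral_norm_bound_integral) (use cont in \<open>auto intro!: integrable_continuous_real continuous_intros\<close>)
    also have "\<dots> \<le> integral {a..b} (\<lambda>y. \<bar>f' y\<bar>)"
      by (rule integral_subset_le) (use cont f' that in \<open>auto intro!: integrable_continuous_real continuous_intros\<close>)
    finally show ?thesis
      by (simp add: A)
  qed
  have int: "integrable ?M (\<lambda>y. \<bar>f y\<bar>)"
    by (rule continuous_integrable_Ioo(1)) (intro continuous_intros f)
  interpret finite_measure ?M
    by (rule finite_measure_Ioo)
  have "\<bar>f x\<bar> * (b - a) = (\<integral>y. \<bar>f x\<bar> \<partial>?M)"
    by (rule integral_const_Ioo[OF less_imp_le[OF \<open>a < b\<close>], symmetric])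
  also have "\<dots> \<le> (\<integral>y. \<bar>f y\<bar> + A \<partial>?M)"
  proof (rule integral_mono)
    fix y assume y: "y \<in> space ?M"
    have "\<bar>f x - f y\<bar> \<le> A"
      using osc[of x y] osc[of y x] x y by (cases "x \<le> y") auto
    then show "\<bar>f x\<bar> \<le> \<bar>f y\<bar> + A"
      by linarith
  qed (use int in auto)
  also have "\<dots> = (\<integral>y. \<bar>f y\<bar> \<partial>?M) + (\<integral>y. A \<partial>?M)"
    by (rule Bochner_Integration.integral_add) (use int in auto)
  also have "(\<integral>y. A \<partial>?M) = A * (b - a)"
    by (rule integral_const_Ioo[OF less_imp_le[OF \<open>a < b\<close>]])
  finally show ?thesis
    using \<open>a < b\<close> by (simp add: A_def field_simps)
qed

section \<open>Dissipation of energy along a trajectory\<close>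

lemma continuous_on_Icc_bounded:
  fixes f :: "real \<Rightarrow> real"
  assumes "continuous_on {a..b} f"
  shows "\<exists>B\<ge>0. \<forall>x\<in>{a..b}. \<bar>f x\<bar> \<le> B"
proof -
  obtain B where B: "\<forall>y\<in>f ` {a..b}. norm y \<le> B"
    using compact_imp_bounded[OF compact_continuous_image[OF assms compact_Icc]]
    unfolding bounded_iff by blast
  show ?thesis
    by (rule exI[of _ "\<bar>B\<bar>"]) (use B in force)
qed

text \<open>What the dissipation inequality uses of a solution on \<open>[0, T]\<close>. Here \<open>G\<close> plays the part of \<open>Q_tilde\<close>, \<open>ux\<close> and
\<open>w\<close> are the space and time derivatives of \<open>u\<close>, and the last assumption is the equation with the Neumann condition
built in: the flux vanishes at both ends of the interval.\<close>

locale energy_trajectory =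
  fixes a b \<epsilon> \<kappa> T :: real and Q G F F' :: "real \<Rightarrow> real" and u ux w :: "real \<Rightarrow> real \<Rightarrow> real"
  assumes ab: "a < b" and eps: "0 < \<epsilon>"
    and Q_cont: "continuous_on {- \<kappa>..\<kappa>} Q" and G_cont: "continuous_on {- \<kappa>..\<kappa>} G"
    and G_convex: "\<And>p q. \<bar>p\<bar> \<le> \<kappa> \<Longrightarrow> \<bar>q\<bar> \<le> \<kappa> \<Longrightarrow> G q + Q q * (p - q) \<le> G p"
    and F_deriv: "\<And>z. (F has_real_derivative F' z) (at z)" and F'_cont: "continuous_on UNIV F'"
    and u_deriv: "\<And>t x. t \<in> {0..T} \<Longrightarrow> x \<in> {a..b} \<Longrightarrow>
      (u t has_real_derivative ux t x) (at x within {a..b})"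
    and ux_cont: "\<And>t. t \<in> {0..T} \<Longrightarrow> continuous_on {a..b} (ux t)"
    and ux_bound: "\<And>t x. t \<in> {0..T} \<Longrightarrow> x \<in> {a..b} \<Longrightarrow> \<bar>\<epsilon>\<^sup>2 * ux t x\<bar> \<le> \<kappa>"
    and u_L2: "\<And>t. t \<in> {0..T} \<Longrightarrow>
      ((\<lambda>s. \<integral>x. (u s x - u t x)\<^sup>2 \<partial>lebesgue_on {a<..<b}) \<longlongrightarrow> 0) (at t within {0..T})"
    and ux_L2: "\<And>t. t \<in> {0..T} \<Longrightarrow>
      ((\<lambda>s. \<integral>x. (ux s x - ux t x)\<^sup>2 \<partial>lebesgue_on {a<..<b}) \<longlongrightarrow> 0) (at t within {0..T})"
    and w_sq: "\<And>t. t \<in> {0..T} \<Longrightarrow> square_integrable a b (w t)"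
    and difference_quotient: "\<And>t. t \<in> {0..T} \<Longrightarrow>
      ((\<lambda>s. \<integral>x. ((u s x - u t x) / (s - t) - w t x)\<^sup>2 \<partial>lebesgue_on {a<..<b}) \<longlongrightarrow> 0)
        (at t within {0..T})"
    and pde: "\<And>t. t \<in> {0<..T} \<Longrightarrow> \<exists>g. integrable (lebesgue_on {a<..<b}) g \<and>
      (\<forall>y\<in>{a..b}. Q (\<epsilon>\<^sup>2 * ux t y) = integral {a..y} g) \<and> Q (\<epsilon>\<^sup>2 * ux t b) = 0 \<and>
      (AE x in lebesgue_on {a<..<b}. w t x = g x - F' (u t x))"
begin

abbreviation "M \<equiv> lebesgue_on {a<..<b}"

definition en :: "real \<Rightarrow> real" where
  "en t = (\<integral>x. G (\<epsilon>\<^sup>2 * ux t x) / \<epsilon> ^ 3 + F (u t x) / \<epsilon> \<partial>M)"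

lemma u_cont: "t \<in> {0..T} \<Longrightarrow> continuous_on {a..b} (u t)"
  using u_deriv by (meson DERIV_continuous_on)

lemma flux_cont: "t \<in> {0..T} \<Longrightarrow> continuous_on {a..b} (\<lambda>x. Q (\<epsilon>\<^sup>2 * ux t x))"
  by (rule continuous_on_compose2[OF Q_cont])
    (use ux_bound in \<open>auto intro!: continuous_intros ux_cont simp: abs_le_iff minus_le_iff\<close>)

lemma bulk_cont: "t \<in> {0..T} \<Longrightarrow> continuous_on {a..b} (\<lambda>x. G (\<epsilon>\<^sup>2 * ux t x))"
  by (rule continuous_on_compose2[OF G_cont])
    (use ux_bound in \<open>auto intro!: continuous_intros ux_cont simp: abs_le_iff minus_le_iff\<close>)

lemma F_cont: "continuous_on S F"
  using F_deriv by (meson DERIV_isCont continuous_at_imp_continuous_on)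

lemma Fu_cont: "t \<in> {0..T} \<Longrightarrow> continuous_on {a..b} (\<lambda>x. F (u t x))"
  by (rule continuous_on_compose2[OF F_cont[of UNIV]]) (auto intro: u_cont)

lemma F'u_cont: "t \<in> {0..T} \<Longrightarrow> continuous_on {a..b} (\<lambda>x. F' (u t x))"
  by (rule continuous_on_compose2[OF F'_cont]) (auto intro: u_cont)

lemma L1_tendsto_0:
  assumes "\<And>s. s \<in> {0..T} \<Longrightarrow> square_integrable a b (f s)"
    and lim: "((\<lambda>s. \<integral>x. (f s x)\<^sup>2 \<partial>M) \<longlongrightarrow> 0) (at t within {0..T})"
    and g: "square_integrable a b g"
  shows "((\<lambda>s. \<integral>x. \<bar>g x * f s x\<bar> \<partial>M) \<longlongrightarrow> 0) (at t within {0..T})"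
proof (rule tendsto_sandwich[of "\<lambda>_. 0"])
  show "\<forall>\<^sub>F s in at t within {0..T}. (\<integral>x. \<bar>g x * f s x\<bar> \<partial>M) \<le>
      ((\<integral>x. (g x)\<^sup>2 \<partial>M) + 1) / 2 * sqrt (\<integral>x. (f s x)\<^sup>2 \<partial>M)"
    unfolding eventually_at_filter
    by (intro always_eventually allI impI abs_integral_mult_le_sqrt assms)
  have "((\<lambda>s. ((\<integral>x. (g x)\<^sup>2 \<partial>M) + 1) / 2 * sqrt (\<integral>x. (f s x)\<^sup>2 \<partial>M)) \<longlongrightarrow>
      ((\<integral>x. (g x)\<^sup>2 \<partial>M) + 1) / 2 * sqrt 0) (at t within {0..T})"
    by (intro tendsto_intros lim)
  then show "((\<lambda>s. ((\<integral>x. (g x)\<^sup>2 \<partial>M) + 1) / 2 * sqrt (\<integral>x. (f s x)\<^sup>2 \<partial>M)) \<longlongrightarrow> 0) (at t within {0..T})"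
    by simp
  show "\<forall>\<^sub>F s in at t within {0..T}. 0 \<le> (\<integral>x. \<bar>g x * f s x\<bar> \<partial>M)"
    by (rule always_eventually) auto
qed (rule tendsto_const)

lemma one_square_integrable: "square_integrable a b (\<lambda>_. 1)"
  by (intro continuous_square_integrable continuous_intros)

lemma u_L1:
  assumes "t \<in> {0..T}"
  shows "((\<lambda>s. \<integral>x. \<bar>u s x - u t x\<bar> \<partial>M) \<longlongrightarrow> 0) (at t within {0..T})"
proof -
  have "((\<lambda>s. \<integral>x. \<bar>1 * (u s x - u t x)\<bar> \<partial>M) \<longlongrightarrow> 0) (at t within {0..T})"
    by (rule L1_tendsto_0[OF _ u_L2[OF assms] one_square_integrable])
      (intro continuous_square_integrable continuous_intros u_cont assms)
  then show ?thesis
    by simp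
qed

lemma ux_L1:
  assumes "t \<in> {0..T}"
  shows "((\<lambda>s. \<integral>x. \<bar>ux s x - ux t x\<bar> \<partial>M) \<longlongrightarrow> 0) (at t within {0..T})"
proof -
  have "((\<lambda>s. \<integral>x. \<bar>1 * (ux s x - ux t x)\<bar> \<partial>M) \<longlongrightarrow> 0) (at t within {0..T})"
    by (rule L1_tendsto_0[OF _ ux_L2[OF assms] one_square_integrable])
      (intro continuous_square_integrable continuous_intros ux_cont assms)
  then show ?thesis
    by simp
qed

lemma u_uniform:
  assumes t: "t \<in> {0..T}" and "0 < \<delta>"
  shows "\<forall>\<^sub>F s in at t within {0..T}. \<forall>x\<in>{a..b}. \<bar>u s x - u t x\<bar> < \<delta>"
proof -
  have "((\<lambda>s. (\<integral>x. \<bar>u s x - u t x\<bar> \<partial>M) / (b - a) + (\<integral>x. \<bar>ux s x - ux t x\<bar> \<partial>M)) \<longlongrightarrow> 0 / (b - a) + 0)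
      (at t within {0..T})"
    by (intro tendsto_intros u_L1 ux_L1 t) (use ab in auto)
  then have "\<forall>\<^sub>F s in at t within {0..T}.
      (\<integral>x. \<bar>u s x - u t x\<bar> \<partial>M) / (b - a) + (\<integral>x. \<bar>ux s x - ux t x\<bar> \<partial>M) < \<delta>"
    using \<open>0 < \<delta>\<close> by (auto dest: order_tendstoD(2))
  moreover have "\<forall>\<^sub>F s in at t within {0..T}. s \<in> {0..T}"
    by (auto simp: eventually_at_filter)
  ultimately show ?thesis
  proof eventually_elim
    case (elim s)
    show ?case
    proof
      fix x assume x: "x \<in> {a..b}"
      have "\<bar>u s x - u t x\<bar> \<le> (\<integral>x. \<bar>u s x - u t x\<bar> \<partial>M) / (b - a) + (\<integral>x. \<bar>ux s x - ux t x\<bar> \<partial>M)"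
      proof (rule sup_le_integral_abs[OF ab _ _ x])
        show "continuous_on {a..b} (\<lambda>x. ux s x - ux t x)"
          by (intro continuous_intros ux_cont t elim)
        show "((\<lambda>x. u s x - u t x) has_real_derivative ux s x - ux t x) (at x within {a..b})"
          if "x \<in> {a..b}" for x
          by (intro DERIV_diff u_deriv t elim that)
      qed
      with elim show "\<bar>u s x - u t x\<bar> < \<delta>"
        by linarith
    qed
  qed
qed

lemma F_linearisation:
  assumes t: "t \<in> {0..T}" and "0 < \<eta>"
  shows "\<forall>\<^sub>F s in at t within {0..T}. \<forall>x\<in>{a..b}.
    \<bar>F (u s x) - F (u t x) - F' (u t x) * (u s x - u t x)\<bar> \<le> \<eta> * \<bar>u s x - u t x\<bar>"
proof -
  obtain R where R: "\<And>x. x \<in> {a..b} \<Longrightarrow> \<bar>u t x\<bar> \<le> R"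
    using continuous_on_Icc_bounded[OF u_cont[OF t]] by blast
  have "uniformly_continuous_on {- R - 1..R + 1} F'"
    by (intro compact_uniformly_continuous continuous_on_subset[OF F'_cont]) auto
  then obtain \<delta> where \<delta>: "0 < \<delta>"
    "\<And>y z. y \<in> {- R - 1..R + 1} \<Longrightarrow> z \<in> {- R - 1..R + 1} \<Longrightarrow> \<bar>y - z\<bar> < \<delta> \<Longrightarrow> \<bar>F' y - F' z\<bar> < \<eta>"
    using \<open>0 < \<eta>\<close> unfolding uniformly_continuous_on_def dist_real_def by metis
  have "\<forall>\<^sub>F s in at t within {0..T}. \<forall>x\<in>{a..b}. \<bar>u s x - u t x\<bar> < min \<delta> 1"
    using \<delta>(1) by (intro u_uniform[OF t]) auto
  then show ?thesis
  proof eventually_elim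
    case (elim s)
    show ?case
    proof
      fix x assume x: "x \<in> {a..b}"
      define p q where "p = u s x" and "q = u t x"
      have pq: "\<bar>p - q\<bar> < \<delta>" "\<bar>p - q\<bar> < 1" "\<bar>q\<bar> \<le> R"
        using elim x R[OF x] by (auto simp: p_def q_def)
      have mvt: "\<exists>z. min p q \<le> z \<and> z \<le> max p q \<and> F p - F q = F' z * (p - q)"
      proof -
        consider "p < q" | "p = q" | "q < p" by linarith
        then show ?thesis
        proof cases
          case 1
          then obtain z where "p < z" "z < q" "F q - F p = (q - p) * F' z"
            using MVT2[of p q F F'] F_deriv by blast
          then show ?thesis
            using 1 by (intro exI[of _ z]) (auto simp: algebra_simps)
        next
          case 3
          then obtain z where "q < z" "z < p" "F p - F q = (p - q) * F' z"
            using MVT2[of q p F F'] F_deriv by blast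
          then show ?thesis
            using 3 by (intro exI[of _ z]) (auto simp: algebra_simps)
        qed auto
      qed
      then obtain z where z: "min p q \<le> z" "z \<le> max p q" "F p - F q = F' z * (p - q)"
        by blast
      have "\<bar>F' z - F' q\<bar> < \<eta>"
        by (rule \<delta>(2)) (use z pq in \<open>auto simp: min_def max_def abs_if split: if_splits\<close>)
      then have "\<bar>F' z - F' q\<bar> * \<bar>p - q\<bar> \<le> \<eta> * \<bar>p - q\<bar>"
        by (intro mult_right_mono) auto
      moreover have "F p - F q - F' q * (p - q) = (F' z - F' q) * (p - q)"
        using z(3) by (simp add: algebra_simps)
      ultimately show "\<bar>F (u s x) - F (u t x) - F' (u t x) * (u s x - u t x)\<bar> \<le> \<eta> * \<bar>u s x - u t x\<bar>"
        by (simp add: abs_mult p_def q_def)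
    qed
  qed
qed

lemma en_integrable: "t \<in> {0..T} \<Longrightarrow> continuous_on {a..b} (\<lambda>x. G (\<epsilon>\<^sup>2 * ux t x) / \<epsilon> ^ 3 + F (u t x) / \<epsilon>)"
  by (intro continuous_intros bulk_cont Fu_cont) (use eps in auto)

lemma en_diff:
  assumes "s \<in> {0..T}" "t \<in> {0..T}"
  shows "en s - en t = (\<integral>x. (G (\<epsilon>\<^sup>2 * ux s x) - G (\<epsilon>\<^sup>2 * ux t x)) / \<epsilon> ^ 3 + (F (u s x) - F (u t x)) / \<epsilon> \<partial>M)"
  unfolding en_def using continuous_integrable_Ioo(1)[OF en_integrable] assms
  by (subst Bochner_Integration.integral_diff[symmetric]) (auto simp: diff_divide_distrib algebra_simps)

lemma flux_bounded: "\<exists>B\<ge>0. \<forall>p. \<bar>p\<bar> \<le> \<kappa> \<longrightarrow> \<bar>Q p\<bar> \<le> B"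
  using continuous_on_Icc_bounded[OF Q_cont] by (auto simp: abs_le_iff minus_le_iff)

lemma en_continuous: "continuous_on {0..T} en"
  unfolding continuous_on_def
proof
  fix t assume t: "t \<in> {0..T}"
  obtain B where B: "0 \<le> B" "\<And>p. \<bar>p\<bar> \<le> \<kappa> \<Longrightarrow> \<bar>Q p\<bar> \<le> B"
    using flux_bounded by blast
  obtain K where K: "\<And>x. x \<in> {a..b} \<Longrightarrow> \<bar>F' (u t x)\<bar> \<le> K"
    using continuous_on_Icc_bounded[OF F'u_cont[OF t]] by blast
  have Gdiff: "\<bar>G p - G q\<bar> \<le> B * \<bar>p - q\<bar>" if "\<bar>p\<bar> \<le> \<kappa>" "\<bar>q\<bar> \<le> \<kappa>" for p q
  proof -
    have "\<bar>Q q * (p - q)\<bar> \<le> B * \<bar>p - q\<bar>" "\<bar>Q p * (q - p)\<bar> \<le> B * \<bar>p - q\<bar>"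
      using B(2)[OF that(1)] B(2)[OF that(2)] by (auto simp: abs_mult abs_minus_commute intro!: mult_right_mono)
    with G_convex[OF that] G_convex[OF that(2,1)] show ?thesis
      by linarith
  qed
  let ?bd = "\<lambda>s. B / \<epsilon> * (\<integral>x. \<bar>ux s x - ux t x\<bar> \<partial>M) + (K + 1) / \<epsilon> * (\<integral>x. \<bar>u s x - u t x\<bar> \<partial>M)"
  have "\<forall>\<^sub>F s in at t within {0..T}. s \<in> {0..T}"
    by (auto simp: eventually_at_filter)
  then have "\<forall>\<^sub>F s in at t within {0..T}. norm (en s - en t) \<le> ?bd s"
    using F_linearisation[OF t zero_less_one]
  proof eventually_elim
    case (elim s)
    note cont = continuous_on_diff[OF u_cont[OF elim(1)] u_cont[OF t]]
      continuous_on_diff[OF ux_cont[OF elim(1)] ux_cont[OF t]]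
    note int = cont[THEN continuous_on_rabs, THEN continuous_integrable_Ioo(1)]
    have "norm (en s - en t) \<le> (\<integral>x. B / \<epsilon> * \<bar>ux s x - ux t x\<bar> + (K + 1) / \<epsilon> * \<bar>u s x - u t x\<bar> \<partial>M)"
      unfolding en_diff[OF elim(1) t]
    proof (rule Bochner_Integration.integral_norm_bound_integral)
      show "integrable M (\<lambda>x. (G (\<epsilon>\<^sup>2 * ux s x) - G (\<epsilon>\<^sup>2 * ux t x)) / \<epsilon> ^ 3 + (F (u s x) - F (u t x)) / \<epsilon>)"
        by (intro continuous_integrable_Ioo(1) continuous_intros bulk_cont Fu_cont t elim) (use eps in auto)
      fix x assume x: "x \<in> space M"
      then have xab: "x \<in> {a..b}"
        by auto
      have "\<bar>G (\<epsilon>\<^sup>2 * ux s x) - G (\<epsilon>\<^sup>2 * ux t x)\<bar> \<le> B * \<bar>\<epsilon>\<^sup>2 * ux s x - \<epsilon>\<^sup>2 * ux t x\<bar>"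
        by (intro Gdiff ux_bound elim t xab)
      also have "\<dots> = \<epsilon> ^ 3 * (B / \<epsilon> * \<bar>ux s x - ux t x\<bar>)"
        using eps by (simp add: right_diff_distrib[symmetric] abs_mult power2_eq_square power3_eq_cube)
      finally have 1: "\<bar>(G (\<epsilon>\<^sup>2 * ux s x) - G (\<epsilon>\<^sup>2 * ux t x)) / \<epsilon> ^ 3\<bar> \<le> B / \<epsilon> * \<bar>ux s x - ux t x\<bar>"
        using eps by (simp add: abs_divide divide_le_eq mult.commute)
      have "\<bar>F (u s x) - F (u t x)\<bar> \<le> \<bar>F' (u t x) * (u s x - u t x)\<bar> + 1 * \<bar>u s x - u t x\<bar>"
        using bspec[OF elim(2) xab] by linarith
      also have "\<dots> \<le> K * \<bar>u s x - u t x\<bar> + 1 * \<bar>u s x - u t x\<bar>"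
        unfolding abs_mult by (intro add_mono mult_right_mono K xab) auto
      finally have "\<bar>(F (u s x) - F (u t x)) / \<epsilon>\<bar> \<le> (K + 1) / \<epsilon> * \<bar>u s x - u t x\<bar>"
        using eps by (simp add: abs_divide divide_right_mono distrib_right)
      with 1 show "norm ((G (\<epsilon>\<^sup>2 * ux s x) - G (\<epsilon>\<^sup>2 * ux t x)) / \<epsilon> ^ 3 + (F (u s x) - F (u t x)) / \<epsilon>)
          \<le> B / \<epsilon> * \<bar>ux s x - ux t x\<bar> + (K + 1) / \<epsilon> * \<bar>u s x - u t x\<bar>"
        unfolding real_norm_def by linarith
    qed (use int in auto)
    also have "\<dots> = (\<integral>x. B / \<epsilon> * \<bar>ux s x - ux t x\<bar> \<partial>M) + (\<integral>x. (K + 1) / \<epsilon> * \<bar>u s x - u t x\<bar> \<partial>M)"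
      by (rule Bochner_Integration.integral_add; rule integrable_mult_right; rule int)
    also have "\<dots> = ?bd s"
      by (simp only: integral_mult_right_zero)
    finally show ?case .
  qed
  moreover have "(?bd \<longlongrightarrow> B / \<epsilon> * 0 + (K + 1) / \<epsilon> * 0) (at t within {0..T})"
    by (intro tendsto_intros u_L1 ux_L1 t)
  ultimately have "((\<lambda>s. en s - en t) \<longlongrightarrow> 0) (at t within {0..T})"
    by (intro Lim_null_comparison[of "\<lambda>s. en s - en t" ?bd]) simp_all
  then show "(en \<longlongrightarrow> en t) (at t within {0..T})"
    by (simp add: LIM_zero_iff)
qed

text \<open>By convexity, \<open>en s - en t\<close> is at least its linearisation at time \<open>t\<close>. After integration by parts the
equation turns the linear part into \<open>-1/\<epsilon>\<close> times the integral of \<open>w t * (u s - u t)\<close>, and \<open>u s - u t\<close> is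
\<open>(s - t) * w t\<close> up to a small error. The linearisation bounds \<open>en s\<close> from below,
which is the useful direction for \<open>s < t\<close>, and it involves the derivative of the flux at the single time \<open>t\<close> only.\<close>

lemma en_left_increment:
  assumes t: "t \<in> {0<..T}" and "0 < \<eta>"
  shows "\<forall>\<^sub>F s in at t within {0..T}. s < t \<longrightarrow>
    en t - en s \<le> (t - s) / \<epsilon> * (\<eta> - (\<integral>x. (w t x)\<^sup>2 \<partial>M)) \<and>
    (\<integral>x. \<bar>u t x - u s x\<bar> \<partial>M) \<le> (t - s) * ((\<integral>x. \<bar>w t x\<bar> \<partial>M) + \<eta>)"
proof -
  have t0: "t \<in> {0..T}"
    using t by auto
  obtain g where g: "integrable M g" "\<And>y. y \<in> {a..b} \<Longrightarrow> Q (\<epsilon>\<^sup>2 * ux t y) = integral {a..y} g"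
    "Q (\<epsilon>\<^sup>2 * ux t b) = 0" "AE x in M. w t x = g x - F' (u t x)"
    using pde[OF t] by blast
  note wsq = w_sq[OF t0]
  have intw: "integrable M (\<lambda>x. \<bar>w t x\<bar>)" "integrable M (\<lambda>x. (w t x)\<^sup>2)"
    using square_integrable_integrable[OF wsq] wsq by (auto simp: square_integrable_def)
  define R where "R = (\<lambda>s x. (u s x - u t x) / (s - t) - w t x)"
  have Rsq: "square_integrable a b (R s)" if "s \<in> {0..T}" for s
    unfolding R_def divide_inverse
    by (intro square_integrable_diff wsq continuous_square_integrable continuous_intros u_cont that t0)
  define IR where "IR = (\<lambda>s. \<integral>x. \<bar>R s x\<bar> \<partial>M)"
  define IwR where "IwR = (\<lambda>s. \<integral>x. \<bar>w t x * R s x\<bar> \<partial>M)"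
  define Iw where "Iw = (\<integral>x. \<bar>w t x\<bar> \<partial>M)"
  have "((\<lambda>s. \<integral>x. \<bar>1 * R s x\<bar> \<partial>M) \<longlongrightarrow> 0) (at t within {0..T})"
    by (rule L1_tendsto_0[OF Rsq _ one_square_integrable])
      (use difference_quotient[OF t0] in \<open>simp_all add: R_def\<close>)
  then have IR: "(IR \<longlongrightarrow> 0) (at t within {0..T})"
    by (simp add: IR_def)
  have IwR: "(IwR \<longlongrightarrow> 0) (at t within {0..T})"
    unfolding IwR_def
    by (rule L1_tendsto_0[OF Rsq _ wsq]) (use difference_quotient[OF t0] in \<open>simp_all add: R_def\<close>)
  \<comment> \<open>So that the nonlinear remainder of \<open>F\<close>, at most \<open>\<eta>'\<close> times the \<open>L\<^sup>1\<close> increment of \<open>u\<close>, uses up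
    half of the admissible error.\<close>
  define \<eta>' where "\<eta>' = \<eta> / (2 * (Iw + 1))"
  have "0 \<le> Iw"
    by (simp add: Iw_def)
  then have \<eta>': "0 < \<eta>'" "\<eta>' * (Iw + 1) = \<eta> / 2"
    using \<open>0 < \<eta>\<close> by (auto simp: \<eta>'_def field_simps)
  have "\<forall>\<^sub>F s in at t within {0..T}. s \<in> {0..T}"
    by (auto simp: eventually_at_filter)
  moreover note F_linearisation[OF t0 \<eta>'(1)]
  moreover have "\<forall>\<^sub>F s in at t within {0..T}. IR s < min 1 \<eta>"
    using \<open>0 < \<eta>\<close> by (intro order_tendstoD(2)[OF IR]) auto
  moreover have "\<forall>\<^sub>F s in at t within {0..T}. IwR s < \<eta> / 2"
    using \<open>0 < \<eta>\<close> by (intro order_tendstoD(2)[OF IwR]) auto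
  ultimately show ?thesis
  proof eventually_elim
    case (elim s)
    note s0 = elim(1)
    show ?case
    proof (intro impI)
      assume "s < t"
      have us: "u s x - u t x = (s - t) * (w t x + R s x)" for x
        using \<open>s < t\<close> by (simp add: R_def)
      have absR: "integrable M (\<lambda>x. \<bar>R s x\<bar>)"
        using square_integrable_integrable[OF Rsq[OF s0]] by simp
      have du: "continuous_on {a..b} (\<lambda>x. u s x - u t x)"
        and dux: "continuous_on {a..b} (\<lambda>x. ux s x - ux t x)"
        by (intro continuous_intros u_cont ux_cont s0 t0)+
      have L1: "(\<integral>x. \<bar>u s x - u t x\<bar> \<partial>M) \<le> (t - s) * (Iw + IR s)"
      proof -
        have "(\<integral>x. \<bar>u s x - u t x\<bar> \<partial>M) \<le> (\<integral>x. (t - s) * (\<bar>w t x\<bar> + \<bar>R s x\<bar>) \<partial>M)"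
        proof (rule integral_mono)
          show "integrable M (\<lambda>x. \<bar>u s x - u t x\<bar>)"
            by (intro continuous_integrable_Ioo(1) continuous_intros du)
          show "\<bar>u s x - u t x\<bar> \<le> (t - s) * (\<bar>w t x\<bar> + \<bar>R s x\<bar>)" for x
            unfolding us abs_mult using \<open>s < t\<close> by (intro mult_mono) auto
        qed (use intw absR in auto)
        also have "\<dots> = (t - s) * (Iw + IR s)"
          using intw absR by (simp add: Iw_def IR_def)
        finally show ?thesis .
      qed
      have "(\<integral>x. \<bar>u t x - u s x\<bar> \<partial>M) = (\<integral>x. \<bar>u s x - u t x\<bar> \<partial>M)"
        by (simp only: abs_minus_commute)
      also note L1
      also have "(t - s) * (Iw + IR s) \<le> (t - s) * (Iw + \<eta>)"
        using \<open>s < t\<close> elim(3) by (intro mult_left_mono) auto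
      finally have second: "(\<integral>x. \<bar>u t x - u s x\<bar> \<partial>M) \<le> (t - s) * ((\<integral>x. \<bar>w t x\<bar> \<partial>M) + \<eta>)"
        by (simp add: Iw_def)
      let ?flux = "\<lambda>x. Q (\<epsilon>\<^sup>2 * ux t x) * (ux s x - ux t x)"
      let ?bulk = "\<lambda>x. F' (u t x) * (u s x - u t x)"
      let ?rest = "\<lambda>x. \<eta>' * \<bar>u s x - u t x\<bar>"
      have cont: "continuous_on {a..b} ?flux" "continuous_on {a..b} ?bulk" "continuous_on {a..b} ?rest"
        by (intro continuous_intros flux_cont[OF t0] dux F'u_cont[OF t0] du)+
      note int = cont[THEN continuous_integrable_Ioo(1)]
      have "en s - en t \<ge> (\<integral>x. (?flux x + ?bulk x - ?rest x) / \<epsilon> \<partial>M)"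
        unfolding en_diff[OF s0 t0]
      proof (rule integral_mono)
        show "integrable M (\<lambda>x. (G (\<epsilon>\<^sup>2 * ux s x) - G (\<epsilon>\<^sup>2 * ux t x)) / \<epsilon> ^ 3 + (F (u s x) - F (u t x)) / \<epsilon>)"
          by (intro continuous_integrable_Ioo(1) continuous_intros bulk_cont Fu_cont t0 s0) (use eps in auto)
        show "integrable M (\<lambda>x. (?flux x + ?bulk x - ?rest x) / \<epsilon>)"
          using int by auto
        fix x assume "x \<in> space M"
        then have xab: "x \<in> {a..b}"
          by auto
        have "Q (\<epsilon>\<^sup>2 * ux t x) * (\<epsilon>\<^sup>2 * ux s x - \<epsilon>\<^sup>2 * ux t x) \<le> G (\<epsilon>\<^sup>2 * ux s x) - G (\<epsilon>\<^sup>2 * ux t x)"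
          using G_convex[OF ux_bound[OF s0 xab] ux_bound[OF t0 xab]] by simp
        then have "Q (\<epsilon>\<^sup>2 * ux t x) * (\<epsilon>\<^sup>2 * ux s x - \<epsilon>\<^sup>2 * ux t x) / \<epsilon> ^ 3 \<le>
            (G (\<epsilon>\<^sup>2 * ux s x) - G (\<epsilon>\<^sup>2 * ux t x)) / \<epsilon> ^ 3"
          using eps by (intro divide_right_mono) auto
        moreover have "Q (\<epsilon>\<^sup>2 * ux t x) * (\<epsilon>\<^sup>2 * ux s x - \<epsilon>\<^sup>2 * ux t x) / \<epsilon> ^ 3 = ?flux x / \<epsilon>"
          using eps by (simp add: field_simps power2_eq_square power3_eq_cube)
        moreover have "(?bulk x - ?rest x) / \<epsilon> \<le> (F (u s x) - F (u t x)) / \<epsilon>"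
          using bspec[OF elim(2) xab] eps by (intro divide_right_mono) linarith+
        ultimately show "(?flux x + ?bulk x - ?rest x) / \<epsilon> \<le>
            (G (\<epsilon>\<^sup>2 * ux s x) - G (\<epsilon>\<^sup>2 * ux t x)) / \<epsilon> ^ 3 + (F (u s x) - F (u t x)) / \<epsilon>"
          by (simp add: add_divide_distrib diff_divide_distrib)
      qed
      also have "(\<integral>x. (?flux x + ?bulk x - ?rest x) / \<epsilon> \<partial>M) =
          ((\<integral>x. ?flux x \<partial>M) + (\<integral>x. ?bulk x \<partial>M) - (\<integral>x. ?rest x \<partial>M)) / \<epsilon>"
        using int by simp
      also have "(\<integral>x. ?flux x \<partial>M) = - (\<integral>x. g x * (u s x - u t x) \<partial>M)"
        by (rule integral_by_parts_indefinite[OF ab g(1,2,3) _ dux])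
          (assumption | intro DERIV_diff u_deriv s0 t0)+
      finally have low: "- (\<integral>x. g x * (u s x - u t x) \<partial>M) + (\<integral>x. ?bulk x \<partial>M) - (\<integral>x. ?rest x \<partial>M)
          \<le> \<epsilon> * (en s - en t)"
        using eps by (simp add: pos_divide_le_eq mult.commute)
      have wu: "integrable M (\<lambda>x. w t x * (u s x - u t x))"
        by (rule square_integrable_mult[OF wsq continuous_square_integrable[OF du]])
      have "(\<integral>x. w t x * (u s x - u t x) + ?bulk x \<partial>M) = (\<integral>x. g x * (u s x - u t x) \<partial>M)"
      proof (rule integral_lebesgue_on_AE(1))
        show "(\<lambda>x. w t x * (u s x - u t x) + ?bulk x) \<in> borel_measurable M"
          using wu int(2) by auto
        show "AE x in M. w t x * (u s x - u t x) + ?bulk x = g x * (u s x - u t x)"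
          using g(4) by eventually_elim (simp add: left_diff_distrib)
      qed simp
      then have "(\<integral>x. g x * (u s x - u t x) \<partial>M) = (\<integral>x. w t x * (u s x - u t x) \<partial>M) + (\<integral>x. ?bulk x \<partial>M)"
        using wu int(2) by simp
      with low have low2: "- (\<integral>x. w t x * (u s x - u t x) \<partial>M) - (\<integral>x. ?rest x \<partial>M) \<le> \<epsilon> * (en s - en t)"
        by simp
      have "(\<integral>x. w t x * (u s x - u t x) \<partial>M) \<le> (\<integral>x. (t - s) * (\<bar>w t x * R s x\<bar> - (w t x)\<^sup>2) \<partial>M)"
      proof (rule integral_mono)
        show "w t x * (u s x - u t x) \<le> (t - s) * (\<bar>w t x * R s x\<bar> - (w t x)\<^sup>2)" for x
        proof -
          have "w t x * (u s x - u t x) = (t - s) * (- (w t x * R s x) - (w t x)\<^sup>2)"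
            unfolding us by (simp add: algebra_simps power2_eq_square)
          also have "\<dots> \<le> (t - s) * (\<bar>w t x * R s x\<bar> - (w t x)\<^sup>2)"
            using \<open>s < t\<close> by (intro mult_left_mono) auto
          finally show ?thesis .
        qed
        show "integrable M (\<lambda>x. (t - s) * (\<bar>w t x * R s x\<bar> - (w t x)\<^sup>2))"
          using square_integrable_mult[OF wsq Rsq[OF s0]] intw by auto
      qed (rule wu)
      also have "\<dots> = (t - s) * (IwR s - (\<integral>x. (w t x)\<^sup>2 \<partial>M))"
        using square_integrable_mult[OF wsq Rsq[OF s0]] intw by (simp add: IwR_def)
      finally have cross: "(\<integral>x. w t x * (u s x - u t x) \<partial>M) \<le> (t - s) * (IwR s - (\<integral>x. (w t x)\<^sup>2 \<partial>M))" .
      have "(\<integral>x. ?rest x \<partial>M) = \<eta>' * (\<integral>x. \<bar>u s x - u t x\<bar> \<partial>M)"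
        by simp
      also have "\<dots> \<le> \<eta>' * ((t - s) * (Iw + 1))"
        using L1 elim(3) \<eta>' \<open>s < t\<close>
        by (intro mult_left_mono order_trans[OF L1] mult_left_mono) auto
      also have "\<dots> = (t - s) * (\<eta> / 2)"
        using \<eta>'(2) by (metis mult.left_commute)
      finally have rest: "(\<integral>x. ?rest x \<partial>M) \<le> (t - s) * (\<eta> / 2)" .
      have "\<epsilon> * (en t - en s) \<le> (t - s) * (IwR s - (\<integral>x. (w t x)\<^sup>2 \<partial>M)) + (t - s) * (\<eta> / 2)"
      proof -
        have "\<epsilon> * (en t - en s) = - (\<epsilon> * (en s - en t))"
          by (simp add: algebra_simps)
        with low2 cross rest show ?thesis
          by linarith
      qed
      also have "\<dots> = (t - s) * (IwR s + \<eta> / 2 - (\<integral>x. (w t x)\<^sup>2 \<partial>M))"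
        by (simp add: algebra_simps)
      also have "\<dots> \<le> (t - s) * (\<eta> - (\<integral>x. (w t x)\<^sup>2 \<partial>M))"
        using \<open>s < t\<close> elim(4) by (intro mult_left_mono) auto
      finally have "en t - en s \<le> (t - s) / \<epsilon> * (\<eta> - (\<integral>x. (w t x)\<^sup>2 \<partial>M))"
        using eps by (simp add: pos_le_divide_eq mult.commute)
      with second show "en t - en s \<le> (t - s) / \<epsilon> * (\<eta> - (\<integral>x. (w t x)\<^sup>2 \<partial>M)) \<and>
          (\<integral>x. \<bar>u t x - u s x\<bar> \<partial>M) \<le> (t - s) * ((\<integral>x. \<bar>w t x\<bar> \<partial>M) + \<eta>)"
        by blast
    qed
  qed
qed

lemma L1_distance_triangle:
  assumes v: "integrable M v" and s: "s \<in> {0..T}" and t: "t \<in> {0..T}"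
  shows "(\<integral>x. \<bar>u t x - v x\<bar> \<partial>M) \<le> (\<integral>x. \<bar>u t x - u s x\<bar> \<partial>M) + (\<integral>x. \<bar>u s x - v x\<bar> \<partial>M)"
proof -
  have int: "integrable M (u p)" if "p \<in> {0..T}" for p
    by (rule continuous_integrable_Ioo(1)[OF u_cont[OF that]])
  have i: "integrable M (\<lambda>x. \<bar>u t x - u s x\<bar>)" "integrable M (\<lambda>x. \<bar>u s x - v x\<bar>)"
    using int[OF s] int[OF t] v by auto
  have "(\<integral>x. \<bar>u t x - v x\<bar> \<partial>M) \<le> (\<integral>x. \<bar>u t x - u s x\<bar> + \<bar>u s x - v x\<bar> \<partial>M)"
    by (rule integral_mono) (use i int[OF t] v in auto)
  then show ?thesis
    by (simp only: Bochner_Integration.integral_add[OF i])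
qed

lemma L1_distance_continuous:
  assumes v: "integrable M v"
  shows "continuous_on {0..T} (\<lambda>t. \<integral>x. \<bar>u t x - v x\<bar> \<partial>M)"
  unfolding continuous_on_def
proof
  fix t assume t: "t \<in> {0..T}"
  let ?n = "\<lambda>t. \<integral>x. \<bar>u t x - v x\<bar> \<partial>M"
  have "\<forall>\<^sub>F s in at t within {0..T}. norm (?n s - ?n t) \<le> (\<integral>x. \<bar>u s x - u t x\<bar> \<partial>M)"
    unfolding eventually_at_filter
  proof (intro always_eventually allI impI)
    fix s assume s: "s \<in> {0..T}"
    have "(\<integral>x. \<bar>u t x - u s x\<bar> \<partial>M) = (\<integral>x. \<bar>u s x - u t x\<bar> \<partial>M)"
      by (simp only: abs_minus_commute)
    with L1_distance_triangle[OF v s t] L1_distance_triangle[OF v t s]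
    show "norm (?n s - ?n t) \<le> (\<integral>x. \<bar>u s x - u t x\<bar> \<partial>M)"
      unfolding real_norm_def by linarith
  qed
  then have "((\<lambda>s. ?n s - ?n t) \<longlongrightarrow> 0) (at t within {0..T})"
    by (rule Lim_null_comparison[OF _ u_L1[OF t]])
  then show "(?n \<longlongrightarrow> ?n t) (at t within {0..T})"
    by (simp add: LIM_zero_iff)
qed

text \<open>The left increments of the distance \<open>n\<close> to the initial value are at most those of
\<open>(b - a) \<mu> t / 2 - \<epsilon> / (2 \<mu>) en t\<close>: compare the integral of \<open>\<bar>w\<bar>\<close> with \<open>\<mu> / 2\<close> times the length plus
\<open>1 / (2 \<mu>)\<close> times the integral of \<open>w\<^sup>2\<close>. So the difference of the two is nonincreasing in time.\<close>

theorem L1_displacement_le_dissipation: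
  assumes "0 \<le> T" "0 < \<mu>"
  shows "(\<integral>x. \<bar>u T x - u 0 x\<bar> \<partial>M) \<le> (b - a) * \<mu> * T / 2 + \<epsilon> / (2 * \<mu>) * (en 0 - en T)"
proof -
  define n where "n = (\<lambda>t. \<integral>x. \<bar>u t x - u 0 x\<bar> \<partial>M)"
  define m where "m = (\<lambda>t. n t - (b - a) * \<mu> / 2 * t + \<epsilon> / (2 * \<mu>) * en t)"
  have zero: "0 \<in> {0..T}"
    using \<open>0 \<le> T\<close> by simp
  have u0: "integrable M (u 0)"
    by (rule continuous_integrable_Ioo(1)[OF u_cont[OF zero]])
  have tri: "n t - n s \<le> (\<integral>x. \<bar>u t x - u s x\<bar> \<partial>M)" if "s \<in> {0..T}" "t \<in> {0..T}" for s t
    using L1_distance_triangle[OF u0 that] by (simp add: n_def)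
  have "continuous_on {0..T} n"
    unfolding n_def by (rule L1_distance_continuous[OF u0])
  then have "continuous_on {0..T} m"
    unfolding m_def by (intro continuous_intros en_continuous)
  moreover have "\<exists>s. 0 \<le> s \<and> s < t \<and> m t - m s \<le> \<eta> * (t - s)" if t: "0 < t" "t \<le> T" and "0 < \<eta>" for t \<eta>
  proof -
    define \<eta>' where "\<eta>' = \<eta> / (1 + 1 / (2 * \<mu>))"
    have "0 < \<eta>'"
      using \<open>0 < \<eta>\<close> \<open>0 < \<mu>\<close> by (auto simp: \<eta>'_def intro!: divide_pos_pos add_pos_pos)
    have "0 < 1 + 1 / (2 * \<mu>)"
      using \<open>0 < \<mu>\<close> by (intro add_pos_pos) auto
    then have "\<eta>' * (1 + 1 / (2 * \<mu>)) = \<eta>"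
      unfolding \<eta>'_def by simp
    then have \<eta>': "\<eta>' + \<eta>' / (2 * \<mu>) = \<eta>"
      by (simp add: distrib_left)
    have tT: "t \<in> {0<..T}" "t \<in> {0..T}"
      using t by auto
    from en_left_increment[OF tT(1) \<open>0 < \<eta>'\<close>] obtain d where d: "0 < d"
      "\<And>s. s \<in> {0..T} \<Longrightarrow> s \<noteq> t \<Longrightarrow> dist s t < d \<Longrightarrow> s < t \<longrightarrow>
        en t - en s \<le> (t - s) / \<epsilon> * (\<eta>' - (\<integral>x. (w t x)\<^sup>2 \<partial>M)) \<and>
        (\<integral>x. \<bar>u t x - u s x\<bar> \<partial>M) \<le> (t - s) * ((\<integral>x. \<bar>w t x\<bar> \<partial>M) + \<eta>')"
      unfolding eventually_at by blast
    define s where "s = max 0 (t - d / 2)"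
    have s: "0 \<le> s" "s < t" "s \<in> {0..T}" "dist s t < d"
      using d(1) t by (auto simp: s_def dist_real_def)
    let ?W = "\<integral>x. (w t x)\<^sup>2 \<partial>M"
    have inc: "en t - en s \<le> (t - s) / \<epsilon> * (\<eta>' - ?W)"
      "(\<integral>x. \<bar>u t x - u s x\<bar> \<partial>M) \<le> (t - s) * ((\<integral>x. \<bar>w t x\<bar> \<partial>M) + \<eta>')"
      using d(2)[OF s(3) _ s(4)] s(2) by auto
    have "n t - n s \<le> (t - s) * ((\<integral>x. \<bar>w t x\<bar> \<partial>M) + \<eta>')"
      using tri[OF s(3) tT(2)] inc(2) by linarith
    also have "\<dots> \<le> (t - s) * ((b - a) * \<mu> / 2 + ?W / (2 * \<mu>) + \<eta>')"
      using integral_abs_le_square[OF w_sq[OF tT(2)] \<open>0 < \<mu>\<close>] ab s(2) by (intro mult_left_mono) auto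
    finally have 1: "n t - n s \<le> (t - s) * ((b - a) * \<mu> / 2 + ?W / (2 * \<mu>) + \<eta>')" .
    have "\<epsilon> / (2 * \<mu>) * (en t - en s) \<le> \<epsilon> / (2 * \<mu>) * ((t - s) / \<epsilon> * (\<eta>' - ?W))"
      using inc(1) eps \<open>0 < \<mu>\<close> by (intro mult_left_mono) auto
    also have "\<dots> = (t - s) * (\<eta>' / (2 * \<mu>) - ?W / (2 * \<mu>))"
      using eps \<open>0 < \<mu>\<close> by (simp add: field_simps)
    finally have 2: "\<epsilon> / (2 * \<mu>) * (en t - en s) \<le> (t - s) * (\<eta>' / (2 * \<mu>) - ?W / (2 * \<mu>))" .
    have "m t - m s = (n t - n s) - (t - s) * ((b - a) * \<mu> / 2) + \<epsilon> / (2 * \<mu>) * (en t - en s)"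
    proof -
      have "(p - c * t + k * e) - (p' - c * s + k * e') = (p - p') - (t - s) * c + k * (e - e')"
        for p p' c k e e' :: real
        by (simp add: algebra_simps)
      then show ?thesis
        unfolding m_def .
    qed
    also have "\<dots> \<le> (t - s) * ((b - a) * \<mu> / 2 + ?W / (2 * \<mu>) + \<eta>') - (t - s) * ((b - a) * \<mu> / 2)
        + (t - s) * (\<eta>' / (2 * \<mu>) - ?W / (2 * \<mu>))"
      using 1 2 by linarith
    also have "\<dots> = (t - s) * (\<eta>' + \<eta>' / (2 * \<mu>))"
      by (simp only: ring_distribs)
    also have "\<dots> = \<eta> * (t - s)"
      unfolding \<eta>' by (rule mult.commute)
    finally show ?thesis
      using s by blast
  qed
  ultimately have "m T \<le> m 0"
    by (intro nonincreasing_if_left_increments[OF \<open>0 \<le> T\<close>])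
  then show ?thesis
    by (simp add: m_def n_def algebra_simps)
qed

text \<open>An increase of the energy would make the bound on the displacement negative for small \<open>\<mu>\<close>.\<close>

corollary energy_nonincreasing:
  assumes "0 \<le> T"
  shows "en T \<le> en 0"
proof (rule ccontr)
  assume "\<not> ?thesis"
  then have D: "0 < en T - en 0"
    by simp
  define c where "c = (b - a) * T + 1"
  have c: "0 < c"
    using ab \<open>0 \<le> T\<close> by (auto simp: c_def intro: add_nonneg_pos)
  define \<mu> where "\<mu> = sqrt (\<epsilon> * (en T - en 0) / c)"
  have \<mu>: "0 < \<mu>" "c * \<mu>\<^sup>2 = \<epsilon> * (en T - en 0)"
    using D c eps by (auto simp: \<mu>_def)
  have "0 \<le> (\<integral>x. \<bar>u T x - u 0 x\<bar> \<partial>M)"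
    by simp
  also have "\<dots> \<le> (b - a) * \<mu> * T / 2 + \<epsilon> / (2 * \<mu>) * (en 0 - en T)"
    by (rule L1_displacement_le_dissipation[OF assms \<mu>(1)])
  also have "\<dots> = ((b - a) * T * \<mu>\<^sup>2 - \<epsilon> * (en T - en 0)) / (2 * \<mu>)"
    using \<mu>(1) by (simp add: field_simps power2_eq_square)
  also have "\<dots> = - (\<mu>\<^sup>2 / (2 * \<mu>))"
    unfolding \<mu>(2)[symmetric] c_def by (simp add: ring_distribs)
  also have "\<dots> < 0"
    using \<mu>(1) by simp
  finally show False
    by simp
qed

end

section \<open>The flux nonlinearity and its Legendre transform\<close>

lemma C1_differentiable_on_UNIV_deriv:
  assumes "f C1_differentiable_on (UNIV :: real set)"
  shows "(f has_real_derivative deriv f x) (at x)" "continuous_on UNIV (deriv f)"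
proof -
  obtain D where D: "\<And>x. (f has_vector_derivative D x) (at x)" "continuous_on UNIV D"
    using assms unfolding C1_differentiable_on_def by auto
  then have "(f has_real_derivative D x) (at x)" for x
    by (simp add: has_real_derivative_iff_has_vector_derivative)
  moreover from this have "deriv f = D"
    using DERIV_imp_deriv by blast
  ultimately show "(f has_real_derivative deriv f x) (at x)" "continuous_on UNIV (deriv f)"
    using D(2) by auto
qed

locale admissible_nonlinearities =
  fixes Q :: "real \<Rightarrow> real" and \<kappa> :: real and F :: "real \<Rightarrow> real" and \<theta> :: real
  assumes Q: "admissible_Q Q \<kappa>" and F: "admissible_F F \<theta>" and theta: "\<theta> > 2"
begin

lemma kappa_pos: "0 < \<kappa>"
  using Q by (simp add: admissible_Q_def)

lemma Q_zero [simp]: "Q 0 = 0"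
  using Q by (simp add: admissible_Q_def)

lemma Q_odd: "Q (- s) = - Q s"
  using Q by (simp add: admissible_Q_def)

lemma Q_deriv: "(Q has_real_derivative deriv Q x) (at x)" and Q'_cont: "continuous_on UNIV (deriv Q)"
  using C1_differentiable_on_UNIV_deriv Q by (auto simp: admissible_Q_def)

lemma F_deriv: "(F has_real_derivative deriv F x) (at x)" and F'_cont: "continuous_on UNIV (deriv F)"
  using C1_differentiable_on_UNIV_deriv F by (auto simp: admissible_F_def)

lemma Q_cont: "continuous_on S Q"
  by (meson Q_deriv DERIV_isCont continuous_at_imp_continuous_on)

lemma F_cont: "continuous_on S F"
  by (meson F_deriv DERIV_isCont continuous_at_imp_continuous_on)

lemma F_zero [simp]: "F 1 = 0" "F (- 1) = 0"
  using F by (auto simp: admissible_F_def)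

lemma F_nonneg: "0 \<le> F z"
  using F F_zero unfolding admissible_F_def by (metis less_eq_real_def)

lemma Q_mono:
  assumes "- \<kappa> \<le> p" "p \<le> q" "q \<le> \<kappa>"
  shows "Q p \<le> Q q"
proof (cases "p = q")
  case False
  with assms have "p < q" by simp
  then have "Q p < Q q"
  proof (rule DERIV_pos_imp_increasing_open)
    fix x assume "p < x" "x < q"
    with assms have "deriv Q x > 0"
      using Q by (auto simp: admissible_Q_def)
    with Q_deriv show "\<exists>y. (Q has_real_derivative y) (at x) \<and> 0 < y"
      by blast
  qed (rule Q_cont)
  then show ?thesis by simp
qed simp

lemma Q_nonneg: "0 \<le> p \<Longrightarrow> p \<le> \<kappa> \<Longrightarrow> 0 \<le> Q p"
  using Q_mono[of 0 p] kappa_pos by simp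

lemma Q_tilde_increment:
  obtains A where "\<And>s. (A has_real_derivative Q s) (at s)" "\<And>s. Q_tilde Q s = A s - A 0"
proof -
  have "\<exists>A. \<forall>x. (A has_real_derivative Q x) (at x)"
    using einterval_antiderivative[of "-\<infinity>" "\<infinity>" Q] Q_cont[of UNIV]
    by (auto simp: continuous_on_eq_continuous_at has_real_derivative_iff_has_vector_derivative)
  then obtain A where A: "\<And>x. (A has_real_derivative Q x) (at x)"
    by blast
  have "Q_tilde Q s = A s - A 0" for s
    unfolding Q_tilde_def zero_ereal_def
  proof (rule interval_integral_FTC_finite[OF Q_cont])
    show "(A has_vector_derivative Q x) (at x within {min 0 s..max 0 s})" for x
      using has_field_derivative_at_within[OF A]
      by (simp add: has_real_derivative_iff_has_vector_derivative)
  qed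
  with A show ?thesis
    using that by blast
qed

lemma Q_tilde_deriv: "(Q_tilde Q has_real_derivative Q s) (at s)"
proof -
  obtain A where A: "\<And>s. (A has_real_derivative Q s) (at s)" "\<And>s. Q_tilde Q s = A s - A 0"
    by (rule Q_tilde_increment) blast
  have "Q_tilde Q = (\<lambda>s. A s - A 0)"
    using A(2) by blast
  then show ?thesis
    using DERIV_diff[OF A(1)[of s] DERIV_const] by simp
qed

lemma Q_tilde_zero [simp]: "Q_tilde Q 0 = 0"
  by (simp add: Q_tilde_def zero_ereal_def)

lemma Q_tilde_cont: "continuous_on S (Q_tilde Q)"
  by (meson Q_tilde_deriv DERIV_isCont continuous_at_imp_continuous_on)

lemma Q_tilde_even: "Q_tilde Q (- s) = Q_tilde Q s"
proof -
  have "((\<lambda>s. Q_tilde Q (- s) - Q_tilde Q s) has_real_derivative 0) (at s)" for s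
  proof -
    have "((\<lambda>s. Q_tilde Q (- s)) has_real_derivative Q (- s) * (- 1)) (at s)"
      by (rule DERIV_chain2[OF Q_tilde_deriv]) (auto intro!: derivative_eq_intros)
    from DERIV_diff[OF this Q_tilde_deriv[of s]] show ?thesis
      by (simp add: Q_odd)
  qed
  from DERIV_isconst_all[OF allI[OF this], of s 0] show ?thesis
    by simp
qed

lemma Q_tilde_convex:
  assumes p: "\<bar>p\<bar> \<le> \<kappa>" and q: "\<bar>q\<bar> \<le> \<kappa>"
  shows "Q_tilde Q q + Q q * (p - q) \<le> Q_tilde Q p"
proof -
  consider "p < q" | "p = q" | "q < p" by linarith
  then show ?thesis
  proof cases
    case 1
    then obtain z where z: "p < z" "z < q" "Q_tilde Q q - Q_tilde Q p = (q - p) * Q z"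
      using MVT2[of p q "Q_tilde Q" Q] Q_tilde_deriv by blast
    have "Q z \<le> Q q"
      by (rule Q_mono) (use z p q in auto)
    then have "(q - p) * Q z \<le> (q - p) * Q q"
      using 1 by (intro mult_left_mono) auto
    with z(3) show ?thesis
      by (simp add: algebra_simps)
  next
    case 3
    then obtain z where z: "q < z" "z < p" "Q_tilde Q p - Q_tilde Q q = (p - q) * Q z"
      using MVT2[of q p "Q_tilde Q" Q] Q_tilde_deriv by blast
    have "Q q \<le> Q z"
      by (rule Q_mono) (use z p q in auto)
    then have "(p - q) * Q q \<le> (p - q) * Q z"
      using 3 by (intro mult_left_mono) auto
    with z(3) show ?thesis
      by (simp add: algebra_simps)
  qed simp
qed

lemma Q_tilde_nonneg: "\<bar>p\<bar> \<le> \<kappa> \<Longrightarrow> 0 \<le> Q_tilde Q p"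
  using Q_tilde_convex[of p 0] kappa_pos by simp

text \<open>At the flux \<open>Q q\<close> this is the convex conjugate of \<open>Q_tilde\<close>. \<open>P_eps\<close> is a rescaling of it,
and \<open>legendre \<kappa>\<close> is the constant \<open>\<ell>\<close>.\<close>

definition legendre :: "real \<Rightarrow> real" where
  "legendre q = q * Q q - Q_tilde Q q"

lemma legendre_deriv: "(legendre has_real_derivative q * deriv Q q) (at q)"
proof -
  have "((\<lambda>q. q * Q q - Q_tilde Q q) has_real_derivative (1 * Q q + deriv Q q * q) - Q q) (at q)"
    by (intro DERIV_diff DERIV_mult DERIV_ident Q_deriv Q_tilde_deriv)
  then show ?thesis
    unfolding legendre_def by (simp add: mult.commute)
qed

lemma legendre_zero [simp]: "legendre 0 = 0"
  by (simp add: legendre_def)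

lemma legendre_cont: "continuous_on S legendre"
  by (meson legendre_deriv DERIV_isCont continuous_at_imp_continuous_on)

lemma legendre_strict_mono:
  assumes "0 \<le> p" "p < q" "q \<le> \<kappa>"
  shows "legendre p < legendre q"
  using assms(2)
proof (rule DERIV_pos_imp_increasing_open)
  fix x assume x: "p < x" "x < q"
  with assms have "deriv Q x > 0"
    using Q by (auto simp: admissible_Q_def)
  then have "0 < x * deriv Q x"
    using x assms by simp
  with legendre_deriv show "\<exists>y. (legendre has_real_derivative y) (at x) \<and> 0 < y"
    by blast
qed (rule legendre_cont)

lemma legendre_kappa_pos: "0 < legendre \<kappa>"
  using legendre_strict_mono[of 0 \<kappa>] kappa_pos by simp

text \<open>The derivative of \<open>Q\<^sup>2\<close> is \<open>2 Q Q'\<close>, that of \<open>legendre\<close> is \<open>q Q'\<close>, and \<open>Q q \<le> B q\<close> with \<open>B\<close> a bound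
for \<open>Q'\<close>.\<close>

lemma Q_squared_le_legendre:
  "\<exists>m>0. \<forall>q\<in>{0..\<kappa>}. (Q q)\<^sup>2 \<le> m * legendre q"
proof -
  obtain B where B: "0 \<le> B" "\<And>q. q \<in> {0..\<kappa>} \<Longrightarrow> \<bar>deriv Q q\<bar> \<le> B"
    using continuous_on_Icc_bounded[OF continuous_on_subset[OF Q'_cont subset_UNIV]] by blast
  have lin: "Q q \<le> B * q" if q: "q \<in> {0..\<kappa>}" for q
  proof (cases "q = 0")
    case False
    then obtain z where "0 < z" "z < q" "Q q - Q 0 = (q - 0) * deriv Q z"
      using MVT2[of 0 q Q "deriv Q"] Q_deriv q by auto
    then show ?thesis
      using B(2)[of z] q by (auto simp: mult.commute[of B] intro!: mult_left_mono)
  qed simp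
  have "(Q q)\<^sup>2 \<le> (2 * B + 1) * legendre q" if q: "q \<in> {0..\<kappa>}" for q
  proof -
    have "(2 * B) * legendre 0 - (Q 0)\<^sup>2 \<le> (2 * B) * legendre q - (Q q)\<^sup>2"
    proof (rule DERIV_nonneg_imp_increasing_open[of 0 q "\<lambda>q. (2 * B) * legendre q - (Q q)\<^sup>2"])
      show "0 \<le> q" using q by simp
      show "continuous_on {0..q} (\<lambda>q. (2 * B) * legendre q - (Q q)\<^sup>2)"
        by (intro continuous_intros legendre_cont Q_cont)
      fix x assume x: "0 < x" "x < q"
      have "((\<lambda>q. (2 * B) * legendre q - (Q q)\<^sup>2) has_real_derivative
          (2 * B) * (x * deriv Q x) - 2 * (deriv Q x * Q x)) (at x)"
        by (intro DERIV_diff DERIV_cmult legendre_deriv)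
          (use DERIV_power[OF Q_deriv[of x], of 2] in \<open>simp add: mult.assoc\<close>)
      moreover have "0 \<le> (2 * B) * (x * deriv Q x) - 2 * (deriv Q x * Q x)"
      proof -
        have "0 < deriv Q x"
          using Q x q by (auto simp: admissible_Q_def)
        then have "0 \<le> 2 * deriv Q x * (B * x - Q x)"
          using lin[of x] x q by simp
        then show ?thesis
          by (simp add: algebra_simps)
      qed
      ultimately show "\<exists>y. ((\<lambda>q. (2 * B) * legendre q - (Q q)\<^sup>2) has_real_derivative y) (at x) \<and> 0 \<le> y"
        by blast
    qed
    moreover have "0 \<le> legendre q"
      using legendre_strict_mono[of 0 q] q by (cases "q = 0") auto
    ultimately show ?thesis
      by (simp add: algebra_simps)
  qed
  then show ?thesis
    using B(1) by (intro exI[of _ "2 * B + 1"]) auto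
qed


lemma P_eps_eq: "0 < \<epsilon> \<Longrightarrow> P_eps Q \<epsilon> s = legendre (\<epsilon>\<^sup>2 * s) / \<epsilon>\<^sup>2"
proof -
  assume eps: "0 < \<epsilon>"
  have "P_eps Q \<epsilon> s = legendre (\<epsilon>\<^sup>2 * s) / \<epsilon>\<^sup>2 - legendre (\<epsilon>\<^sup>2 * 0) / \<epsilon>\<^sup>2"
    unfolding P_eps_def zero_ereal_def
  proof (rule interval_integral_FTC_finite)
    show "continuous_on {min 0 s..max 0 s} (\<lambda>z. \<epsilon>\<^sup>2 * z * deriv Q (\<epsilon>\<^sup>2 * z))"
      by (intro continuous_intros continuous_on_compose2[OF Q'_cont]) auto
    fix x
    have "((\<lambda>s. legendre (\<epsilon>\<^sup>2 * s)) has_real_derivative ((\<epsilon>\<^sup>2 * x) * deriv Q (\<epsilon>\<^sup>2 * x)) * \<epsilon>\<^sup>2) (at x)"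
      by (rule DERIV_chain2[OF legendre_deriv]) (auto intro!: derivative_eq_intros)
    from DERIV_cdivide[OF this, of "\<epsilon>\<^sup>2"] eps
    have "((\<lambda>s. legendre (\<epsilon>\<^sup>2 * s) / \<epsilon>\<^sup>2) has_real_derivative \<epsilon>\<^sup>2 * x * deriv Q (\<epsilon>\<^sup>2 * x)) (at x)"
      by simp
    from has_field_derivative_at_within[OF this]
    show "((\<lambda>s. legendre (\<epsilon>\<^sup>2 * s) / \<epsilon>\<^sup>2) has_vector_derivative \<epsilon>\<^sup>2 * x * deriv Q (\<epsilon>\<^sup>2 * x))
        (at x within {min 0 s..max 0 s})"
      by (simp only: has_real_derivative_iff_has_vector_derivative)
  qed
  then show ?thesis
    by simp
qed

text \<open>The rescaled slope \<open>\<epsilon>\<^sup>2 J_eps\<close> of the optimal profile at potential \<open>y\<close>, with values in \<open>[0, \<kappa>]\<close>.\<close>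

definition slope :: "real \<Rightarrow> real \<Rightarrow> real" where
  "slope \<epsilon> y = \<epsilon>\<^sup>2 * J_eps Q \<kappa> \<epsilon> y"

lemma slope_legendre:
  assumes eps: "0 < \<epsilon>" and y: "y \<in> {0..legendre \<kappa> / \<epsilon>\<^sup>2}"
  shows "slope \<epsilon> y \<in> {0..\<kappa>}" "legendre (slope \<epsilon> y) = \<epsilon>\<^sup>2 * y"
proof -
  have "\<exists>s\<ge>0. s \<le> \<kappa> / \<epsilon>\<^sup>2 \<and> P_eps Q \<epsilon> s = y"
  proof (rule IVT')
    show "P_eps Q \<epsilon> 0 \<le> y" "y \<le> P_eps Q \<epsilon> (\<kappa> / \<epsilon>\<^sup>2)" "0 \<le> \<kappa> / \<epsilon>\<^sup>2"
      using y eps kappa_pos by (auto simp: P_eps_eq)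
    have "P_eps Q \<epsilon> = (\<lambda>s. legendre (\<epsilon>\<^sup>2 * s) / \<epsilon>\<^sup>2)"
      using P_eps_eq[OF eps] by blast
    then show "continuous_on {0..\<kappa> / \<epsilon>\<^sup>2} (P_eps Q \<epsilon>)"
      using eps by (auto intro!: continuous_intros continuous_on_compose2[OF legendre_cont[of UNIV]])
  qed
  then have "y \<in> P_eps Q \<epsilon> ` {0..\<kappa> / \<epsilon>\<^sup>2}"
    by auto
  then have J: "J_eps Q \<kappa> \<epsilon> y \<in> {0..\<kappa> / \<epsilon>\<^sup>2}" "P_eps Q \<epsilon> (J_eps Q \<kappa> \<epsilon> y) = y"
    unfolding J_eps_def by (rule inv_into_into, rule f_inv_into_f)
  show "slope \<epsilon> y \<in> {0..\<kappa>}"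
    using J(1) eps by (auto simp: slope_def pos_le_divide_eq mult.commute)
  show "legendre (slope \<epsilon> y) = \<epsilon>\<^sup>2 * y"
    using J(2) eps by (simp add: slope_def P_eps_eq field_simps)
qed

lemma slope_cont:
  assumes eps: "0 < \<epsilon>"
  shows "continuous_on {0..legendre \<kappa> / \<epsilon>\<^sup>2} (slope \<epsilon>)"
proof -
  let ?g = "\<lambda>q. legendre q / \<epsilon>\<^sup>2"
  have inj: "p = q" if "legendre p = legendre q" "p \<in> {0..\<kappa>}" "q \<in> {0..\<kappa>}" for p q
    using legendre_strict_mono[of p q] legendre_strict_mono[of q p] that by (cases p q rule: linorder_cases) auto
  have mono: "legendre p \<le> legendre q" if "0 \<le> p" "p \<le> q" "q \<le> \<kappa>" for p q
    using legendre_strict_mono[of p q] that by (cases "p = q") auto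
  have range: "?g q \<in> {0..legendre \<kappa> / \<epsilon>\<^sup>2}" if "q \<in> {0..\<kappa>}" for q
    using mono[of 0 q] mono[of q \<kappa>] that eps by (auto intro!: divide_right_mono)
  have inv: "slope \<epsilon> (?g q) = q" if q: "q \<in> {0..\<kappa>}" for q
    by (rule inj) (use slope_legendre[OF eps range[OF q]] q eps in auto)
  have "continuous_on {0..\<kappa>} ?g"
    using eps by (intro continuous_intros legendre_cont) auto
  then have "continuous_on (?g ` {0..\<kappa>}) (slope \<epsilon>)"
    by (rule continuous_on_inv) (use inv in auto)
  moreover have "{0..legendre \<kappa> / \<epsilon>\<^sup>2} \<subseteq> ?g ` {0..\<kappa>}"
  proof
    fix y assume y: "y \<in> {0..legendre \<kappa> / \<epsilon>\<^sup>2}"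
    then have "y = ?g (slope \<epsilon> y)"
      using slope_legendre(2)[OF eps y] eps by simp
    with slope_legendre(1)[OF eps y] show "y \<in> ?g ` {0..\<kappa>}"
      by blast
  qed
  ultimately show ?thesis
    by (rule continuous_on_subset)
qed

section \<open>The cost of a transition\<close>


text \<open>Exactly the range of \<open>\<epsilon>\<close> in which \<open>J_eps\<close> is meaningful at all values of \<open>F\<close> on \<open>[-1, 1]\<close>.\<close>

definition small :: "real \<Rightarrow> bool" where
  "small \<epsilon> \<longleftrightarrow> 0 < \<epsilon> \<and> (\<forall>s\<in>{- 1..1}. F s \<le> legendre \<kappa> / \<epsilon>\<^sup>2)"

text \<open>The integrand of \<open>c_eps\<close>. The argument is projected to \<open>[-1, 1]\<close>, where \<open>slope\<close> is under control; since \<open>F\<close>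
vanishes at \<open>\<plusminus>1\<close>, the weight is zero outside, and it is continuous everywhere.\<close>

definition weight :: "real \<Rightarrow> real \<Rightarrow> real" where
  "weight \<epsilon> s = Q (slope \<epsilon> (F (max (- 1) (min 1 s)))) / \<epsilon>"

lemma eventually_small: "\<exists>e>0. \<forall>\<epsilon>\<in>{0<..<e}. small \<epsilon>"
proof -
  obtain B where B: "0 \<le> B" "\<And>s. s \<in> {- 1..1} \<Longrightarrow> \<bar>F s\<bar> \<le> B"
    using continuous_on_Icc_bounded[OF F_cont[of "{- 1..1}"]] by blast
  define e where "e = sqrt (legendre \<kappa> / (B + 1))"
  have "0 < e"
    using B(1) legendre_kappa_pos by (simp add: e_def)
  moreover have "small \<epsilon>" if "\<epsilon> \<in> {0<..<e}" for \<epsilon>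
  proof -
    have "\<epsilon>\<^sup>2 \<le> e\<^sup>2"
      using that by (intro power_mono) auto
    also have "e\<^sup>2 = legendre \<kappa> / (B + 1)"
      using B(1) legendre_kappa_pos by (simp add: e_def)
    finally have "B + 1 \<le> legendre \<kappa> / \<epsilon>\<^sup>2"
      using that B(1) by (simp add: field_simps)
    then show ?thesis
      unfolding small_def using B(2) that by force
  qed
  ultimately show ?thesis
    by blast
qed

lemma F_clamp: "F (max (- 1) (min 1 s)) \<le> F s"
proof -
  consider "s < - 1" | "- 1 \<le> s \<and> s \<le> 1" | "1 < s"
    by linarith
  then show ?thesis
    by cases (use F_nonneg[of s] in \<open>auto simp: max_def min_def\<close>)
qed

lemma F_clamp_range:
  assumes "small \<epsilon>"
  shows "F (max (- 1) (min 1 s)) \<in> {0..legendre \<kappa> / \<epsilon>\<^sup>2}"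
  using assms F_nonneg by (auto simp: small_def)

lemma weight_cont:
  assumes "small \<epsilon>"
  shows "continuous_on S (weight \<epsilon>)"
proof -
  have eps: "0 < \<epsilon>"
    using assms by (simp add: small_def)
  have F: "continuous_on S (\<lambda>s. F (max (- 1) (min 1 s)))"
    by (intro continuous_on_compose2[OF F_cont[of UNIV]] continuous_intros) auto
  have "continuous_on S (\<lambda>s. slope \<epsilon> (F (max (- 1) (min 1 s))))"
    by (rule continuous_on_compose2[OF slope_cont[OF eps] F]) (use F_clamp_range[OF assms] in blast)
  then have "continuous_on S (\<lambda>s. Q (slope \<epsilon> (F (max (- 1) (min 1 s)))))"
    by (rule continuous_on_compose2[OF Q_cont[of UNIV]]) auto
  then show ?thesis
    unfolding weight_def using eps by (intro continuous_on_divide) auto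
qed

lemma weight_nonneg:
  assumes "small \<epsilon>"
  shows "0 \<le> weight \<epsilon> s"
  using assms slope_legendre(1)[OF _ F_clamp_range[OF assms]]
  by (auto simp: weight_def small_def intro!: divide_nonneg_pos Q_nonneg)

lemma weight_le_sqrt_F: "\<exists>m>0. \<forall>\<epsilon> s. small \<epsilon> \<longrightarrow> weight \<epsilon> s \<le> sqrt (m * F s)"
proof -
  obtain m where m: "0 < m" "\<And>q. q \<in> {0..\<kappa>} \<Longrightarrow> (Q q)\<^sup>2 \<le> m * legendre q"
    using Q_squared_le_legendre by blast
  have "weight \<epsilon> s \<le> sqrt (m * F s)" if small: "small \<epsilon>" for \<epsilon> s
  proof (rule real_le_rsqrt)
    have eps: "0 < \<epsilon>"
      using small by (simp add: small_def)
    note q = slope_legendre[OF eps F_clamp_range[OF small, of s]]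
    have "(Q (slope \<epsilon> (F (max (- 1) (min 1 s)))))\<^sup>2 \<le> m * (\<epsilon>\<^sup>2 * F (max (- 1) (min 1 s)))"
      using m(2)[OF q(1)] q(2) by simp
    also have "\<dots> \<le> m * (\<epsilon>\<^sup>2 * F s)"
      using m(1) F_clamp[of s] by (intro mult_left_mono) auto
    finally show "(weight \<epsilon> s)\<^sup>2 \<le> m * F s"
      using eps by (simp add: weight_def power_divide pos_divide_le_eq mult_ac)
  qed
  with m(1) show ?thesis
    by blast
qed

text \<open>The tangent to \<open>Q_tilde\<close> at the optimal slope \<open>q0\<close>, evaluated at \<open>\<epsilon>\<^sup>2 \<bar>p\<bar>\<close>: its offset is
\<open>- legendre q0\<close>, which is \<open>- \<epsilon>\<^sup>2\<close> times the potential by the choice of \<open>q0\<close>.\<close>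

lemma weight_mult_le_density:
  assumes small: "small \<epsilon>" and p: "\<bar>\<epsilon>\<^sup>2 * p\<bar> \<le> \<kappa>"
  shows "weight \<epsilon> s * \<bar>p\<bar> \<le> Q_tilde Q (\<epsilon>\<^sup>2 * p) / \<epsilon> ^ 3 + F s / \<epsilon>"
proof -
  have eps: "0 < \<epsilon>"
    using small by (simp add: small_def)
  define q0 where "q0 = slope \<epsilon> (F (max (- 1) (min 1 s)))"
  define q where "q = \<epsilon>\<^sup>2 * \<bar>p\<bar>"
  note q0 = slope_legendre[OF eps F_clamp_range[OF small, of s], folded q0_def]
  have "Q_tilde Q q = Q_tilde Q (\<epsilon>\<^sup>2 * p)"
    using Q_tilde_even[of "\<epsilon>\<^sup>2 * p"] by (cases "0 \<le> p") (auto simp: q_def)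
  moreover have "Q_tilde Q q0 + Q q0 * (q - q0) \<le> Q_tilde Q q"
    by (rule Q_tilde_convex) (use p q0(1) in \<open>auto simp: q_def abs_mult\<close>)
  moreover have "q0 * Q q0 - Q_tilde Q q0 = \<epsilon>\<^sup>2 * F (max (- 1) (min 1 s))"
    using q0(2) by (simp add: legendre_def)
  moreover have "\<epsilon>\<^sup>2 * F (max (- 1) (min 1 s)) \<le> \<epsilon>\<^sup>2 * F s"
    using F_clamp by (intro mult_left_mono) auto
  ultimately have "Q q0 * q \<le> Q_tilde Q (\<epsilon>\<^sup>2 * p) + \<epsilon>\<^sup>2 * F s"
    by (simp add: algebra_simps)
  then have "Q q0 * q / \<epsilon> ^ 3 \<le> (Q_tilde Q (\<epsilon>\<^sup>2 * p) + \<epsilon>\<^sup>2 * F s) / \<epsilon> ^ 3"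
    using eps by (intro divide_right_mono) auto
  moreover have "Q q0 * q / \<epsilon> ^ 3 = weight \<epsilon> s * \<bar>p\<bar>"
    using eps by (simp add: weight_def q_def q0_def power2_eq_square power3_eq_cube)
  moreover have "(Q_tilde Q (\<epsilon>\<^sup>2 * p) + \<epsilon>\<^sup>2 * F s) / \<epsilon> ^ 3 = Q_tilde Q (\<epsilon>\<^sup>2 * p) / \<epsilon> ^ 3 + F s / \<epsilon>"
    using eps by (simp add: add_divide_distrib power2_eq_square power3_eq_cube)
  ultimately show ?thesis
    by simp
qed

lemma weight_antiderivative:
  assumes "small \<epsilon>"
  shows "\<exists>W. \<forall>s. (W has_real_derivative weight \<epsilon> s) (at s)"
  using einterval_antiderivative[of "-\<infinity>" "\<infinity>" "weight \<epsilon>"] weight_cont[OF assms, of UNIV]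
  by (auto simp: continuous_on_eq_continuous_at has_real_derivative_iff_has_vector_derivative)

lemma c_eps_eq:
  assumes small: "small \<epsilon>" and W: "\<And>s. (W has_real_derivative weight \<epsilon> s) (at s)"
  shows "c_eps Q \<kappa> F \<epsilon> = W 1 - W (- 1)"
proof -
  have eps: "0 < \<epsilon>"
    using small by (simp add: small_def)
  have "c_eps Q \<kappa> F \<epsilon> = (LBINT s=ereal (- 1)..ereal 1. Q (\<epsilon>\<^sup>2 * J_eps Q \<kappa> \<epsilon> (F s)) / \<epsilon>)"
    by (simp add: c_eps_def one_ereal_def)
  also have "\<dots> = (LBINT s=ereal (- 1)..ereal 1. weight \<epsilon> s)"
    by (rule interval_integral_cong) (auto simp: weight_def slope_def einterval_iff max_def min_def)
  also have "\<dots> = W 1 - W (- 1)"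
  proof (rule interval_integral_FTC_finite[OF weight_cont[OF small]])
    show "(W has_vector_derivative weight \<epsilon> x) (at x within {min (- 1) 1..max (- 1) 1})" for x
      using has_field_derivative_at_within[OF W]
      by (simp add: has_real_derivative_iff_has_vector_derivative)
  qed
  finally show ?thesis .
qed

lemma c_eps_bounded: "\<exists>B\<ge>0. \<forall>\<epsilon>. small \<epsilon> \<longrightarrow> c_eps Q \<kappa> F \<epsilon> \<le> B"
proof -
  obtain m where m: "0 < m" "\<And>\<epsilon> s. small \<epsilon> \<Longrightarrow> weight \<epsilon> s \<le> sqrt (m * F s)"
    using weight_le_sqrt_F by blast
  obtain B where B: "0 \<le> B" "\<And>s. s \<in> {- 1..1} \<Longrightarrow> \<bar>F s\<bar> \<le> B"
    using continuous_on_Icc_bounded[OF F_cont[of "{- 1..1}"]] by blast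
  have "c_eps Q \<kappa> F \<epsilon> \<le> 2 * sqrt (m * B)" if small: "small \<epsilon>" for \<epsilon>
  proof -
    obtain W where W: "\<And>s. (W has_real_derivative weight \<epsilon> s) (at s)"
      using weight_antiderivative[OF small] by blast
    then obtain z where z: "- 1 < z" "z < 1" "W 1 - W (- 1) = (1 - (- 1)) * weight \<epsilon> z"
      using MVT2[of "- 1" 1 W "weight \<epsilon>"] by auto
    have "weight \<epsilon> z \<le> sqrt (m * F z)"
      by (rule m(2)[OF small])
    also have "\<dots> \<le> sqrt (m * B)"
      using B(2)[of z] z m(1) by (intro real_sqrt_le_mono mult_left_mono) auto
    finally show ?thesis
      using z(3) c_eps_eq[OF small W] by simp
  qed
  with B(1) m(1) show ?thesis
    by (intro exI[of _ "2 * sqrt (m * B)"]) auto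
qed

text \<open>Integrate the bounds on \<open>F'\<close> from the well. For the lower bound the mean value theorem is applied on the outer half
of the segment, where the lower bound for \<open>\<bar>F'\<bar>\<close> is at least its value at the midpoint; this avoids
differentiating real powers.\<close>

lemma F_near_well:
  "\<exists>\<eta>>0. \<exists>c>0. \<exists>C>0. \<forall>p\<in>{1, - 1}. \<forall>z. \<bar>z - p\<bar> < \<eta> \<longrightarrow>
    c * \<bar>z - p\<bar> powr \<theta> \<le> F z \<and> F z \<le> C * \<bar>z - p\<bar> powr \<theta>"
proof -
  obtain c1 c2 \<eta> where c: "0 < c1" "c1 \<le> c2" "0 < \<eta>"
    and F': "\<And>\<sigma> y. \<sigma> \<in> {1, - 1} \<Longrightarrow> \<bar>y + \<sigma>\<bar> < \<eta> \<Longrightarrow> y \<noteq> - \<sigma> \<Longrightarrow>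
      c1 * \<bar>1 + \<sigma> * y\<bar> powr (\<theta> - 2) \<le> deriv F y / (y + \<sigma>) \<and>
      deriv F y / (y + \<sigma>) \<le> c2 * \<bar>1 + \<sigma> * y\<bar> powr (\<theta> - 2)"
    using F unfolding admissible_F_def by blast
  have bounds: "c1 * (d / 2) powr \<theta> \<le> F (p + s * d) \<and> F (p + s * d) \<le> c2 * d powr \<theta>"
    if p: "p \<in> {1, - 1}" and s: "s \<in> {1, - 1}" and d: "0 < d" "d < \<eta>" for p s d :: real
  proof -
    have der: "((\<lambda>d. F (p + s * d)) has_real_derivative deriv F (p + s * y) * s) (at y)" for y
      by (rule DERIV_chain2[OF F_deriv]) (auto intro!: derivative_eq_intros)
    have F'b: "c1 * y powr (\<theta> - 1) \<le> deriv F (p + s * y) * s \<and> deriv F (p + s * y) * s \<le> c2 * y powr (\<theta> - 1)"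
      if y: "0 < y" "y < \<eta>" for y
    proof -
      have e: "\<bar>p + s * y + (- p)\<bar> = y" "\<bar>1 + (- p) * (p + s * y)\<bar> = y" "p + s * y \<noteq> - (- p)"
        using p s y by (auto simp: abs_mult algebra_simps)
      have "deriv F (p + s * y) / (p + s * y + (- p)) = deriv F (p + s * y) * s / y"
        using s by auto
      then have "c1 * y powr (\<theta> - 2) \<le> deriv F (p + s * y) * s / y \<and>
          deriv F (p + s * y) * s / y \<le> c2 * y powr (\<theta> - 2)"
        using F'[of "- p" "p + s * y"] e p y by auto
      moreover have "y powr (\<theta> - 1) = y powr (\<theta> - 2) * y"
        using powr_mult_base[of y "\<theta> - 2"] y by (simp add: mult.commute)
      ultimately show ?thesis
        using y by (simp add: pos_le_divide_eq pos_divide_le_eq mult.assoc)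
    qed
    obtain z where z: "0 < z" "z < d" "F (p + s * d) - F (p + s * 0) = (d - 0) * (deriv F (p + s * z) * s)"
      using MVT2[of 0 d "\<lambda>d. F (p + s * d)" "\<lambda>y. deriv F (p + s * y) * s"] der d by auto
    obtain y where y: "d / 2 < y" "y < d"
      "F (p + s * d) - F (p + s * (d / 2)) = (d - d / 2) * (deriv F (p + s * y) * s)"
      using MVT2[of "d / 2" d "\<lambda>d. F (p + s * d)" "\<lambda>y. deriv F (p + s * y) * s"] der d by auto
    have pw: "e powr \<theta> = e * e powr (\<theta> - 1)" if "0 < e" for e :: real
      using that by (simp add: powr_mult_base)
    have "deriv F (p + s * z) * s \<le> c2 * d powr (\<theta> - 1)"
    proof -
      have "deriv F (p + s * z) * s \<le> c2 * z powr (\<theta> - 1)"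
        using F'b[of z] z d by auto
      also have "\<dots> \<le> c2 * d powr (\<theta> - 1)"
        using z c theta by (intro mult_left_mono powr_mono2) auto
      finally show ?thesis .
    qed
    then have "d * (deriv F (p + s * z) * s) \<le> d * (c2 * d powr (\<theta> - 1))"
      using d by (intro mult_left_mono) auto
    then have up: "F (p + s * d) \<le> c2 * d powr \<theta>"
      using z(3) p d by (auto simp: pw mult.left_commute)
    have "c1 * (d / 2) powr (\<theta> - 1) \<le> deriv F (p + s * y) * s"
    proof -
      have "c1 * (d / 2) powr (\<theta> - 1) \<le> c1 * y powr (\<theta> - 1)"
        using y d c theta by (intro mult_left_mono powr_mono2) auto
      also have "\<dots> \<le> deriv F (p + s * y) * s"
        using F'b[of y] y d by auto
      finally show ?thesis .
    qed
    then have "d / 2 * (c1 * (d / 2) powr (\<theta> - 1)) \<le> d / 2 * (deriv F (p + s * y) * s)"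
      using d by (intro mult_left_mono) auto
    moreover have "c1 * (d / 2) powr \<theta> = d / 2 * (c1 * (d / 2) powr (\<theta> - 1))"
      using pw[of "d / 2"] d by simp
    moreover have "F (p + s * d) - F (p + s * (d / 2)) = d / 2 * (deriv F (p + s * y) * s)"
      using y(3) by simp
    ultimately have "c1 * (d / 2) powr \<theta> \<le> F (p + s * d)"
      using F_nonneg[of "p + s * (d / 2)"] by linarith
    with up show ?thesis
      by blast
  qed
  have "c1 * (1 / 2) powr \<theta> * \<bar>z - p\<bar> powr \<theta> \<le> F z \<and> F z \<le> c2 * \<bar>z - p\<bar> powr \<theta>"
    if p: "p \<in> {1, - 1}" and z: "\<bar>z - p\<bar> < \<eta>" for p z :: real
  proof (cases "z = p")
    case True
    with p theta show ?thesis
      by auto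
  next
    case False
    have "z = p + sgn (z - p) * \<bar>z - p\<bar>"
      by (simp add: sgn_mult_abs)
    moreover have "sgn (z - p) \<in> {1, - 1}"
      using False by (auto simp: sgn_if)
    ultimately have "c1 * (\<bar>z - p\<bar> / 2) powr \<theta> \<le> F z \<and> F z \<le> c2 * \<bar>z - p\<bar> powr \<theta>"
      using bounds[OF p, of "sgn (z - p)" "\<bar>z - p\<bar>"] False z by auto
    moreover have "(\<bar>z - p\<bar> / 2) powr \<theta> = (1 / 2) powr \<theta> * \<bar>z - p\<bar> powr \<theta>"
      by (simp add: powr_mult[symmetric])
    ultimately show ?thesis
      by (simp add: mult.assoc)
  qed
  then show ?thesis
    using c by (intro exI[of _ \<eta>] conjI exI[of _ "c1 * (1 / 2) powr \<theta>"] exI[of _ c2]) auto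
qed


text \<open>With \<open>d\<close> the distance of \<open>z\<close> to the well, the loss is at most \<open>d\<close> times the weight, hence of order
\<open>d\<^sup>1\<^sup>+\<^sup>\<theta>\<^sup>/\<^sup>2\<close>, while \<open>d\<^sup>\<theta>\<close> is of order at most \<open>A\<close>. The quotient \<open>(1 + \<theta>/2) / \<theta>\<close> is the exponent
\<open>1/2 + 1/\<theta>\<close>.\<close>

lemma potential_loss_near_well:
  "\<exists>\<eta>>0. \<exists>L>0. \<eta> < 1 \<and> (\<forall>\<epsilon> W p z A. small \<epsilon> \<longrightarrow> (\<forall>s. (W has_real_derivative weight \<epsilon> s) (at s)) \<longrightarrow>
    p \<in> {1, - 1} \<longrightarrow> \<bar>z - p\<bar> \<le> \<eta> \<longrightarrow> F z \<le> A \<longrightarrow> \<bar>W z - W p\<bar> \<le> L * A powr (1 / 2 + 1 / \<theta>))"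
proof -
  obtain m where m: "0 < m" "\<And>\<epsilon> s. small \<epsilon> \<Longrightarrow> weight \<epsilon> s \<le> sqrt (m * F s)"
    using weight_le_sqrt_F by blast
  obtain \<eta>0 c C where c: "0 < \<eta>0" "0 < c" "0 < C" and
    Fb: "\<And>p z. p \<in> {1, - 1} \<Longrightarrow> \<bar>z - p\<bar> < \<eta>0 \<Longrightarrow>
      c * \<bar>z - p\<bar> powr \<theta> \<le> F z \<and> F z \<le> C * \<bar>z - p\<bar> powr \<theta>"
    using F_near_well by blast
  define \<eta> where "\<eta> = min (\<eta>0 / 2) (1 / 2)"
  define \<alpha> where "\<alpha> = 1 / 2 + 1 / \<theta>"
  define L where "L = sqrt (m * C) * (1 / c) powr \<alpha>"
  have \<eta>: "0 < \<eta>" "\<eta> < \<eta>0" "\<eta> < 1"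
    using c(1) by (auto simp: \<eta>_def min_def)
  have "0 < L"
    using c m by (simp add: L_def)
  have "\<bar>W z - W p\<bar> \<le> L * A powr \<alpha>"
    if small: "small \<epsilon>" and W: "\<And>s. (W has_real_derivative weight \<epsilon> s) (at s)"
      and p: "p \<in> {1, - 1}" and z: "\<bar>z - p\<bar> \<le> \<eta>" and A: "F z \<le> A" for \<epsilon> W p z A
  proof (cases "z = p")
    case True
    with \<open>0 < L\<close> show ?thesis
      by simp
  next
    case False
    define d where "d = \<bar>z - p\<bar>"
    have d: "0 < d" "d < \<eta>0"
      using False z \<eta> by (auto simp: d_def)
    have "\<exists>y. \<bar>y - p\<bar> \<le> d \<and> \<bar>W z - W p\<bar> = d * weight \<epsilon> y"
    proof (cases "z < p")
      case True
      then obtain y where "z < y" "y < p" "W p - W z = (p - z) * weight \<epsilon> y"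
        using MVT2[of z p W "weight \<epsilon>"] W by blast
      with True weight_nonneg[OF small, of y] show ?thesis
        by (intro exI[of _ y]) (auto simp: d_def abs_minus_commute[of "W z"] abs_mult)
    next
      case F: False
      with False have "p < z" by simp
      then obtain y where "p < y" "y < z" "W z - W p = (z - p) * weight \<epsilon> y"
        using MVT2[of p z W "weight \<epsilon>"] W by blast
      with \<open>p < z\<close> weight_nonneg[OF small, of y] show ?thesis
        by (intro exI[of _ y]) (auto simp: d_def abs_mult)
    qed
    then obtain y where y: "\<bar>y - p\<bar> \<le> d" "\<bar>W z - W p\<bar> = d * weight \<epsilon> y"
      by blast
    have "F y \<le> C * \<bar>y - p\<bar> powr \<theta>"
      using Fb[OF p, of y] y(1) d by auto
    also have "\<dots> \<le> C * d powr \<theta>"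
      using y(1) c theta by (intro mult_left_mono powr_mono2) auto
    finally have "weight \<epsilon> y \<le> sqrt (m * (C * d powr \<theta>))"
      using m(2)[OF small, of y] m(1) by (meson mult_left_mono order_trans real_sqrt_le_mono less_imp_le)
    also have "\<dots> = sqrt (m * C) * d powr (\<theta> / 2)"
      using d by (simp add: real_sqrt_mult powr_half_sqrt[symmetric] powr_powr)
    finally have "\<bar>W z - W p\<bar> \<le> d * (sqrt (m * C) * d powr (\<theta> / 2))"
      using y(2) d by simp
    also have "\<dots> = sqrt (m * C) * (d powr \<theta>) powr \<alpha>"
    proof -
      have "\<theta> * \<alpha> = 1 + \<theta> / 2"
        using theta by (simp add: \<alpha>_def field_simps)
      then have "(d powr \<theta>) powr \<alpha> = d * d powr (\<theta> / 2)"
        using powr_mult_base[of d "\<theta> / 2"] d by (simp add: powr_powr)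
      then show ?thesis
        by simp
    qed
    also have "\<dots> \<le> sqrt (m * C) * (A / c) powr \<alpha>"
    proof (intro mult_left_mono powr_mono2)
      have "c * d powr \<theta> \<le> A"
        using Fb[OF p, of z] d A by (auto simp: d_def)
      then show "d powr \<theta> \<le> A / c"
        using c by (simp add: pos_le_divide_eq mult.commute)
    qed (use m c theta in \<open>auto simp: \<alpha>_def\<close>)
    also have "\<dots> = L * A powr \<alpha>"
      using F_nonneg[of z] A c by (simp add: L_def powr_mult[symmetric])
    finally show ?thesis .
  qed
  then show ?thesis
    unfolding \<alpha>_def using \<eta> \<open>0 < L\<close> by blast
qed

definition energy_density :: "real \<Rightarrow> (real \<Rightarrow> real) \<Rightarrow> (real \<Rightarrow> real) \<Rightarrow> real \<Rightarrow> real" where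
  "energy_density \<epsilon> f f' x = Q_tilde Q (\<epsilon>\<^sup>2 * f' x) / \<epsilon> ^ 3 + F (f x) / \<epsilon>"

definition profile :: "real \<Rightarrow> real \<Rightarrow> real \<Rightarrow> (real \<Rightarrow> real) \<Rightarrow> (real \<Rightarrow> real) \<Rightarrow> bool" where
  "profile a b \<epsilon> f f' \<longleftrightarrow> small \<epsilon> \<and> continuous_on {a..b} f' \<and>
    (\<forall>x\<in>{a..b}. (f has_real_derivative f' x) (at x within {a..b}) \<and> \<bar>\<epsilon>\<^sup>2 * f' x\<bar> \<le> \<kappa>)"

lemma profileD:
  assumes "profile a b \<epsilon> f f'"
  shows "small \<epsilon>" "0 < \<epsilon>" "continuous_on {a..b} f'" "continuous_on {a..b} f"
    "\<And>x. x \<in> {a..b} \<Longrightarrow> (f has_real_derivative f' x) (at x within {a..b})"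
    "\<And>x. x \<in> {a..b} \<Longrightarrow> \<bar>\<epsilon>\<^sup>2 * f' x\<bar> \<le> \<kappa>"
  using assms by (auto simp: profile_def small_def intro!: DERIV_continuous_on)

lemma energy_density_cont:
  assumes "profile a b \<epsilon> f f'"
  shows "continuous_on {a..b} (energy_density \<epsilon> f f')"
proof -
  note p = profileD[OF assms]
  have "continuous_on {a..b} (\<lambda>x. Q_tilde Q (\<epsilon>\<^sup>2 * f' x))"
    by (rule continuous_on_compose2[OF Q_tilde_cont[of UNIV]]) (auto intro!: continuous_intros p(3))
  moreover have "continuous_on {a..b} (\<lambda>x. F (f x))"
    by (rule continuous_on_compose2[OF F_cont[of UNIV]]) (auto intro!: p(4))
  ultimately show ?thesis
    unfolding energy_density_def using p(2) by (intro continuous_on_add continuous_on_divide) auto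
qed

lemma energy_density_ge:
  assumes "profile a b \<epsilon> f f'" "x \<in> {a..b}"
  shows "0 \<le> F (f x) / \<epsilon>" "F (f x) / \<epsilon> \<le> energy_density \<epsilon> f f' x"
proof -
  note p = profileD[OF assms(1)]
  have "0 \<le> Q_tilde Q (\<epsilon>\<^sup>2 * f' x) / \<epsilon> ^ 3"
    using p(2) Q_tilde_nonneg[OF p(6)[OF assms(2)]] by (intro divide_nonneg_pos) auto
  then show "F (f x) / \<epsilon> \<le> energy_density \<epsilon> f f' x"
    unfolding energy_density_def by linarith
  show "0 \<le> F (f x) / \<epsilon>"
    using p(2) F_nonneg by simp
qed

lemma transition_energy:
  assumes prof: "profile a b \<epsilon> f f'" and W: "\<And>s. (W has_real_derivative weight \<epsilon> s) (at s)"
    and xy: "a \<le> x" "x \<le> y" "y \<le> b"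
  shows "\<bar>W (f y) - W (f x)\<bar> \<le> integral {x..y} (energy_density \<epsilon> f f')"
proof -
  note p = profileD[OF prof]
  have sub: "{x..y} \<subseteq> {a..b}"
    using xy by auto
  have "((\<lambda>z. W (f z)) has_real_derivative weight \<epsilon> (f z) * f' z) (at z within {a..b})" if "z \<in> {a..b}" for z
    using DERIV_image_chain[OF has_field_derivative_at_within[OF W] p(5)[OF that]] by (simp add: o_def)
  from FTC_within[OF this xy]
  have int: "((\<lambda>z. weight \<epsilon> (f z) * f' z) has_integral W (f y) - W (f x)) {x..y}"
    by simp
  have "norm (integral {x..y} (\<lambda>z. weight \<epsilon> (f z) * f' z)) \<le> integral {x..y} (energy_density \<epsilon> f f')"
  proof (rule integral_norm_bound_integral)
    show "energy_density \<epsilon> f f' integrable_on {x..y}"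
      by (rule integrable_continuous_real[OF continuous_on_subset[OF energy_density_cont[OF prof] sub]])
    fix z assume "z \<in> {x..y}"
    with sub have z: "z \<in> {a..b}"
      by blast
    show "norm (weight \<epsilon> (f z) * f' z) \<le> energy_density \<epsilon> f f' z"
      using weight_mult_le_density[OF p(1) p(6)[OF z], of "f z"] weight_nonneg[OF p(1), of "f z"]
      by (simp add: energy_density_def abs_mult)
  qed (use int in blast)
  with int show ?thesis
    by (simp add: integral_unique)
qed

text \<open>Otherwise every point of the interval is far from the well or has large potential, and one of the two
integrals would exceed its bound.\<close>

lemma exists_point_near_well:
  assumes prof: "profile a b \<epsilon> f f'" and cd: "a \<le> c" "c < d" "d \<le> b"
    and L1: "(\<integral>x. \<bar>f x - p\<bar> \<partial>lebesgue_on {c<..<d}) \<le> \<eta> * ((d - c) / 4)" and "0 < \<eta>"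
    and en: "integral {c..d} (energy_density \<epsilon> f f') \<le> A / \<epsilon> * ((d - c) / 4)" and "0 < A"
  shows "\<exists>y\<in>{c..d}. \<bar>f y - p\<bar> \<le> \<eta> \<and> F (f y) \<le> A"
proof (rule ccontr)
  assume none: "\<not> ?thesis"
  note p = profileD[OF prof]
  have sub: "{c..d} \<subseteq> {a..b}"
    using cd by auto
  have cont: "continuous_on {c..d} (\<lambda>x. \<bar>f x - p\<bar>)" "continuous_on {c..d} (energy_density \<epsilon> f f')"
    using continuous_on_subset[OF p(4) sub] continuous_on_subset[OF energy_density_cont[OF prof] sub]
    by (auto intro!: continuous_intros)
  note int = cont[THEN integrable_continuous_real]
  have "d - c = integral {c..d} (\<lambda>x. 1 :: real)"
    using cd by simp
  also have "\<dots> \<le> integral {c..d} (\<lambda>x. (1 / \<eta>) * \<bar>f x - p\<bar> + \<epsilon> / A * energy_density \<epsilon> f f' x)"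
  proof (rule integral_le)
    show "(\<lambda>x. (1 / \<eta>) * \<bar>f x - p\<bar> + \<epsilon> / A * energy_density \<epsilon> f f' x) integrable_on {c..d}"
      by (intro integrable_continuous_real continuous_intros cont)
    fix x assume x: "x \<in> {c..d}"
    with sub have xab: "x \<in> {a..b}"
      by blast
    have "F (f x) \<le> \<epsilon> * energy_density \<epsilon> f f' x"
      using energy_density_ge(2)[OF prof xab] p(2) by (simp add: pos_divide_le_eq mult.commute)
    moreover have "0 \<le> F (f x)"
      by (rule F_nonneg)
    moreover have "\<eta> < \<bar>f x - p\<bar> \<or> A < F (f x)"
    proof -
      have "\<not> (\<bar>f x - p\<bar> \<le> \<eta> \<and> F (f x) \<le> A)"
        using none x by blast
      then show ?thesis
        by auto
    qed
    ultimately show "1 \<le> (1 / \<eta>) * \<bar>f x - p\<bar> + \<epsilon> / A * energy_density \<epsilon> f f' x"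
    proof (elim disjE)
      assume *: "0 \<le> F (f x)" "F (f x) \<le> \<epsilon> * energy_density \<epsilon> f f' x" "\<eta> < \<bar>f x - p\<bar>"
      then have "1 \<le> (1 / \<eta>) * \<bar>f x - p\<bar>" "0 \<le> \<epsilon> / A * energy_density \<epsilon> f f' x"
        using \<open>0 < \<eta>\<close> \<open>0 < A\<close> by (auto simp: field_simps)
      then show ?thesis
        by linarith
    next
      assume *: "0 \<le> F (f x)" "F (f x) \<le> \<epsilon> * energy_density \<epsilon> f f' x" "A < F (f x)"
      then have "0 \<le> (1 / \<eta>) * \<bar>f x - p\<bar>" "1 \<le> \<epsilon> / A * energy_density \<epsilon> f f' x"
        using \<open>0 < \<eta>\<close> \<open>0 < A\<close> by (auto simp: field_simps)
      then show ?thesis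
        by linarith
    qed
  qed auto
  also have "\<dots> = (1 / \<eta>) * integral {c..d} (\<lambda>x. \<bar>f x - p\<bar>) + \<epsilon> / A * integral {c..d} (energy_density \<epsilon> f f')"
    using Henstock_Kurzweil_Integration.integral_add[OF integrable_on_mult_right[OF int(1), of "1 / \<eta>"]
        integrable_on_mult_right[OF int(2), of "\<epsilon> / A"]]
    by (simp only: Henstock_Kurzweil_Integration.integral_mult_right)
  also have "\<dots> \<le> (1 / \<eta>) * (\<eta> * ((d - c) / 4)) + \<epsilon> / A * (A / \<epsilon> * ((d - c) / 4))"
    using L1 en continuous_integrable_Ioo(2)[OF cont(1)] \<open>0 < \<eta>\<close> \<open>0 < A\<close> p(2)
    by (intro add_mono mult_left_mono) auto
  also have "\<dots> = (d - c) / 2"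
    using \<open>0 < \<eta>\<close> \<open>0 < A\<close> p(2) by simp
  finally show False
    using cd by simp
qed

end

section \<open>Step functions and the exponents\<close>

lemma step_functionD:
  assumes "step_function a b N h r v"
  shows "1 \<le> N" "0 < r" "\<And>k n. 1 \<le> k \<Longrightarrow> k < n \<Longrightarrow> n \<le> N \<Longrightarrow> h k < h n"
    "\<And>x. x \<in> {a..b} \<Longrightarrow> v x \<in> {- 1, 1}"
    "\<And>x y. a \<le> x \<Longrightarrow> x \<le> y \<Longrightarrow> y \<le> b \<Longrightarrow> {x..y} \<inter> h ` {1..N} = {} \<Longrightarrow> v x = v y"
    "\<And>k n. k \<in> {1..N} \<Longrightarrow> n \<in> {1..N} \<Longrightarrow> h k \<in> {h n - r<..<h n + r} \<Longrightarrow> k = n"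
    "\<And>n. n \<in> {1..N} \<Longrightarrow> a \<le> h n - r \<and> h n + r \<le> b"
    "\<And>k. 1 \<le> k \<Longrightarrow> Suc k \<le> N \<Longrightarrow> h k + r \<le> h (Suc k) - r"
proof -
  show N: "1 \<le> N" and r: "0 < r"
    and "\<And>x. x \<in> {a..b} \<Longrightarrow> v x \<in> {- 1, 1}"
    and "\<And>x y. a \<le> x \<Longrightarrow> x \<le> y \<Longrightarrow> y \<le> b \<Longrightarrow> {x..y} \<inter> h ` {1..N} = {} \<Longrightarrow> v x = v y"
    using assms unfolding step_function_def by blast+
  have ends: "a \<le> h 1 - r" "h N + r \<le> b"
    using assms unfolding step_function_def by blast+
  show mono: "h k < h n" if "1 \<le> k" "k < n" "n \<le> N" for k n
    using assms that unfolding step_function_def strict_mono_on_def by auto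
  have disj: "k = n" if "k \<in> {1..N}" "n \<in> {1..N}" "x \<in> {h k - r<..<h k + r}" "x \<in> {h n - r<..<h n + r}" for k n x
    using assms that unfolding step_function_def disjoint_family_on_def by blast
  show "k = n" if "k \<in> {1..N}" "n \<in> {1..N}" "h k \<in> {h n - r<..<h n + r}" for k n
    using disj[OF that(1,2) _ that(3)] r by simp
  show "a \<le> h n - r \<and> h n + r \<le> b" if "n \<in> {1..N}" for n
  proof -
    have "h 1 \<le> h n" "h n \<le> h N"
      using mono[of 1 n] mono[of n N] that by (cases "n = 1"; cases "n = N"; simp)+
    with ends show ?thesis
      by linarith
  qed
  show "h k + r \<le> h (Suc k) - r" if "1 \<le> k" "Suc k \<le> N" for k
  proof (rule ccontr)
    assume "\<not> ?thesis"
    moreover have "h k < h (Suc k)"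
      using mono that by simp
    ultimately have "k = Suc k"
      using disj[of k "Suc k" "(h k + h (Suc k)) / 2"] that by (simp add: field_simps)
    then show False
      by simp
  qed
qed

lemma step_function_sides:
  assumes step: "step_function a b N h r v" and n: "n \<in> {1..N}"
  shows "\<exists>p\<in>{1, - 1}. \<exists>q\<in>{1, - 1}. p \<noteq> q \<and>
    (\<forall>x\<in>{h n - r<..<h n}. v x = p) \<and> (\<forall>x\<in>{h n<..<h n + r}. v x = q)"
proof -
  note S = step_functionD[OF step]
  obtain p q where pq: "p \<noteq> q" "(v \<longlongrightarrow> p) (at_left (h n))" "(v \<longlongrightarrow> q) (at_right (h n))"
    using step n unfolding step_function_def by blast
  have free: "{x..y} \<inter> h ` {1..N} = {}" if "h n - r < x" "y < h n + r" "h n \<notin> {x..y}" for x y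
    using S(6)[OF _ n] that by fastforce
  have const: "v x = v y" if "h n - r < x" "x \<le> y" "y < h n + r" "h n \<notin> {x..y}" for x y
    by (rule S(5)) (use S(7)[OF n] free that in auto)
  have left: "v x = v (h n - r / 2)" if "x \<in> {h n - r<..<h n}" for x
  proof (cases "x \<le> h n - r / 2")
    case True
    show ?thesis
      by (rule const) (use True that S(2) in auto)
  next
    case False
    show ?thesis
      by (rule const[symmetric]) (use False that S(2) in auto)
  qed
  have right: "v x = v (h n + r / 2)" if "x \<in> {h n<..<h n + r}" for x
  proof (cases "x \<le> h n + r / 2")
    case True
    show ?thesis
      by (rule const) (use True that S(2) in auto)
  next
    case False
    show ?thesis
      by (rule const[symmetric]) (use False that S(2) in auto)
  qed
  have "\<forall>\<^sub>F x in at_left (h n). x \<in> {h n - r<..<h n}"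
    using S(2) by (intro eventually_at_leftI[of "h n - r"]) auto
  then have "\<forall>\<^sub>F x in at_left (h n). v x = v (h n - r / 2)"
    by eventually_elim (rule left)
  from tendsto_unique[OF _ pq(2) tendsto_eventually[OF this]] have p: "p = v (h n - r / 2)"
    by simp
  have "\<forall>\<^sub>F x in at_right (h n). x \<in> {h n<..<h n + r}"
    using S(2) by (intro eventually_at_rightI[of _ "h n + r"]) auto
  then have "\<forall>\<^sub>F x in at_right (h n). v x = v (h n + r / 2)"
    by eventually_elim (rule right)
  from tendsto_unique[OF _ pq(3) tendsto_eventually[OF this]] have q: "q = v (h n + r / 2)"
    by simp
  have "p \<in> {1, - 1}" "q \<in> {1, - 1}"
    using S(4)[of "h n - r / 2"] S(4)[of "h n + r / 2"] S(7)[OF n] S(2) by (auto simp: p q)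
  then show ?thesis
    using pq(1) left right unfolding p q by blast
qed

lemma step_function_measurable:
  assumes step: "step_function a b N h r v"
  shows "v \<in> borel_measurable (lebesgue_on {a<..<b})"
proof -
  note S = step_functionD[OF step]
  define U where "U = {a<..<b} - h ` {1..N}"
  have U: "open U"
    unfolding U_def by (intro open_Diff finite_imp_closed finite_imageI) auto
  have "isCont v x" if x: "x \<in> U" for x
  proof -
    obtain e where e: "0 < e" "ball x e \<subseteq> U"
      using U x openE by blast
    have "v y = v x" if y: "y \<in> ball x e" for y
    proof -
      have "{min x y..max x y} \<subseteq> ball x e"
        using y e(1) by (auto simp: dist_real_def min_def max_def split: if_splits)
      with e(2) have sub: "{min x y..max x y} \<subseteq> U"
        by blast
      then have "min x y \<in> U" "max x y \<in> U"
        by (auto simp: min_def max_def)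
      then have "v (min x y) = v (max x y)"
        using sub by (intro S(5)) (auto simp: U_def)
      then show ?thesis
        by (auto simp: min_def max_def split: if_splits)
    qed
    note const = this
    have "\<forall>\<^sub>F y in nhds x. y \<in> ball x e"
      using e(1) by (intro eventually_nhds_in_open) auto
    then have "\<forall>\<^sub>F y in at x. v y = v x"
      unfolding eventually_at_filter by eventually_elim (use const in blast)
    then show ?thesis
      unfolding isCont_def by (rule tendsto_eventually)
  qed
  then have "continuous_on U v"
    by (simp add: continuous_at_imp_continuous_on)
  then have "v \<in> borel_measurable (lebesgue_on U)"
    using U by (intro continuous_imp_measurable_on_sets_lebesgue) auto
  then have "(\<lambda>x. if x \<in> U then v x else 0) \<in> borel_measurable lebesgue"
    using U borel_measurable_if[of U v] by auto
  moreover have "AE x in lebesgue. (if x \<in> U then v x else 0) = (if x \<in> {a<..<b} then v x else 0)"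
  proof (rule AE_I')
    have "negligible (h ` {1..N})"
      by (intro negligible_finite finite_imageI) auto
    then show "h ` {1..N} \<in> null_sets lebesgue"
      by (simp add: negligible_iff_null_sets)
  qed (auto simp: U_def)
  ultimately have "(\<lambda>x. if x \<in> {a<..<b} then v x else 0) \<in> borel_measurable lebesgue"
    by (rule borel_measurable_AE)
  then show ?thesis
    using borel_measurable_if[of "{a<..<b}" v] by auto
qed

lemma step_function_integrable:
  assumes "step_function a b N h r v"
  shows "integrable (lebesgue_on {a<..<b}) v"
proof (rule Bochner_Integration.integrable_bound[of _ "\<lambda>_. 1 :: real"])
  interpret finite_measure "lebesgue_on {a<..<b}"
    by (rule finite_measure_Ioo)
  show "integrable (lebesgue_on {a<..<b}) (\<lambda>_. 1 :: real)"
    by simp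
  have "norm (v x) \<le> norm (1 :: real)" if "x \<in> {a<..<b}" for x
    using step_functionD(4)[OF assms, of x] that by auto
  then show "AE x in lebesgue_on {a<..<b}. norm (v x) \<le> norm (1 :: real)"
    by (intro AE_I2) auto
qed (rule step_function_measurable[OF assms])

text \<open>The intervals of radius \<open>s\<close> around the jumps do not overlap.\<close>

lemma sum_increments_around_jumps:
  fixes G :: "real \<Rightarrow> real"
  assumes step: "step_function a b N h r v" and s: "0 \<le> s" "s \<le> r"
    and G: "\<And>x y. a \<le> x \<Longrightarrow> x \<le> y \<Longrightarrow> y \<le> b \<Longrightarrow> G x \<le> G y"
  shows "(\<Sum>n=1..N. G (h n + s) - G (h n - s)) \<le> G b - G a"
proof -
  note S = step_functionD[OF step]
  have "(\<Sum>n=1..m. G (h n + s) - G (h n - s)) \<le> G (h m + s) - G a" if "1 \<le> m" "m \<le> N" for m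
    using that
  proof (induction m rule: nat_induct_at_least)
    case base
    then show ?case
      using G[of a "h 1 - s"] S(7)[of 1] s by simp
  next
    case (Suc m)
    have "G (h m + s) \<le> G (h (Suc m) - s)"
      by (rule G) (use S(7)[of m] S(7)[of "Suc m"] S(8)[of m] S(2) Suc s in auto)
    with Suc show ?case
      by simp
  qed
  from this[of N] S(1) have "(\<Sum>n=1..N. G (h n + s) - G (h n - s)) \<le> G (h N + s) - G a"
    by simp
  also have "G (h N + s) \<le> G b"
    by (rule G) (use S(1,2) S(7)[of N] s in auto)
  finally show ?thesis
    by simp
qed

lemma k_exp_Suc: "k_exp \<theta> (Suc i) = (1 / 2 + 1 / \<theta>) * (1 + k_exp \<theta> i)"
proof -
  have "k_exp \<theta> (Suc i) = (\<Sum>m=0..i. (1 / 2 + 1 / \<theta>) ^ Suc m)"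
    unfolding k_exp_def One_nat_def sum.shift_bounds_cl_Suc_ivl by simp
  also have "\<dots> = (1 / 2 + 1 / \<theta>) * (\<Sum>m=0..i. (1 / 2 + 1 / \<theta>) ^ m)"
    by (simp add: sum_distrib_left)
  also have "(\<Sum>m=0..i. (1 / 2 + 1 / \<theta>) ^ m) = 1 + k_exp \<theta> i"
    unfolding k_exp_def by (subst sum.atLeast_Suc_atMost) auto
  finally show ?thesis .
qed

lemma k_exp_mono:
  assumes "0 < \<theta>" "i \<le> j"
  shows "k_exp \<theta> i \<le> k_exp \<theta> j"
  unfolding k_exp_def by (rule sum_mono2) (use assms in auto)

section \<open>Lower bound for the energy near a step function\<close>

context admissible_nonlinearities
begin

definition cumulative :: "real \<Rightarrow> real \<Rightarrow> (real \<Rightarrow> real) \<Rightarrow> (real \<Rightarrow> real) \<Rightarrow> real \<Rightarrow> real" where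
  "cumulative a \<epsilon> f f' x = integral {a..x} (energy_density \<epsilon> f f')"

lemma cumulative_increment:
  assumes prof: "profile a b \<epsilon> f f'" and "a \<le> x" "x \<le> y" "y \<le> b"
  shows "cumulative a \<epsilon> f f' y - cumulative a \<epsilon> f f' x = integral {x..y} (energy_density \<epsilon> f f')"
proof -
  have "energy_density \<epsilon> f f' integrable_on {a..y}"
    by (rule integrable_continuous_real[OF continuous_on_subset[OF energy_density_cont[OF prof]]])
      (use assms in auto)
  then show ?thesis
    using Henstock_Kurzweil_Integration.integral_combine[of a x y "energy_density \<epsilon> f f'"] assms
    by (simp add: cumulative_def)
qed

lemma cumulative_mono:
  assumes prof: "profile a b \<epsilon> f f'" and xy: "a \<le> x" "x \<le> y" "y \<le> b"
  shows "cumulative a \<epsilon> f f' x \<le> cumulative a \<epsilon> f f' y"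
proof -
  have "energy_density \<epsilon> f f' integrable_on {x..y}"
    by (rule integrable_continuous_real[OF continuous_on_subset[OF energy_density_cont[OF prof]]])
      (use assms in auto)
  moreover have "0 \<le> energy_density \<epsilon> f f' z" if "z \<in> {x..y}" for z
    using energy_density_ge[OF prof, of z] that xy by auto
  ultimately have "0 \<le> integral {x..y} (energy_density \<epsilon> f f')"
    by (rule Henstock_Kurzweil_Integration.integral_nonneg)
  with cumulative_increment[OF assms] show ?thesis
    by simp
qed

text \<open>The energy between the distances \<open>s\<close> and \<open>s'\<close> from a jump is at most \<open>B1 + B2\<close>, as the inner part already
accounts for the rest. So this region contains, on each side of the jump, a point close to the right well
with potential at most \<open>A\<close>, and the passage between these two points costs almost \<open>c_eps\<close>.\<close>

lemma energy_lower_bound_step: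
  assumes step: "step_function a b N h r v" and s: "0 \<le> s" "s < s'" "s' \<le> r"
    and \<eta>: "0 < \<eta>" "0 < L" and loss: "\<forall>\<epsilon> W p z A. small \<epsilon> \<longrightarrow> (\<forall>s. (W has_real_derivative weight \<epsilon> s) (at s)) \<longrightarrow>
      p \<in> {1, - 1} \<longrightarrow> \<bar>z - p\<bar> \<le> \<eta> \<longrightarrow> F z \<le> A \<longrightarrow> \<bar>W z - W p\<bar> \<le> L * A powr (1 / 2 + 1 / \<theta>)"
    and prof: "profile a b \<epsilon> f f'"
    and L1: "L1_norm a b (\<lambda>x. f x - v x) \<le> \<eta> * ((s' - s) / 4)" and "0 < A"
    and upper: "cumulative a \<epsilon> f f' b \<le> real N * c_eps Q \<kappa> F \<epsilon> + B1"
    and lower: "real N * c_eps Q \<kappa> F \<epsilon> - B2 \<le>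
      (\<Sum>n=1..N. cumulative a \<epsilon> f f' (h n + s) - cumulative a \<epsilon> f f' (h n - s))"
    and B: "B1 + B2 \<le> A / \<epsilon> * ((s' - s) / 4)"
  shows "real N * (c_eps Q \<kappa> F \<epsilon> - 2 * (L * A powr (1 / 2 + 1 / \<theta>))) \<le>
      (\<Sum>n=1..N. cumulative a \<epsilon> f f' (h n + s') - cumulative a \<epsilon> f f' (h n - s'))"
proof -
  note S = step_functionD[OF step]
  note p = profileD[OF prof]
  define G where "G = cumulative a \<epsilon> f f'"
  have G_int: "G y - G x = integral {x..y} (energy_density \<epsilon> f f')" and G_mono: "G x \<le> G y"
    if "a \<le> x" "x \<le> y" "y \<le> b" for x y
    using cumulative_increment[OF prof that] cumulative_mono[OF prof that] by (simp_all add: G_def)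
  obtain W where W: "\<And>s. (W has_real_derivative weight \<epsilon> s) (at s)"
    using weight_antiderivative[OF p(1)] by blast
  have c: "c_eps Q \<kappa> F \<epsilon> = W 1 - W (- 1)"
    by (rule c_eps_eq[OF p(1) W])
  have in_ab: "a \<le> h n - s'" "h n + s' \<le> b" if "n \<in> {1..N}" for n
    using S(7)[OF that] s by auto
  \<comment> \<open>The energy in the two shells between the distances \<open>s\<close> and \<open>s'\<close> of a jump.\<close>
  define gap where "gap = (\<lambda>n. (G (h n + s') - G (h n + s)) + (G (h n - s) - G (h n - s')))"
  have gap_nonneg: "0 \<le> G (h n + s') - G (h n + s)" "0 \<le> G (h n - s) - G (h n - s')" if "n \<in> {1..N}" for n
    using G_mono[of "h n + s" "h n + s'"] G_mono[of "h n - s'" "h n - s"] in_ab[OF that] s by auto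
  have "(\<Sum>n=1..N. gap n) = (\<Sum>n=1..N. G (h n + s') - G (h n - s')) - (\<Sum>n=1..N. G (h n + s) - G (h n - s))"
    unfolding gap_def sum_subtractf[symmetric] by (rule sum.cong) auto
  also have "(\<Sum>n=1..N. G (h n + s') - G (h n - s')) \<le> G b - G a"
    by (rule sum_increments_around_jumps[OF step _ s(3)]) (use s G_mono in auto)
  finally have "(\<Sum>n=1..N. gap n) \<le> B1 + B2"
    using upper lower by (simp add: G_def cumulative_def)
  then have gap: "gap n \<le> A / \<epsilon> * ((s' - s) / 4)" if "n \<in> {1..N}" for n
  proof -
    have "gap n \<le> (\<Sum>n=1..N. gap n)"
      by (rule member_le_sum) (use that gap_nonneg in \<open>auto simp: gap_def add_nonneg_nonneg\<close>)
    with \<open>(\<Sum>n=1..N. gap n) \<le> B1 + B2\<close> B show ?thesis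
      by linarith
  qed
  have intf: "integrable (lebesgue_on {a<..<b}) (\<lambda>x. \<bar>f x - v x\<bar>)"
    using continuous_integrable_Ioo(1)[OF p(4)] step_function_integrable[OF step] by simp
  have L1_sub: "(\<integral>x. \<bar>f x - q\<bar> \<partial>lebesgue_on {c<..<d}) \<le> \<eta> * ((s' - s) / 4)"
    if "a \<le> c" "d \<le> b" and q: "\<And>x. x \<in> {c<..<d} \<Longrightarrow> v x = q" for c d q
  proof -
    have "(\<integral>x. \<bar>f x - q\<bar> \<partial>lebesgue_on {c<..<d}) = (\<integral>x. indicator {c<..<d} x * \<bar>f x - q\<bar> \<partial>lebesgue_on {a<..<b})"
      by (rule integral_indicator_lebesgue_on[symmetric]) (use that in auto)
    also have "\<dots> = (\<integral>x. indicator {c<..<d} x *\<^sub>R \<bar>f x - v x\<bar> \<partial>lebesgue_on {a<..<b})"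
      using q by (intro Bochner_Integration.integral_cong) (auto simp: indicator_def)
    also have "\<dots> \<le> (\<integral>x. \<bar>f x - v x\<bar> \<partial>lebesgue_on {a<..<b})"
    proof (rule integral_mono[OF integrable_mult_indicator[OF _ intf] intf])
      have "{c<..<d} \<subseteq> {a<..<b}"
        using that by auto
      then show "{c<..<d} \<in> sets (lebesgue_on {a<..<b})"
        by (simp add: sets_restrict_space_iff)
    qed (auto simp: indicator_def)
    also have "\<dots> \<le> \<eta> * ((s' - s) / 4)"
      using L1 by (simp add: L1_norm_def)
    finally show ?thesis .
  qed
  have single: "c_eps Q \<kappa> F \<epsilon> - 2 * (L * A powr (1 / 2 + 1 / \<theta>)) \<le> G (h n + s') - G (h n - s')"
    if n: "n \<in> {1..N}" for n
  proof -
    obtain p q where pq: "p \<in> {1, - 1}" "q \<in> {1, - 1}" "p \<noteq> q"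
      "\<And>x. x \<in> {h n - r<..<h n} \<Longrightarrow> v x = p" "\<And>x. x \<in> {h n<..<h n + r} \<Longrightarrow> v x = q"
      using step_function_sides[OF step n] by blast
    have "\<exists>y\<in>{h n + s..h n + s'}. \<bar>f y - q\<bar> \<le> \<eta> \<and> F (f y) \<le> A"
    proof (rule exists_point_near_well[OF prof])
      show "(\<integral>x. \<bar>f x - q\<bar> \<partial>lebesgue_on {h n + s<..<h n + s'}) \<le> \<eta> * ((h n + s' - (h n + s)) / 4)"
        using L1_sub[of "h n + s" "h n + s'" q] pq(5) in_ab[OF n] s S(7)[OF n] S(2) by simp
      show "integral {h n + s..h n + s'} (energy_density \<epsilon> f f') \<le> A / \<epsilon> * ((h n + s' - (h n + s)) / 4)"
        using gap[OF n] gap_nonneg(2)[OF n] G_int[of "h n + s" "h n + s'"] in_ab[OF n] s S(7)[OF n] S(2)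
        by (simp add: gap_def)
    qed (use in_ab[OF n] s S(7)[OF n] S(2) \<eta> \<open>0 < A\<close> in auto)
    then obtain y where y: "y \<in> {h n + s..h n + s'}" "\<bar>f y - q\<bar> \<le> \<eta>" "F (f y) \<le> A"
      by blast
    have "\<exists>x\<in>{h n - s'..h n - s}. \<bar>f x - p\<bar> \<le> \<eta> \<and> F (f x) \<le> A"
    proof (rule exists_point_near_well[OF prof])
      show "(\<integral>x. \<bar>f x - p\<bar> \<partial>lebesgue_on {h n - s'<..<h n - s}) \<le> \<eta> * ((h n - s - (h n - s')) / 4)"
        using L1_sub[of "h n - s'" "h n - s" p] pq(4) in_ab[OF n] s S(7)[OF n] S(2) by simp
      show "integral {h n - s'..h n - s} (energy_density \<epsilon> f f') \<le> A / \<epsilon> * ((h n - s - (h n - s')) / 4)"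
        using gap[OF n] gap_nonneg(1)[OF n] G_int[of "h n - s'" "h n - s"] in_ab[OF n] s S(7)[OF n] S(2)
        by (simp add: gap_def)
    qed (use in_ab[OF n] s S(7)[OF n] S(2) \<eta> \<open>0 < A\<close> in auto)
    then obtain x where x: "x \<in> {h n - s'..h n - s}" "\<bar>f x - p\<bar> \<le> \<eta>" "F (f x) \<le> A"
      by blast
    have xy: "a \<le> x" "x \<le> y" "y \<le> b"
      using x(1) y(1) in_ab[OF n] s by auto
    have "c_eps Q \<kappa> F \<epsilon> \<le> \<bar>W q - W p\<bar>"
      using pq(1-3) c by auto
    also have "\<dots> \<le> \<bar>W (f y) - W (f x)\<bar> + 2 * (L * A powr (1 / 2 + 1 / \<theta>))"
    proof -
      have "\<bar>W z - W p'\<bar> \<le> L * A powr (1 / 2 + 1 / \<theta>)" if "p' \<in> {1, - 1}" "\<bar>z - p'\<bar> \<le> \<eta>" "F z \<le> A" for z p'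
        using loss p(1) W that by blast
      from this[OF pq(1) x(2,3)] this[OF pq(2) y(2,3)] show ?thesis
        by linarith
    qed
    also have "\<bar>W (f y) - W (f x)\<bar> \<le> G y - G x"
      using transition_energy[OF prof W xy] G_int[OF xy] by simp
    also have "G y - G x \<le> G (h n + s') - G (h n - s')"
      using G_mono[of y "h n + s'"] G_mono[of "h n - s'" x] x(1) y(1) xy in_ab[OF n] by auto
    finally show ?thesis
      by simp
  qed
  have "(\<Sum>n=1..N. c_eps Q \<kappa> F \<epsilon> - 2 * (L * A powr (1 / 2 + 1 / \<theta>))) \<le> (\<Sum>n=1..N. G (h n + s') - G (h n - s'))"
    by (rule sum_mono) (rule single)
  then show ?thesis
    by (simp add: G_def)
qed

text \<open>Apply \<open>energy_lower_bound_step\<close> \<open>j\<close> times with the distances \<open>i r / (j + 1)\<close>, starting from the trivial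
bound at distance zero, where \<open>c_eps\<close> is only known to be bounded.\<close>

theorem energy_lower_bound:
  assumes step: "step_function a b N h r v" and "0 \<le> C"
  shows "\<exists>\<delta>>0. \<exists>K\<ge>0. \<exists>e>0. \<forall>\<epsilon>\<in>{0<..<e}. \<forall>f f'. profile a b \<epsilon> f f' \<longrightarrow>
    L1_norm a b (\<lambda>x. f x - v x) \<le> \<delta> \<longrightarrow>
    integral {a..b} (energy_density \<epsilon> f f') \<le> real N * c_eps Q \<kappa> F \<epsilon> + C * \<epsilon> powr k_exp \<theta> j \<longrightarrow>
    real N * c_eps Q \<kappa> F \<epsilon> - K * \<epsilon> powr k_exp \<theta> j \<le> integral {a..b} (energy_density \<epsilon> f f')"
proof -
  note S = step_functionD[OF step]
  obtain \<eta> L where \<eta>: "0 < \<eta>" "0 < L" and loss: "\<forall>\<epsilon> W p z A. small \<epsilon> \<longrightarrow> (\<forall>s. (W has_real_derivative weight \<epsilon> s) (at s)) \<longrightarrow>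
      p \<in> {1, - 1} \<longrightarrow> \<bar>z - p\<bar> \<le> \<eta> \<longrightarrow> F z \<le> A \<longrightarrow> \<bar>W z - W p\<bar> \<le> L * A powr (1 / 2 + 1 / \<theta>)"
    using potential_loss_near_well by blast
  define \<sigma> where "\<sigma> = r / (real j + 1)"
  define s where "s = (\<lambda>i. real i * \<sigma>)"
  have \<sigma>: "0 < \<sigma>"
    using S(2) by (simp add: \<sigma>_def)
  have s: "0 \<le> s i" "s (Suc i) - s i = \<sigma>" for i
    using \<sigma> by (auto simp: s_def algebra_simps)
  have s_le: "s i \<le> r" if "i \<le> j" for i
  proof -
    have "s i \<le> (real j + 1) * \<sigma>"
      unfolding s_def using that \<sigma> by (intro mult_right_mono) auto
    then show ?thesis
      by (simp add: \<sigma>_def)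
  qed
  \<comment> \<open>\<open>\<sigma>\<close> is the width of every shell, so this \<open>\<delta>\<close> serves all steps of the induction.\<close>
  define \<delta> where "\<delta> = \<eta> * (\<sigma> / 4)"
  have "0 < \<delta>"
    using \<eta> \<sigma> by (simp add: \<delta>_def)
  have "\<exists>K\<ge>0. \<exists>e>0. \<forall>\<epsilon>\<in>{0<..<e}. \<forall>f f'. profile a b \<epsilon> f f' \<longrightarrow>
    L1_norm a b (\<lambda>x. f x - v x) \<le> \<delta> \<longrightarrow>
    integral {a..b} (energy_density \<epsilon> f f') \<le> real N * c_eps Q \<kappa> F \<epsilon> + C * \<epsilon> powr k_exp \<theta> j \<longrightarrow>
    real N * c_eps Q \<kappa> F \<epsilon> - K * \<epsilon> powr k_exp \<theta> i \<le>
      (\<Sum>n=1..N. cumulative a \<epsilon> f f' (h n + s i) - cumulative a \<epsilon> f f' (h n - s i))"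
    if "i \<le> j" for i
    using that
  proof (induction i)
    case 0
    obtain B where B: "0 \<le> B" "\<And>\<epsilon>. small \<epsilon> \<Longrightarrow> c_eps Q \<kappa> F \<epsilon> \<le> B"
      using c_eps_bounded by blast
    have "real N * c_eps Q \<kappa> F \<epsilon> - real N * B * \<epsilon> powr k_exp \<theta> 0 \<le>
      (\<Sum>n=1..N. cumulative a \<epsilon> f f' (h n + s 0) - cumulative a \<epsilon> f f' (h n - s 0))"
      if "profile a b \<epsilon> f f'" for \<epsilon> f f'
      using B(2)[OF profileD(1)[OF that]] profileD(2)[OF that]
      by (simp add: s_def k_exp_def mult_left_mono)
    with B(1) show ?case
      by (intro exI[of _ "real N * B"] conjI exI[of _ 1]) auto
  next
    case (Suc i)
    then obtain K e where K: "0 \<le> K" and e: "0 < e" and IH: "\<And>\<epsilon> f f'. \<epsilon> \<in> {0<..<e} \<Longrightarrow> profile a b \<epsilon> f f' \<Longrightarrow>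
      L1_norm a b (\<lambda>x. f x - v x) \<le> \<delta> \<Longrightarrow>
      integral {a..b} (energy_density \<epsilon> f f') \<le> real N * c_eps Q \<kappa> F \<epsilon> + C * \<epsilon> powr k_exp \<theta> j \<Longrightarrow>
      real N * c_eps Q \<kappa> F \<epsilon> - K * \<epsilon> powr k_exp \<theta> i \<le>
        (\<Sum>n=1..N. cumulative a \<epsilon> f f' (h n + s i) - cumulative a \<epsilon> f f' (h n - s i))"
      by (auto simp: Suc_le_eq)
    define \<alpha> where "\<alpha> = 1 / 2 + 1 / \<theta>"
    define D where "D = 4 * (C + K + 1) / \<sigma>"
    have "0 < D"
      using \<open>0 \<le> C\<close> K \<sigma> by (simp add: D_def)
    define K' where "K' = real N * (2 * (L * D powr \<alpha>))"
    have "real N * c_eps Q \<kappa> F \<epsilon> - K' * \<epsilon> powr k_exp \<theta> (Suc i) \<le>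
        (\<Sum>n=1..N. cumulative a \<epsilon> f f' (h n + s (Suc i)) - cumulative a \<epsilon> f f' (h n - s (Suc i)))"
      if \<epsilon>: "\<epsilon> \<in> {0<..<min e 1}" and prof: "profile a b \<epsilon> f f'" and L1: "L1_norm a b (\<lambda>x. f x - v x) \<le> \<delta>"
        and upper: "integral {a..b} (energy_density \<epsilon> f f') \<le> real N * c_eps Q \<kappa> F \<epsilon> + C * \<epsilon> powr k_exp \<theta> j" for \<epsilon> f f'
    proof -
      \<comment> \<open>The energy left in a shell is of order \<open>\<epsilon>\<^sup>k\<close>; the potential enters it with the factor \<open>1/\<epsilon>\<close>, which
        gains one power of \<open>\<epsilon>\<close>.\<close>
      define A where "A = D * (\<epsilon> * \<epsilon> powr k_exp \<theta> i)"
      have eps: "0 < \<epsilon>" "\<epsilon> < 1"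
        using \<epsilon> by auto
      have "0 < A"
        using \<open>0 < D\<close> eps by (simp add: A_def)
      have "real N * (c_eps Q \<kappa> F \<epsilon> - 2 * (L * A powr (1 / 2 + 1 / \<theta>))) \<le>
        (\<Sum>n=1..N. cumulative a \<epsilon> f f' (h n + s (Suc i)) - cumulative a \<epsilon> f f' (h n - s (Suc i)))"
      proof (rule energy_lower_bound_step[OF step s(1) _ s_le[OF Suc.prems] \<eta> loss prof])
        show "s i < s (Suc i)"
          using s(2)[of i] \<sigma> by simp
        show "L1_norm a b (\<lambda>x. f x - v x) \<le> \<eta> * ((s (Suc i) - s i) / 4)"
          using L1 s(2)[of i] by (simp add: \<delta>_def)
        show "cumulative a \<epsilon> f f' b \<le> real N * c_eps Q \<kappa> F \<epsilon> + C * \<epsilon> powr k_exp \<theta> j"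
          using upper by (simp add: cumulative_def)
        show "real N * c_eps Q \<kappa> F \<epsilon> - K * \<epsilon> powr k_exp \<theta> i \<le>
            (\<Sum>n=1..N. cumulative a \<epsilon> f f' (h n + s i) - cumulative a \<epsilon> f f' (h n - s i))"
          by (rule IH[OF _ prof L1 upper]) (use \<epsilon> in auto)
        have "\<epsilon> powr k_exp \<theta> j \<le> \<epsilon> powr k_exp \<theta> i"
          using k_exp_mono[of \<theta> i j] theta Suc.prems eps by (intro powr_mono') auto
        from mult_left_mono[OF this \<open>0 \<le> C\<close>]
        have "C * \<epsilon> powr k_exp \<theta> j + K * \<epsilon> powr k_exp \<theta> i \<le> (C + K + 1) * \<epsilon> powr k_exp \<theta> i"
          by (simp add: distrib_right add_increasing2)
        also have "\<dots> = A / \<epsilon> * ((s (Suc i) - s i) / 4)"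
          using eps \<sigma> unfolding s(2) A_def D_def by (simp add: field_simps)
        finally show "C * \<epsilon> powr k_exp \<theta> j + K * \<epsilon> powr k_exp \<theta> i \<le> A / \<epsilon> * ((s (Suc i) - s i) / 4)" .
      qed (use \<open>0 < A\<close> in auto)
      moreover have "A powr \<alpha> = D powr \<alpha> * \<epsilon> powr k_exp \<theta> (Suc i)"
        using \<open>0 < D\<close> eps
        by (simp add: A_def powr_mult powr_powr k_exp_Suc \<alpha>_def powr_mult_base mult.commute)
      ultimately show ?thesis
        by (simp add: K'_def \<alpha>_def right_diff_distrib mult_ac)
    qed
    moreover have "0 \<le> K'"
      using \<eta> by (simp add: K'_def)
    ultimately show ?case
      using e by (intro exI[of _ K'] conjI exI[of _ "min e 1"]) auto
  qed
  from this[of j] obtain K e where K: "0 \<le> K" and e: "0 < e" and final: "\<And>\<epsilon> f f'. \<epsilon> \<in> {0<..<e} \<Longrightarrow> profile a b \<epsilon> f f' \<Longrightarrow>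
    L1_norm a b (\<lambda>x. f x - v x) \<le> \<delta> \<Longrightarrow>
    integral {a..b} (energy_density \<epsilon> f f') \<le> real N * c_eps Q \<kappa> F \<epsilon> + C * \<epsilon> powr k_exp \<theta> j \<Longrightarrow>
    real N * c_eps Q \<kappa> F \<epsilon> - K * \<epsilon> powr k_exp \<theta> j \<le>
      (\<Sum>n=1..N. cumulative a \<epsilon> f f' (h n + s j) - cumulative a \<epsilon> f f' (h n - s j))"
    by auto
  have "(\<Sum>n=1..N. cumulative a \<epsilon> f f' (h n + s j) - cumulative a \<epsilon> f f' (h n - s j)) \<le>
      integral {a..b} (energy_density \<epsilon> f f')" if "profile a b \<epsilon> f f'" for \<epsilon> f f'
  proof -
    have "(\<Sum>n=1..N. cumulative a \<epsilon> f f' (h n + s j) - cumulative a \<epsilon> f f' (h n - s j)) \<le>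
        cumulative a \<epsilon> f f' b - cumulative a \<epsilon> f f' a"
      by (rule sum_increments_around_jumps[OF step s(1) s_le]) (use cumulative_mono[OF that] in auto)
    then show ?thesis
      by (simp add: cumulative_def)
  qed
  with final have "real N * c_eps Q \<kappa> F \<epsilon> - K * \<epsilon> powr k_exp \<theta> j \<le> integral {a..b} (energy_density \<epsilon> f f')"
    if "\<epsilon> \<in> {0<..<e}" "profile a b \<epsilon> f f'" "L1_norm a b (\<lambda>x. f x - v x) \<le> \<delta>"
      "integral {a..b} (energy_density \<epsilon> f f') \<le> real N * c_eps Q \<kappa> F \<epsilon> + C * \<epsilon> powr k_exp \<theta> j" for \<epsilon> f f'
    using that order_trans by blast
  then show ?thesis
    using \<open>0 < \<delta>\<close> K e by blast
qed

end

section \<open>Solutions as trajectories\<close>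

lemma space_deriv_works:
  assumes "f differentiable (at x within {a..b})"
  shows "(f has_real_derivative space_deriv a b f x) (at x within {a..b})"
  using assms vector_derivative_works
  by (auto simp: space_deriv_def has_real_derivative_iff_has_vector_derivative)

lemma integral_square_le_sobolev_norm_1:
  "(\<integral>x. (f x)\<^sup>2 \<partial>lebesgue_on {a<..<b}) \<le> (sobolev_norm 1 a b f)\<^sup>2"
  by simp

lemma sobolev_H_1_square_integrable: "sobolev_H 1 a b f \<Longrightarrow> square_integrable a b f"
  by simp

context admissible_nonlinearities
begin

text \<open>Continuity of \<open>u\<^sub>x\<close> comes from the regularity \<open>H\<^sup>2\<close>, the rest from the regularity \<open>H\<^sup>1\<close> in time and the equation.\<close>

lemma solution_energy_trajectory:
  assumes "a < b" and eps: "0 < \<epsilon>" and "0 < T" and sol: "is_solution Q \<kappa> F a b \<epsilon> u0 u"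
  shows "\<exists>w. energy_trajectory a b \<epsilon> \<kappa> T Q (Q_tilde Q) F (deriv F) u (\<lambda>t. space_deriv a b (u t)) w"
proof -
  define ux where "ux = (\<lambda>t. space_deriv a b (u t))"
  have diff: "\<And>t x. 0 \<le> t \<Longrightarrow> x \<in> {a..b} \<Longrightarrow> u t differentiable (at x within {a..b})"
    and C0: "C0_sobolev 2 a b T u"
    and bd: "\<And>t x. 0 \<le> t \<Longrightarrow> x \<in> {a..b} \<Longrightarrow> \<bar>ux t x\<bar> \<le> \<kappa> / \<epsilon>\<^sup>2"
    and neumann: "\<And>t. 0 < t \<Longrightarrow> ux t a = 0 \<and> ux t b = 0"
    using sol \<open>0 < T\<close> unfolding is_solution_def ux_def by auto
  obtain w where C1: "C1_sobolev 1 a b T u w" and pde: "\<And>t. 0 < t \<Longrightarrow>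
      \<exists>g. has_weak_deriv a b (\<lambda>x. Q (\<epsilon>\<^sup>2 * ux t x)) g \<and>
           (AE x in lebesgue_on {a<..<b}. w t x = g x - deriv F (u t x))"
    using sol \<open>0 < T\<close> unfolding is_solution_def ux_def by blast
  have D: "(u t has_real_derivative ux t x) (at x within {a..b})" if "t \<in> {0..T}" "x \<in> {a..b}" for t x
    unfolding ux_def by (rule space_deriv_works[OF diff]) (use that in auto)
  have cont: "continuous_on {a..b} (ux t)" if t: "t \<in> {0..T}" for t
    by (rule H2_continuous_deriv[OF \<open>a < b\<close>, where f = "u t" and B = "\<kappa> / \<epsilon>\<^sup>2"])
      (use D t bd C0 in \<open>auto simp: C0_sobolev_def\<close>)
  have bound: "\<bar>\<epsilon>\<^sup>2 * ux t x\<bar> \<le> \<kappa>" if "t \<in> {0..T}" "x \<in> {a..b}" for t x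
    using bd[of t x] that eps by (simp add: abs_mult pos_le_divide_eq mult.commute)
  have ucont: "continuous_on {a..b} (u t)" if "t \<in> {0..T}" for t
    using D[OF that] by (meson DERIV_continuous_on)
  have wsq: "square_integrable a b (w t)" if "t \<in> {0..T}" for t
    using C1 that unfolding C1_sobolev_def C0_sobolev_def by (blast intro: sobolev_H_1_square_integrable)
  have H1: "((\<lambda>s. (\<integral>x. (u s x - u t x)\<^sup>2 \<partial>lebesgue_on {a<..<b}) +
      (\<integral>x. (ux s x - ux t x)\<^sup>2 \<partial>lebesgue_on {a<..<b})) \<longlongrightarrow> 0) (at t within {0..T})" if t: "t \<in> {0..T}" for t
  proof (rule Lim_transform_eventually)
    have "((\<lambda>s. sobolev_norm 1 a b (\<lambda>x. u s x - u t x)) \<longlongrightarrow> 0) (at t within {0..T})"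
      using C1 t unfolding C1_sobolev_def C0_sobolev_def by blast
    from tendsto_power[OF this, of 2]
    show "((\<lambda>s. (sobolev_norm 1 a b (\<lambda>x. u s x - u t x))\<^sup>2) \<longlongrightarrow> 0) (at t within {0..T})"
      by simp
    show "\<forall>\<^sub>F s in at t within {0..T}. (sobolev_norm 1 a b (\<lambda>x. u s x - u t x))\<^sup>2 =
        (\<integral>x. (u s x - u t x)\<^sup>2 \<partial>lebesgue_on {a<..<b}) + (\<integral>x. (ux s x - ux t x)\<^sup>2 \<partial>lebesgue_on {a<..<b})"
      unfolding eventually_at_filter
    proof (intro always_eventually allI impI)
      fix s assume s: "s \<in> {0..T}"
      have "sobolev_norm 1 a b (\<lambda>x. u s x - u t x) = sqrt ((\<integral>x. (u s x - u t x)\<^sup>2 \<partial>lebesgue_on {a<..<b}) +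
          (\<integral>x. (ux s x - ux t x)\<^sup>2 \<partial>lebesgue_on {a<..<b}))"
      proof (rule sobolev_norm_1_classical)
        show "continuous_on {a..b} (\<lambda>x. ux s x - ux t x)"
          by (intro continuous_intros cont s t)
        show "((\<lambda>x. u s x - u t x) has_real_derivative ux s x - ux t x) (at x within {a..b})"
          if "x \<in> {a..b}" for x
          by (intro DERIV_diff D s t that)
      qed (use \<open>a < b\<close> in simp)
      then show "(sobolev_norm 1 a b (\<lambda>x. u s x - u t x))\<^sup>2 =
        (\<integral>x. (u s x - u t x)\<^sup>2 \<partial>lebesgue_on {a<..<b}) + (\<integral>x. (ux s x - ux t x)\<^sup>2 \<partial>lebesgue_on {a<..<b})"
        by simp
    qed
  qed
  have "energy_trajectory a b \<epsilon> \<kappa> T Q (Q_tilde Q) F (deriv F) u ux w"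
  proof (unfold_locales; (rule \<open>a < b\<close> eps Q_cont Q_tilde_cont Q_tilde_convex F_deriv F'_cont D cont bound wsq; assumption?)?)
    fix t assume t: "t \<in> {0..T}"
    show "((\<lambda>s. \<integral>x. (u s x - u t x)\<^sup>2 \<partial>lebesgue_on {a<..<b}) \<longlongrightarrow> 0) (at t within {0..T})"
      by (rule tendsto_sandwich[OF _ _ tendsto_const H1[OF t]]) (auto intro!: always_eventually)
    show "((\<lambda>s. \<integral>x. (ux s x - ux t x)\<^sup>2 \<partial>lebesgue_on {a<..<b}) \<longlongrightarrow> 0) (at t within {0..T})"
      by (rule tendsto_sandwich[OF _ _ tendsto_const H1[OF t]]) (auto intro!: always_eventually)
    show "((\<lambda>s. \<integral>x. ((u s x - u t x) / (s - t) - w t x)\<^sup>2 \<partial>lebesgue_on {a<..<b}) \<longlongrightarrow> 0) (at t within {0..T})"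
    proof (rule tendsto_sandwich[OF _ _ tendsto_const])
      have "((\<lambda>s. sobolev_norm 1 a b (\<lambda>x. (u s x - u t x) / (s - t) - w t x)) \<longlongrightarrow> 0) (at t within {0..T})"
        using C1 t unfolding C1_sobolev_def by blast
      from tendsto_power[OF this, of 2]
      show "((\<lambda>s. (sobolev_norm 1 a b (\<lambda>x. (u s x - u t x) / (s - t) - w t x))\<^sup>2) \<longlongrightarrow> 0) (at t within {0..T})"
        by simp
      show "\<forall>\<^sub>F s in at t within {0..T}. (\<integral>x. ((u s x - u t x) / (s - t) - w t x)\<^sup>2 \<partial>lebesgue_on {a<..<b}) \<le>
          (sobolev_norm 1 a b (\<lambda>x. (u s x - u t x) / (s - t) - w t x))\<^sup>2"
        by (intro always_eventually allI integral_square_le_sobolev_norm_1)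
    qed (auto intro!: always_eventually)
  next
    fix t assume "t \<in> {0<..T}"
    then have t: "0 < t" "t \<in> {0..T}"
      by auto
    obtain g where g: "has_weak_deriv a b (\<lambda>x. Q (\<epsilon>\<^sup>2 * ux t x)) g"
      "AE x in lebesgue_on {a<..<b}. w t x = g x - deriv F (u t x)"
      using pde[OF t(1)] by blast
    have X: "continuous_on {a..b} (\<lambda>x. Q (\<epsilon>\<^sup>2 * ux t x))"
      by (rule continuous_on_compose2[OF Q_cont[of UNIV]]) (auto intro!: continuous_intros cont[OF t(2)])
    have "continuous_on {a..b} (\<lambda>x. deriv F (u t x))"
      by (rule continuous_on_compose2[OF F'_cont]) (auto intro!: ucont[OF t(2)])
    then have int: "integrable (lebesgue_on {a<..<b}) (\<lambda>x. w t x + deriv F (u t x))"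
      using square_integrable_integrable[OF wsq[OF t(2)]] continuous_integrable_Ioo(1) by auto
    have "AE x in lebesgue_on {a<..<b}. w t x + deriv F (u t x) = g x"
      using g(2) by eventually_elim simp
    then have gint: "integrable (lebesgue_on {a<..<b}) g"
      using integral_lebesgue_on_AE(2)[OF borel_measurable_integrable[OF int]] int by simp
    have "Q (\<epsilon>\<^sup>2 * ux t y) = integral {a..y} g" if "y \<in> {a..b}" for y
      using weak_deriv_increment_closed[OF \<open>a < b\<close> X g(1) gint that] neumann[OF t(1)] by simp
    then show "\<exists>g. integrable (lebesgue_on {a<..<b}) g \<and>
        (\<forall>y\<in>{a..b}. Q (\<epsilon>\<^sup>2 * ux t y) = integral {a..y} g) \<and> Q (\<epsilon>\<^sup>2 * ux t b) = 0 \<and>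
        (AE x in lebesgue_on {a<..<b}. w t x = g x - deriv F (u t x))"
      using gint g(2) neumann[OF t(1)] by auto
  qed
  then show ?thesis
    unfolding ux_def by blast
qed

lemma energy_eq_integral_energy_density:
  assumes "a < b" and prof: "profile a b \<epsilon> f (space_deriv a b f)"
  shows "energy Q F a b \<epsilon> f = integral {a..b} (energy_density \<epsilon> f (space_deriv a b f))"
  unfolding energy_def energy_density_def[symmetric]
  by (rule interval_integral_eq_integral)
    (use \<open>a < b\<close> energy_density_cont[OF prof] in \<open>auto intro: borel_integrable_atLeastAtMost'\<close>)

lemma energy_cong:
  assumes "a < b" "\<And>x. x \<in> {a..b} \<Longrightarrow> f x = g x"
  shows "energy Q F a b \<epsilon> f = energy Q F a b \<epsilon> g"
proof -
  have "space_deriv a b f x = space_deriv a b g x" if x: "x \<in> {a..b}" for x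
  proof -
    have "(f has_vector_derivative D) (at x within {a..b}) \<longleftrightarrow> (g has_vector_derivative D) (at x within {a..b})" for D
      by (rule has_vector_derivative_cong_ev[OF always_eventually]) (use assms x in auto)
    then show ?thesis
      unfolding space_deriv_def vector_derivative_def by simp
  qed
  then show ?thesis
    unfolding energy_def using assms by (intro interval_integral_cong) (auto simp: einterval_iff)
qed

section \<open>Slow motion\<close>


text \<open>Whenever the solution is within \<open>\<delta>\<close> of \<open>v\<close>, the lower bound limits the dissipated energy by \<open>B1 + B2\<close>, so it is
even within the smaller distance on the right-hand side. By the intermediate value theorem it cannot pass
from that smaller distance to more than \<open>\<delta>\<close>.\<close>

lemma L1_distance_while_near:
  assumes "a < b" and small: "small \<epsilon>" and sol: "is_solution Q \<kappa> F a b \<epsilon> u0 u"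
    and v: "integrable (lebesgue_on {a<..<b}) v" and "0 < T" "0 < \<mu>" "0 \<le> B1" "0 \<le> B2"
    and upper: "energy Q F a b \<epsilon> u0 \<le> c + B1"
    and lower: "\<And>f f'. profile a b \<epsilon> f f' \<Longrightarrow> L1_norm a b (\<lambda>x. f x - v x) \<le> \<delta> \<Longrightarrow>
      integral {a..b} (energy_density \<epsilon> f f') \<le> c + B1 \<Longrightarrow> c - B2 \<le> integral {a..b} (energy_density \<epsilon> f f')"
    and close: "L1_norm a b (\<lambda>x. u0 x - v x) + ((b - a) * \<mu> * T / 2 + \<epsilon> / (2 * \<mu>) * (B1 + B2)) < \<delta>"
    and t: "t \<in> {0..T}"
  shows "L1_norm a b (\<lambda>x. u t x - v x) \<le>
    L1_norm a b (\<lambda>x. u0 x - v x) + ((b - a) * \<mu> * T / 2 + \<epsilon> / (2 * \<mu>) * (B1 + B2))"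
proof -
  let ?bd = "(b - a) * \<mu> * T / 2 + \<epsilon> / (2 * \<mu>) * (B1 + B2)"
  let ?ux = "\<lambda>t. space_deriv a b (u t)"
  have eps: "0 < \<epsilon>"
    using small by (simp add: small_def)
  define \<phi> where "\<phi> = (\<lambda>t. L1_norm a b (\<lambda>x. u t x - v x))"
  have init: "u 0 x = u0 x" if "x \<in> {a..b}" for x
    using sol that by (simp add: is_solution_def)
  have \<phi>0: "\<phi> 0 = L1_norm a b (\<lambda>x. u0 x - v x)"
    unfolding \<phi>_def L1_norm_def by (rule Bochner_Integration.integral_cong) (use init in auto)
  have traj: "\<exists>w. energy_trajectory a b \<epsilon> \<kappa> \<tau> Q (Q_tilde Q) F (deriv F) u ?ux w" if "0 < \<tau>" for \<tau>
    by (rule solution_energy_trajectory[OF \<open>a < b\<close> eps that sol])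
  have prof: "profile a b \<epsilon> (u \<tau>) (?ux \<tau>)" if "0 \<le> \<tau>" for \<tau>
  proof -
    have "0 < \<tau> + 1"
      using that by simp
    from traj[OF this] obtain w where
      "energy_trajectory a b \<epsilon> \<kappa> (\<tau> + 1) Q (Q_tilde Q) F (deriv F) u ?ux w"
      by blast
    then interpret energy_trajectory a b \<epsilon> \<kappa> "\<tau> + 1" Q "Q_tilde Q" F "deriv F" u ?ux w .
    show ?thesis
      unfolding profile_def using small u_deriv[of \<tau>] ux_cont[of \<tau>] ux_bound[of \<tau>] that by auto
  qed
  define e where "e = (\<lambda>\<tau>. integral {a..b} (energy_density \<epsilon> (u \<tau>) (?ux \<tau>)))"
  have e0: "e 0 \<le> c + B1"
  proof -
    have "energy Q F a b \<epsilon> (u 0) = energy Q F a b \<epsilon> u0"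
      by (rule energy_cong[OF \<open>a < b\<close> init])
    with upper energy_eq_integral_energy_density[OF \<open>a < b\<close> prof[OF order_refl]] show ?thesis
      by (simp add: e_def)
  qed
  have near: "\<phi> \<tau> \<le> \<phi> 0 + ?bd" if \<tau>: "0 \<le> \<tau>" "\<tau> \<le> T" and "\<phi> \<tau> \<le> \<delta>" for \<tau>
  proof (cases "\<tau> = 0")
    case True
    have "0 \<le> ?bd"
      using \<open>a < b\<close> \<open>0 < \<mu>\<close> \<open>0 < T\<close> eps \<open>0 \<le> B1\<close> \<open>0 \<le> B2\<close> by (intro add_nonneg_nonneg mult_nonneg_nonneg divide_nonneg_nonneg) auto
    with True show ?thesis
      by simp
  next
    case False
    with \<tau> obtain w where "energy_trajectory a b \<epsilon> \<kappa> \<tau> Q (Q_tilde Q) F (deriv F) u ?ux w"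
      using traj[of \<tau>] by auto
    then interpret energy_trajectory a b \<epsilon> \<kappa> \<tau> Q "Q_tilde Q" F "deriv F" u ?ux w .
    have en: "en s = e s" if "s \<in> {0..\<tau>}" for s
      unfolding en_def e_def energy_density_def
      by (rule continuous_integrable_Ioo(2)) (rule en_integrable[OF that])
    have le: "e \<tau> \<le> e 0"
      using energy_nonincreasing[OF \<tau>(1)] en \<tau> by simp
    have "c - B2 \<le> e \<tau>"
      unfolding e_def
      by (rule lower[OF prof[OF \<tau>(1)]]) (use \<open>\<phi> \<tau> \<le> \<delta>\<close> le e0 in \<open>auto simp: \<phi>_def e_def\<close>)
    then have drop: "en 0 - en \<tau> \<le> B1 + B2"
      using e0 en \<tau> by simp
    have "\<phi> \<tau> \<le> (\<integral>x. \<bar>u \<tau> x - u 0 x\<bar> \<partial>lebesgue_on {a<..<b}) + \<phi> 0"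
      using L1_distance_triangle[OF v, of 0 \<tau>] \<tau> by (simp add: \<phi>_def L1_norm_def)
    also have "(\<integral>x. \<bar>u \<tau> x - u 0 x\<bar> \<partial>lebesgue_on {a<..<b}) \<le> (b - a) * \<mu> * \<tau> / 2 + \<epsilon> / (2 * \<mu>) * (en 0 - en \<tau>)"
      by (rule L1_displacement_le_dissipation[OF \<tau>(1) \<open>0 < \<mu>\<close>])
    also have "\<dots> \<le> ?bd"
      using \<open>a < b\<close> \<open>0 < \<mu>\<close> eps \<tau> drop
      by (intro add_mono divide_right_mono mult_left_mono) auto
    finally show ?thesis
      by simp
  qed
  have "\<phi> t \<le> \<delta>"
  proof (rule ccontr)
    assume "\<not> \<phi> t \<le> \<delta>"
    obtain w where "energy_trajectory a b \<epsilon> \<kappa> T Q (Q_tilde Q) F (deriv F) u ?ux w"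
      using traj[OF \<open>0 < T\<close>] by auto
    then interpret energy_trajectory a b \<epsilon> \<kappa> T Q "Q_tilde Q" F "deriv F" u ?ux w .
    have "continuous_on {0..T} \<phi>"
      using L1_distance_continuous[OF v] by (simp add: \<phi>_def L1_norm_def)
    then have cont: "continuous_on {0..t} \<phi>"
      by (rule continuous_on_subset) (use t in auto)
    have "\<phi> 0 + 0 \<le> \<phi> 0 + ?bd"
      using \<open>a < b\<close> \<open>0 < \<mu>\<close> \<open>0 < T\<close> eps \<open>0 \<le> B1\<close> \<open>0 \<le> B2\<close>
      by (intro add_mono order_refl add_nonneg_nonneg mult_nonneg_nonneg divide_nonneg_nonneg) auto
    then have "\<phi> 0 \<le> \<delta>"
      using close \<phi>0 by simp
    then obtain \<tau> where \<tau>: "0 \<le> \<tau>" "\<tau> \<le> t" "\<phi> \<tau> = \<delta>"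
      using IVT'[of \<phi> 0 \<delta> t] \<open>\<not> \<phi> t \<le> \<delta>\<close> t cont by auto
    with near[of \<tau>] close \<phi>0 t show False
      by simp
  qed
  with near[of t] t \<phi>0 show ?thesis
    by (simp add: \<phi>_def)
qed

end

theorem theorem4:
  fixes a b \<kappa> \<theta> r :: real
    and Q F v :: "real \<Rightarrow> real"
    and N j :: nat
    and h :: "nat \<Rightarrow> real"
    and u\<^sub>0 :: "real \<Rightarrow> real \<Rightarrow> real"
    and u :: "real \<Rightarrow> real \<Rightarrow> real \<Rightarrow> real"
  assumes "a < b"
    and "admissible_Q Q \<kappa>"
    and "\<theta> > 2"
    and "admissible_F F \<theta>"
    and "step_function a b N h r v"
    and "j \<ge> 1"
    and "\<forall>\<^sub>F \<epsilon> in at_right 0. is_solution Q \<kappa> F a b \<epsilon> (u\<^sub>0 \<epsilon>) (u \<epsilon>)"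
    and "((\<lambda>\<epsilon>. L1_norm a b (\<lambda>x. u\<^sub>0 \<epsilon> x - v x)) \<longlongrightarrow> 0) (at_right 0)"
    and "\<exists>C>0. \<exists>\<epsilon>\<^sub>0>0. \<forall>\<epsilon>\<in>{0<..<\<epsilon>\<^sub>0}.
           energy Q F a b \<epsilon> (u\<^sub>0 \<epsilon>) \<le> real N * c_eps Q \<kappa> F \<epsilon> + C * \<epsilon> powr k_exp \<theta> j"
  shows "\<forall>l>0. ((\<lambda>\<epsilon>. SUP t\<in>{0..l * \<epsilon> powr (- k_exp \<theta> j)}.
                   ereal (L1_norm a b (\<lambda>x. u \<epsilon> t x - v x))) \<longlongrightarrow> 0) (at_right 0)"
proof (intro allI impI)
  fix l :: real
  assume "0 < l"
  interpret admissible_nonlinearities Q \<kappa> F \<theta>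
    using assms(2-4) by unfold_locales
  let ?k = "k_exp \<theta> j"
  obtain C \<epsilon>0 where C: "0 < C" and \<epsilon>0: "0 < \<epsilon>0" "\<And>\<epsilon>. \<epsilon> \<in> {0<..<\<epsilon>0} \<Longrightarrow>
      energy Q F a b \<epsilon> (u\<^sub>0 \<epsilon>) \<le> real N * c_eps Q \<kappa> F \<epsilon> + C * \<epsilon> powr ?k"
    using assms(9) by blast
  obtain \<delta> K e where \<delta>: "0 < \<delta>" and K: "0 \<le> K" and e: "0 < e" "\<And>\<epsilon> f f'. \<epsilon> \<in> {0<..<e} \<Longrightarrow>
      profile a b \<epsilon> f f' \<Longrightarrow> L1_norm a b (\<lambda>x. f x - v x) \<le> \<delta> \<Longrightarrow>
      integral {a..b} (energy_density \<epsilon> f f') \<le> real N * c_eps Q \<kappa> F \<epsilon> + C * \<epsilon> powr ?k \<Longrightarrow>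
      real N * c_eps Q \<kappa> F \<epsilon> - K * \<epsilon> powr ?k \<le> integral {a..b} (energy_density \<epsilon> f f')"
    using energy_lower_bound[OF assms(5), of C j] C by (auto simp: less_imp_le)
  obtain e' where e': "0 < e'" "\<And>\<epsilon>. \<epsilon> \<in> {0<..<e'} \<Longrightarrow> small \<epsilon>"
    using eventually_small by blast
  define m where "m = (b - a) * l / 2 + (C + K) / 2"
  define bd where "bd = (\<lambda>\<epsilon>. L1_norm a b (\<lambda>x. u\<^sub>0 \<epsilon> x - v x) + m * sqrt \<epsilon>)"
  have "(bd \<longlongrightarrow> 0 + m * sqrt 0) (at_right 0)"
    unfolding bd_def by (intro tendsto_intros assms(8))
  then have bd: "(bd \<longlongrightarrow> 0) (at_right 0)"
    by simp
  have "\<forall>\<^sub>F \<epsilon> in at_right 0. \<epsilon> \<in> {0<..<min \<epsilon>0 (min e e')}"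
    using \<epsilon>0(1) e(1) e'(1) by (intro eventually_at_rightI[of 0 "min \<epsilon>0 (min e e')"]) auto
  moreover have "\<forall>\<^sub>F \<epsilon> in at_right 0. bd \<epsilon> < \<delta>"
    by (rule order_tendstoD(2)[OF bd \<delta>])
  ultimately have upper: "\<forall>\<^sub>F \<epsilon> in at_right 0.
      (SUP t\<in>{0..l * \<epsilon> powr (- ?k)}. ereal (L1_norm a b (\<lambda>x. u \<epsilon> t x - v x))) \<le> ereal (bd \<epsilon>)"
    using assms(7)
  proof eventually_elim
    case (elim \<epsilon>)
    have eps: "0 < \<epsilon>"
      using elim(1) by auto
    define T where "T = l * \<epsilon> powr (- ?k)"
    \<comment> \<open>This choice makes both terms of the displacement bound multiples of \<open>sqrt \<epsilon>\<close>.\<close>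
    define \<mu> where "\<mu> = \<epsilon> powr ?k * sqrt \<epsilon>"
    have "0 < T" "0 < \<mu>"
      using \<open>0 < l\<close> eps by (auto simp: T_def \<mu>_def)
    have balance: "(b - a) * \<mu> * T / 2 + \<epsilon> / (2 * \<mu>) * (C * \<epsilon> powr ?k + K * \<epsilon> powr ?k) = m * sqrt \<epsilon>"
    proof -
      have "\<mu> * T = l * sqrt \<epsilon>"
        using eps by (simp add: \<mu>_def T_def powr_minus field_simps)
      then have "(b - a) * \<mu> * T / 2 = (b - a) * l / 2 * sqrt \<epsilon>"
        by (simp add: mult.assoc)
      moreover have "\<epsilon> / (2 * \<mu>) * (C * \<epsilon> powr ?k + K * \<epsilon> powr ?k) = (C + K) / 2 * sqrt \<epsilon>"
      proof -
        have "s * s / (2 * (q * s)) * (C * q + K * q) = (C + K) / 2 * s" if "0 < s" "0 < q" for s q :: real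
          using that by (simp add: field_simps)
        from this[of "sqrt \<epsilon>" "\<epsilon> powr ?k"] eps show ?thesis
          by (simp add: \<mu>_def)
      qed
      ultimately show ?thesis
        by (simp only: m_def distrib_right)
    qed
    have "L1_norm a b (\<lambda>x. u \<epsilon> t x - v x) \<le> bd \<epsilon>" if t: "t \<in> {0..T}" for t
      unfolding bd_def balance[symmetric]
    proof (rule L1_distance_while_near[OF assms(1) _ elim(3) step_function_integrable[OF assms(5)] \<open>0 < T\<close> \<open>0 < \<mu>\<close>])
      show "energy Q F a b \<epsilon> (u\<^sub>0 \<epsilon>) \<le> real N * c_eps Q \<kappa> F \<epsilon> + C * \<epsilon> powr ?k"
        using \<epsilon>0(2) elim(1) by auto
      show "L1_norm a b (\<lambda>x. u\<^sub>0 \<epsilon> x - v x) +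
          ((b - a) * \<mu> * T / 2 + \<epsilon> / (2 * \<mu>) * (C * \<epsilon> powr ?k + K * \<epsilon> powr ?k)) < \<delta>"
        using elim(2) unfolding balance bd_def .
      show "real N * c_eps Q \<kappa> F \<epsilon> - K * \<epsilon> powr ?k \<le> integral {a..b} (energy_density \<epsilon> f f')"
        if "profile a b \<epsilon> f f'" "L1_norm a b (\<lambda>x. f x - v x) \<le> \<delta>"
          "integral {a..b} (energy_density \<epsilon> f f') \<le> real N * c_eps Q \<kappa> F \<epsilon> + C * \<epsilon> powr ?k" for f f'
        by (rule e(2)[OF _ that]) (use elim(1) in auto)
      show "small \<epsilon>"
        using e'(2) elim(1) by auto
    qed (use C K t in auto)
    then show ?case
      unfolding T_def by (intro SUP_least) auto
  qed
  have lower: "0 \<le> (SUP t\<in>{0..l * \<epsilon> powr (- ?k)}. ereal (L1_norm a b (\<lambda>x. u \<epsilon> t x - v x)))" for \<epsilon>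
    by (rule SUP_upper2[of 0]) (use \<open>0 < l\<close> in \<open>auto simp: L1_norm_def\<close>)
  show "((\<lambda>\<epsilon>. SUP t\<in>{0..l * \<epsilon> powr (- ?k)}. ereal (L1_norm a b (\<lambda>x. u \<epsilon> t x - v x))) \<longlongrightarrow> 0) (at_right 0)"
  proof (rule tendsto_sandwich[OF _ upper tendsto_const])
    show "((\<lambda>\<epsilon>. ereal (bd \<epsilon>)) \<longlongrightarrow> 0) (at_right 0)"
      using tendsto_ereal[OF bd] by (simp add: zero_ereal_def)
  qed (use lower in \<open>auto intro: always_eventually\<close>)
qed

end
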